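(* Let $d\ge1$, $\mathcal{Y}\subseteq\mathbb{R}$, and let $O_i=(X_i,Y_i)$, $i=1,\dots,n$, be i.i.d. with distribution $P_0$ taking values in $\mathcal{O}\subseteq[0,1]^d\times\mathcal{Y}$. Let $\Theta$ be a set of càdlàg functions on $[0,1]^d$ with finite sectional variation norm, let $L:\Theta\to\mathbb{R}^{\mathcal{O}}$ be a loss mapping, and let $\theta_0=\arg\min_{\theta\in\Theta}P_0L(\theta)$. Let $(\Theta_n)_{n\ge1}$ be a sequence of subsets of $\Theta$, non-decreasing for inclusion, and let $(a_n)_{n\ge1}$ be a non-decreasing sequence of positive numbers (possibly diverging to $\infty$) with $a_n=O(n^p)$ for some $p>0$. For each $n$ let $\theta_n=\arg\min_{\theta\in\Theta_n}P_0L(\theta)$ and $\hat\theta_n=\arg\min_{\theta\in\Theta_n}P_nL(\theta)$. Assume: (1) For all $n\ge1$, $\Theta_n\subseteq\{\theta\in\mathbb{D}([0,1]^d):\|\theta\|_v\le a_n\}$. (2) There is $\tilde L:\mathbb{R}\times\mathcal{Y}\to\mathbb{R}$ such that for every $n$, every $\theta\in\Theta_n$ and every $(x,y)\in[0,1]^d\times\mathcal{Y}$, $L(\theta)(x,y)=\tilde L(\theta(x),y)$; moreover, for every $y$ there is $u_y$ such that $u\mapsto\tilde L(u,y)$ is non-increasing on $(-\infty,u_y]$, non-decreasing on $[u_y,\infty)$, and $a_n$-Lipschitz (for every $n$). (3) For every $n$ and every $\theta\in\Theta_n$, $\|L(\theta)-L(\theta_n)\|_{P_0,2}\le a_n\,d(\theta,\theta_n)$.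 Suppose also that $\theta_0\in\Theta_\infty=\{\theta\in\Theta:\exists n_0\text{ such that }\forall n\ge n_0,\ \theta\in\Theta_n\}$. Then $$d(\hat\theta_n,\theta_0)=O_P\left(a_n\,n^{-1/3}(\log n)^{2(d-1)/3}\right).$$
   Context: $\mathbb{D}([0,1]^d)$ is the set of real-valued càdlàg functions on $[0,1]^d$ (continuous from the upper-right quadrant at each point, with limits from all quadrants). For $\emptyset\ne s\subseteq[d]=\{1,\dots,d\}$ and $x\in[0,1]^d$ write $x_s=(x_j:j\in s)$, $x_{-s}=(x_j:j\notin s)$, and let $f_s:x_s\mapsto f(x_s,0_{-s})$ be the $s$-section of $f$. The sectional variation norm is $\|f\|_v=|f(0)|+\sum_{\emptyset\neq s\subseteq[d]}\int|f_s(dx_s)|$, where $f_s(dx_s)$ is the signed measure on $(0_s,1_s]$ generated by $f_s$ and $|f_s(dx_s)|$ its total variation measure. For a function $g$ on $\mathcal{O}$, $P_0g=E_{P_0}[g(O)]$, $P_ng=n^{-1}\sum_{i=1}^ng(O_i)$, and $\|g\|_{P_0,2}=(P_0g^2)^{1/2}$. The minimizers $\theta_0,\theta_n,\hat\theta_n$ are assumed to exist. The loss-based dissimilarity $d$ is the nonnegative quantity defined for $\theta\in\Theta_n$ by $d^2(\theta,\theta_n)=P_0L(\theta)-P_0L(\theta_n)$; similarly $d^2(\theta,\theta_0)=P_0L(\theta)-P_0L(\theta_0)$ (since $\theta_0\in\Theta_n$ for $n$ large, $\theta_0$ minimizes the risk over $\Theta_n$ for such $n$). $O_P$ is as $n\to\infty$.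 *)

theory Defs
  imports "HOL-Probability.Probability"
begin

section \<open>Cadlag functions on the unit cube\<close>

text \<open>
  The index type \<open>'d\<close> plays the role of \<open>{1,\<dots>,d}\<close>, so \<open>d = CARD('d)\<close>, and \<open>cbox 0 1\<close> is the
  unit cube.  The quadrant at \<open>x\<close> in direction \<open>t\<close> is closed below in the coordinates from \<open>t\<close>
  and open above in the others, so that the \<open>2 ^ d\<close> quadrants partition the cube.
\<close>

definition quadrant :: "'d set \<Rightarrow> real ^ 'd \<Rightarrow> (real ^ 'd::finite) set" where
  "quadrant t x = {y \<in> cbox 0 1. \<forall>j. if j \<in> t then x $ j \<le> y $ j else y $ j < x $ j}"

text \<open>
  Functions on the cube are represented by total functions with a fixed dummy value outside it
  (\<^const>\<open>extensional\<close>).  A limit along a quadrant not accumulating at \<open>x\<close> is a vacuous condition.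
\<close>

definition cadlag_cube :: "(real ^ 'd::finite \<Rightarrow> real) set" where
  "cadlag_cube = {f \<in> extensional (cbox 0 1). \<forall>x \<in> cbox 0 1.
     continuous (at x within quadrant UNIV x) f \<and>
     (\<forall>t. \<exists>l. (f \<longlongrightarrow> l) (at x within quadrant t x))}"


section \<open>Sectional variation norm\<close>

text \<open>
  The coordinates \<open>x\<^sub>s\<close> are identified with the point of \<open>real ^ 'd\<close> that agrees with \<open>x\<close> on \<open>s\<close>
  and vanishes off \<open>s\<close>; thus \<open>half_open_box s 0 1\<close> is \<open>(0\<^sub>s, 1\<^sub>s]\<close>, embedded as a face of the cube.
\<close>

definition section_of :: "'d set \<Rightarrow> (real ^ 'd \<Rightarrow> real) \<Rightarrow> real ^ 'd::finite \<Rightarrow> real" where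
  "section_of s f x = f (\<chi> j. if j \<in> s then x $ j else 0)"

definition half_open_box :: "'d set \<Rightarrow> real ^ 'd \<Rightarrow> real ^ 'd \<Rightarrow> (real ^ 'd::finite) set" where
  "half_open_box s a b = {x. \<forall>j. if j \<in> s then a $ j < x $ j \<and> x $ j \<le> b $ j else x $ j = 0}"

definition increment :: "'d set \<Rightarrow> (real ^ 'd \<Rightarrow> real) \<Rightarrow> real ^ 'd \<Rightarrow> real ^ 'd::finite \<Rightarrow> real" where
  "increment s g a b =
     (\<Sum>t \<in> Pow s. (- 1) ^ card t * g (\<chi> j. if j \<in> t then a $ j else b $ j))"

text \<open>Finite signed measures on the Borel subsets of \<open>A\<close>; \<open>\<mu> {} = 0\<close> follows by taking \<open>F = (\<lambda>_. {})\<close>.\<close>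

definition signed_measure_on :: "'a::topological_space set \<Rightarrow> ('a set \<Rightarrow> real) \<Rightarrow> bool" where
  "signed_measure_on A \<mu> \<longleftrightarrow>
     (\<forall>F :: nat \<Rightarrow> 'a set. (\<forall>i. F i \<in> sets borel \<and> F i \<subseteq> A) \<and> disjoint_family F \<longrightarrow>
        (\<lambda>i. \<mu> (F i)) sums \<mu> (\<Union>i. F i))"

definition total_variation :: "'a::topological_space set \<Rightarrow> ('a set \<Rightarrow> real) \<Rightarrow> ennreal" where
  "total_variation A \<mu> =
     (SUP P \<in> {P. finite P \<and> partition_on A P \<and> P \<subseteq> sets borel}. \<Sum>B\<in>P. ennreal \<bar>\<mu> B\<bar>)"

definition generates_signed_measure ::
    "'d set \<Rightarrow> (real ^ 'd \<Rightarrow> real) \<Rightarrow> ((real ^ 'd::finite) set \<Rightarrow> real) \<Rightarrow> bool" where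
  "generates_signed_measure s g \<mu> \<longleftrightarrow>
     signed_measure_on (half_open_box s 0 1) \<mu> \<and>
     (\<forall>a b. (\<forall>j\<in>s. 0 \<le> a $ j \<and> a $ j \<le> b $ j \<and> b $ j \<le> 1) \<longrightarrow>
        \<mu> (half_open_box s a b) = increment s g a b)"

text \<open>
  The generated signed measure is unique on Borel sets when it exists, so the infimum below is
  just its total variation; it is \<open>\<infinity>\<close> if no finite signed measure is generated.
\<close>

definition section_variation :: "'d set \<Rightarrow> (real ^ 'd::finite \<Rightarrow> real) \<Rightarrow> ennreal" where
  "section_variation s f =
     (INF \<mu> \<in> {\<mu>. generates_signed_measure s (section_of s f) \<mu>}.
        total_variation (half_open_box s 0 1) \<mu>)"

definition sectional_variation_norm :: "(real ^ 'd::finite \<Rightarrow> real) \<Rightarrow> ennreal" where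
  "sectional_variation_norm f =
     ennreal \<bar>f 0\<bar> + (\<Sum>s \<in> {s. s \<noteq> {}}. section_variation s f)"


section \<open>Risks and stochastic boundedness\<close>

definition risk :: "'o measure \<Rightarrow> ('t \<Rightarrow> 'o \<Rightarrow> real) \<Rightarrow> 't \<Rightarrow> real" where
  "risk P L \<theta> = (\<integral>z. L \<theta> z \<partial>P)"

definition empirical_risk :: "(nat \<Rightarrow> 'o) \<Rightarrow> nat \<Rightarrow> ('t \<Rightarrow> 'o \<Rightarrow> real) \<Rightarrow> 't \<Rightarrow> real" where
  "empirical_risk z n L \<theta> = (\<Sum>i = 1..n. L \<theta> (z i)) / real n"

definition norm_L2 :: "'o measure \<Rightarrow> ('o \<Rightarrow> real) \<Rightarrow> real" where
  "norm_L2 P g = sqrt (\<integral>z. (g z)\<^sup>2 \<partial>P)"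

definition loss_dissim :: "'o measure \<Rightarrow> ('t \<Rightarrow> 'o \<Rightarrow> real) \<Rightarrow> 't \<Rightarrow> 't \<Rightarrow> real" where
  "loss_dissim P L \<theta> \<theta>' = sqrt (risk P L \<theta> - risk P L \<theta>')"

text \<open>
  \<open>Z n = O\<^sub>P(r n)\<close>.  The outer measure is the ordinary probability whenever the event is
  measurable; it is used because a minimiser chosen separately for each sample need not depend
  measurably on it.
\<close>

definition bounded_in_prob :: "'w measure \<Rightarrow> (nat \<Rightarrow> 'w \<Rightarrow> real) \<Rightarrow> (nat \<Rightarrow> real) \<Rightarrow> bool" where
  "bounded_in_prob M Z r \<longleftrightarrow>
     (\<forall>\<epsilon>>0. \<exists>C>0. \<forall>\<^sub>F n in sequentially.
        outer_measure_of M {\<omega> \<in> space M. \<bar>Z n \<omega>\<bar> > C * r n} \<le> ennreal \<epsilon>)"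

end

theory Submission
  imports Defs "HOL-Real_Asymp.Real_Asymp"
begin

text \<open>
  A function of sectional variation norm at most \<open>a\<close> is \<open>x \<mapsto> \<mu> {c. c \<le> x}\<close> for a signed measure
  of total variation at most \<open>a\<close>.  The kernel \<open>1{c \<le> x}\<close> is expanded along nested binary trees, one
  for each coordinate, whose splits are medians of the distribution of the data conditionally on
  the cells already chosen.  This writes the function as a sum, over the shapes (tuples of depths in
  the trees), of step functions on at most \<open>2 ^ m\<close> disjoint cells of mass at most \<open>2 ^ -m\<close>, with
  coefficients bounded by \<open>a\<close> in \<open>\<ell>\<^sup>1\<close>, where \<open>m\<close> is the total depth; there are at most
  \<open>(m + 1) ^ (d - 1)\<close> shapes of total depth \<open>m\<close>.  Rounding the coefficients gives, for every
  distribution, nets of entropy \<open>2 ^ r * (log n) ^ (d - 1)\<close> and precision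
  \<open>a * 2 ^ -r * (log n) ^ (d - 1)\<close>.  Chaining with Bernstein's inequality from the scale
  \<open>2 ^ r = (n * (log n) ^ (d - 1)) powr (1 / 3)\<close> on bounds the empirical process over the losses, and
  the variance of the first link is absorbed by the excess risk.
\<close>

section \<open>Exponential inequalities and counting\<close>

text \<open>Write \<open>D\<close> for the number of shapes of one depth, of order
  \<open>(log n) ^ (d - 1)\<close>. The scale \<open>q = 2 ^ r\<close> of the first net balances its
  squared error \<open>(a * D / q) ^ 2\<close> against the price \<open>a ^ 2 * D * q / n\<close> of
  a union bound over it; so \<open>q ^ 3 = n * D\<close> and the rate is \<open>a * D / q\<close>.
  Chaining from scale 0 would cost an excess risk of order \<open>n powr (-1/2)\<close>, more than
  the squared rate, of order \<open>n powr (-2/3)\<close> up to logarithms; hence the first net is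
  compared with the optimum in one step, whose variance is controlled by the excess risk itself.
  Splits are made at medians because \<open>P0\<close> is arbitrary: cells lose mass with depth
  under every distribution. The obstacle is the deepest level, where the part of a cell below
  \<open>x\<close> varies with \<open>x\<close> and the class is too large for a union bound. Taking
  \<open>2 ^ J\<close> of order \<open>n ^ 3\<close> makes it unlikely that two observations share a
  cell, which bounds the empirical mass of that level for all functions at once. The rounding slope
  must then be small, since the uniform size of the links carries a factor of up to
  \<open>2 powr (J / 16)\<close>, a small power of \<open>n\<close>.\<close>

lemma exp_le_quadratic:
  fixes x :: real assumes "x \<le> 1" shows "exp x \<le> 1 + x + x\<^sup>2"
proof (cases "x \<ge> 0")
  case True thus ?thesis using exp_bound assms by auto
next
  case False
  define y where "y = - x"
  have y: "y \<ge> 0" using False by (simp add: y_def)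
  \<comment> \<open>The product of \<open>1 - y + y ^ 2\<close> with the minorant
    \<open>1 + y + y ^ 2 / 2\<close> of \<open>exp y\<close> has no negative terms left and stays
    above 1, which gives \<open>exp (- y) \<le> 1 - y + y ^ 2\<close>.\<close>
  have "1 \<le> 1 + (y\<^sup>2 + y ^ 3 + y ^ 4) / 2" using y by simp
  also have "\<dots> = (1 - y + y\<^sup>2) * (1 + y + y\<^sup>2 / 2)" by (simp add: field_simps eval_nat_numeral)
  also have "\<dots> \<le> (1 - y + y\<^sup>2) * exp y"
    using exp_lower_Taylor_quadratic[OF y] zero_le_power2[of "y - 1"] y
    by (intro mult_left_mono) (auto simp: power2_diff)
  finally show ?thesis by (simp add: y_def exp_minus field_simps)
qed

text \<open>Chernoff's method with the exponent \<open>l\<close> left free: the quadratic bound on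
  \<open>exp\<close> reduces the moment generating function to the mean plus \<open>l\<close> times
  the second moment. The links choose \<open>l\<close> to balance variance against range, the first
  net chooses it so that a fixed multiple of the variance remains. The confidence exponent is
  \<open>t\<close>.\<close>

lemma bernstein_upper:
  fixes M :: "'w measure" and P :: "'o measure"
  assumes M: "prob_space M" and P: "prob_space P"
    and indep: "prob_space.indep_vars M (\<lambda>_. P) X {1..}"
    and ident: "\<And>i. i \<ge> 1 \<Longrightarrow> distr M P (X i) = P"
    and g [measurable]: "g \<in> borel_measurable P"
    and b: "\<And>z. z \<in> space P \<Longrightarrow> \<bar>g z\<bar> \<le> b"
    and v: "(\<integral>z. (g z)\<^sup>2 \<partial>P) \<le> v"
    and l: "0 < l" "l * b \<le> 1" and n: "n \<ge> 1"
  shows "measure M {\<omega> \<in> space M. (\<integral>z. g z \<partial>P) + l * v + t / (real n * l) < (\<Sum>i = 1..n. g (X i \<omega>)) / real n}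
       \<le> exp (- t)"
proof -
  interpret M: prob_space M by fact
  interpret P: prob_space P by fact
  have X [measurable]: "X i \<in> measurable M P" if "i \<ge> 1" for i
    using indep that by (auto simp: M.indep_vars_def)
  have int: "integrable P f" if "f \<in> borel_measurable P" "\<And>z. z \<in> space P \<Longrightarrow> \<bar>f z\<bar> \<le> c" for f :: "'o \<Rightarrow> real" and c
    by (rule P.integrable_const_bound[where B = c]) (use that in auto)
  have ig: "integrable P g" by (rule int[OF g b])
  have "(g z)\<^sup>2 \<le> b\<^sup>2" if "z \<in> space P" for z
    using b[OF that] by (metis abs_le_square_iff abs_of_nonneg abs_ge_zero order_trans)
  then have ig2: "integrable P (\<lambda>z. (g z)\<^sup>2)"
    by (intro int[of _ "b\<^sup>2"]) auto
  have lg: "l * g z \<le> 1" if "z \<in> space P" for z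
    by (rule order_trans[OF mult_left_mono l(2)]) (use b[OF that] l in auto)
  then have ie: "integrable P (\<lambda>z. exp (l * g z))"
    by (intro int[of _ "exp 1"]) auto
  define E where "E = (\<integral>z. g z \<partial>P)"
  have "(\<integral>z. exp (l * g z) \<partial>P) \<le> (\<integral>z. 1 + l * g z + l\<^sup>2 * (g z)\<^sup>2 \<partial>P)"
    using ig ig2 ie exp_le_quadratic[OF lg]
    by (intro integral_mono) (auto simp: power_mult_distrib)
  also have "\<dots> = 1 + l * E + l\<^sup>2 * (\<integral>z. (g z)\<^sup>2 \<partial>P)"
    using ig ig2 by (simp add: E_def P.prob_space)
  also have "\<dots> \<le> 1 + (l * E + l\<^sup>2 * v)"
    using v by (simp add: mult_left_mono)
  also have "\<dots> \<le> exp (l * E + l\<^sup>2 * v)" by (rule exp_ge_add_one_self)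
  finally have mgf: "(\<integral>z. exp (l * g z) \<partial>P) \<le> exp (l * E + l\<^sup>2 * v)" .
  have iX: "(\<integral>\<omega>. exp (l * g (X i \<omega>)) \<partial>M) = (\<integral>z. exp (l * g z) \<partial>P)"
    and intX: "integrable M (\<lambda>\<omega>. exp (l * g (X i \<omega>)))" if "i \<ge> 1" for i
    using integral_distr[of "X i" M P "\<lambda>z. exp (l * g z)"] ident[OF that] X[OF that] ie
      integrable_distr[of "X i" M P "\<lambda>z. exp (l * g z)"] by simp_all
  have indep': "M.indep_vars (\<lambda>_. borel) (\<lambda>i \<omega>. exp (l * g (X i \<omega>))) {1..n}"
    by (rule M.indep_vars_compose2[OF M.indep_vars_subset[OF indep], of _ "\<lambda>_ z. exp (l * g z)"]) auto
  have iP: "integrable M (\<lambda>\<omega>. \<Prod>i\<in>{1..n}. exp (l * g (X i \<omega>)))"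
    by (rule M.indep_vars_integrable[OF _ indep']) (use intX in auto)
  have eP: "(\<integral>\<omega>. (\<Prod>i\<in>{1..n}. exp (l * g (X i \<omega>))) \<partial>M) = (\<Prod>i\<in>{1..n}. \<integral>\<omega>. exp (l * g (X i \<omega>)) \<partial>M)"
    by (rule M.indep_vars_lebesgue_integral[OF _ indep']) (use intX in auto)
  have "(\<Prod>i\<in>{1..n}. \<integral>\<omega>. exp (l * g (X i \<omega>)) \<partial>M) \<le> (\<Prod>i\<in>{1..n}. exp (l * E + l\<^sup>2 * v))"
    using iX mgf by (intro prod_mono) auto
  then have ub: "(\<integral>\<omega>. (\<Prod>i\<in>{1..n}. exp (l * g (X i \<omega>))) \<partial>M) \<le> exp (real n * (l * E + l\<^sup>2 * v))"
    unfolding eP by (simp add: exp_of_nat_mult)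
  \<comment> \<open>The threshold after multiplication by \<open>n * l\<close> and exponentiation.
    In Markov's inequality the mean and variance terms cancel against it and leave
    \<open>exp (- t)\<close>.\<close>
  define c where "c = exp (real n * l * (E + l * v + t / (real n * l)))"
  have "c > 0" by (simp add: c_def)
  have "measure M {\<omega> \<in> space M. E + l * v + t / (real n * l) < (\<Sum>i = 1..n. g (X i \<omega>)) / real n}
     \<le> measure M {\<omega> \<in> space M. (\<Prod>i\<in>{1..n}. exp (l * g (X i \<omega>))) \<ge> c}"
  proof (rule M.finite_measure_mono)
    show "{\<omega> \<in> space M. E + l * v + t / (real n * l) < (\<Sum>i = 1..n. g (X i \<omega>)) / real n}
      \<subseteq> {\<omega> \<in> space M. c \<le> (\<Prod>i\<in>{1..n}. exp (l * g (X i \<omega>)))}"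
    proof safe
      fix \<omega> assume *: "E + l * v + t / (real n * l) < (\<Sum>i = 1..n. g (X i \<omega>)) / real n"
      have "real n * l * (E + l * v + t / (real n * l)) \<le> real n * l * ((\<Sum>i = 1..n. g (X i \<omega>)) / real n)"
        using * l by (intro mult_left_mono) auto
      also have "\<dots> = (\<Sum>i = 1..n. l * g (X i \<omega>))" using n by (simp add: mult.assoc flip: sum_distrib_left)
      finally show "c \<le> (\<Prod>i\<in>{1..n}. exp (l * g (X i \<omega>)))"
        by (simp add: c_def exp_sum flip: exp_sum)
    qed
    show "{\<omega> \<in> space M. c \<le> (\<Prod>i\<in>{1..n}. exp (l * g (X i \<omega>)))} \<in> sets M"
      using iP by measurable
  qed
  also have "\<dots> \<le> (\<integral>\<omega>. (\<Prod>i\<in>{1..n}. exp (l * g (X i \<omega>))) \<partial>M) / c"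
    by (rule integral_Markov_inequality_measure[OF iP, of "{}"]) (use \<open>c > 0\<close> in \<open>auto intro!: AE_I2 prod_nonneg\<close>)
  also have "\<dots> \<le> exp (real n * (l * E + l\<^sup>2 * v)) / c"
    using ub \<open>c > 0\<close> by (simp add: divide_right_mono)
  also have "\<dots> = exp (- t)"
    using l n by (simp add: c_def flip: exp_diff) (simp add: field_simps power2_eq_square)
  finally show ?thesis by (simp add: E_def)
qed

section \<open>Counting integer vectors by their weighted l1 size\<close>

lemma sum_geometric_symmetric_le:
  fixes \<beta> :: real and k :: nat
  assumes "\<beta> > 0"
  shows "(\<Sum>j\<in>{- int k..int k}. exp (- \<beta> * \<bar>real_of_int j\<bar>)) \<le> 1 + 2 / (exp \<beta> - 1)"
proof -
  define q where "q = exp (- \<beta>)"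
  have q: "0 < q" "q < 1" using assms by (auto simp: q_def)
  have eq: "exp (- \<beta> * \<bar>real_of_int j\<bar>) = q ^ nat \<bar>j\<bar>" for j
    by (simp add: q_def exp_of_nat_mult[symmetric] mult.commute)
  have "(\<Sum>j\<in>{- int k..int k}. q ^ nat \<bar>j\<bar>) = 1 + 2 * (\<Sum>j\<in>{1..k}. q ^ j)"
  proof (induction k)
    case (Suc k)
    have "{- int (Suc k)..int (Suc k)} = insert (- int (Suc k)) (insert (int (Suc k)) {- int k..int k})" by auto
    then show ?case using Suc by (simp add: nat_add_distrib)
  qed simp
  also have "(\<Sum>j\<in>{1..k}. q ^ j) = q * (\<Sum>j<k. q ^ j)"
    by (simp add: sum_distrib_left sum.atLeast1_atMost_eq lessThan_Suc_atMost flip: power_Suc)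
  also have "(\<Sum>j<k. q ^ j) = (1 - q ^ k) / (1 - q)" using q by (simp add: sum_gp_strict)
  also have "q * \<dots> \<le> q * (1 / (1 - q))" using q by (intro mult_left_mono divide_right_mono) auto
  also have "q * (1 / (1 - q)) = 1 / (exp \<beta> - 1)"
    using assms by (simp add: q_def exp_minus field_simps)
  finally show ?thesis unfolding eq by simp
qed

text \<open>
  A Chernoff bound for the counting measure: each vector contributes at least \<open>1\<close> to
  \<open>exp S * (\<Sum>z. exp (- \<Sum>i. \<beta> i * \<bar>z i\<bar>))\<close>, and that sum factorises.
\<close>

lemma card_integer_vectors_le:
  fixes Z :: "('i \<Rightarrow> int) set" and \<beta> :: "'i \<Rightarrow> real"
  assumes I: "finite I" and Z: "Z \<subseteq> PiE I (\<lambda>_. UNIV)" and pos: "\<And>i. i \<in> I \<Longrightarrow> \<beta> i > 0"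
    and S: "\<And>z. z \<in> Z \<Longrightarrow> (\<Sum>i\<in>I. \<beta> i * \<bar>real_of_int (z i)\<bar>) \<le> S"
  shows "finite Z \<and> real (card Z) \<le> exp S * (\<Prod>i\<in>I. 1 + 2 / (exp (\<beta> i) - 1))"
proof -
  \<comment> \<open>The side lengths of a finite box containing \<open>Z\<close>. They disappear
    from the estimate because each coordinate sum over the box is bounded by its full geometric
    series.\<close>
  define k where "k = (\<lambda>i. nat \<lceil>S / \<beta> i\<rceil>)"
  have sub: "Z \<subseteq> PiE I (\<lambda>i. {- int (k i)..int (k i)})"
  proof
    fix z assume z: "z \<in> Z"
    have "z i \<in> {- int (k i)..int (k i)}" if i: "i \<in> I" for i
    proof -
      have "\<beta> i * \<bar>real_of_int (z i)\<bar> \<le> (\<Sum>i\<in>I. \<beta> i * \<bar>real_of_int (z i)\<bar>)"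
        using pos by (intro member_le_sum I i) (auto simp: less_imp_le)
      also note S[OF z]
      finally have "\<bar>real_of_int (z i)\<bar> \<le> S / \<beta> i" using pos[OF i] by (simp add: field_simps)
      then have "\<bar>z i\<bar> \<le> \<lceil>S / \<beta> i\<rceil>" by linarith
      then show ?thesis unfolding k_def by simp linarith
    qed
    then show "z \<in> PiE I (\<lambda>i. {- int (k i)..int (k i)})" using z Z by (auto simp: PiE_iff)
  qed
  have fin: "finite (PiE I (\<lambda>i. {- int (k i)..int (k i)}))" using I by (intro finite_PiE) auto
  have "real (card Z) = (\<Sum>z\<in>Z. 1)" by simp
  also have "\<dots> \<le> (\<Sum>z\<in>Z. exp S * (\<Prod>i\<in>I. exp (- \<beta> i * \<bar>real_of_int (z i)\<bar>)))"
  proof (rule sum_mono)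
    fix z assume "z \<in> Z"
    then have "0 \<le> S - (\<Sum>i\<in>I. \<beta> i * \<bar>real_of_int (z i)\<bar>)" using S by simp
    then have "1 \<le> exp (S - (\<Sum>i\<in>I. \<beta> i * \<bar>real_of_int (z i)\<bar>))" by simp
    also have "\<dots> = exp (S + (\<Sum>i\<in>I. - \<beta> i * \<bar>real_of_int (z i)\<bar>))" by (simp add: sum_negf)
    also have "\<dots> = exp S * (\<Prod>i\<in>I. exp (- \<beta> i * \<bar>real_of_int (z i)\<bar>))"
      using I by (simp only: exp_add exp_sum)
    finally show "1 \<le> exp S * (\<Prod>i\<in>I. exp (- \<beta> i * \<bar>real_of_int (z i)\<bar>))" .
  qed
  also have "\<dots> \<le> (\<Sum>z\<in>PiE I (\<lambda>i. {- int (k i)..int (k i)}). exp S * (\<Prod>i\<in>I. exp (- \<beta> i * \<bar>real_of_int (z i)\<bar>)))"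
    by (intro sum_mono2 fin sub mult_nonneg_nonneg prod_nonneg) auto
  also have "\<dots> = exp S * (\<Prod>i\<in>I. \<Sum>j\<in>{- int (k i)..int (k i)}. exp (- \<beta> i * \<bar>real_of_int j\<bar>))"
    using I by (subst prod_sum_PiE) (auto simp: sum_distrib_left)
  also have "\<dots> \<le> exp S * (\<Prod>i\<in>I. 1 + 2 / (exp (\<beta> i) - 1))"
    using pos sum_geometric_symmetric_le by (intro mult_left_mono prod_mono) (auto intro: sum_nonneg)
  finally show ?thesis using finite_subset[OF sub fin] by auto
qed

section \<open>Trees of median splits\<close>

lemma sets_Collect_subset:
  assumes "S \<in> sets M" "{x \<in> space M. Q x} \<in> sets M"
  shows "{x \<in> S. Q x} \<in> sets M"
proof -
  have "{x \<in> S. Q x} = S \<inter> {x \<in> space M. Q x}"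
    using sets.sets_into_space[OF assms(1)] by auto
  then show ?thesis using assms by simp
qed

text \<open>Only open half spaces are bounded: if the median is an atom, a closed half may carry
  more than half of the mass. Points on the hyperplane go to the middle branch of the trees. The
  median is the infimum of the levels at which the distribution function reaches half of the mass of
  \<open>S\<close>; continuity of the measure from above and below gives the two bounds.\<close>

lemma (in finite_measure) median_exists:
  fixes f :: "'a \<Rightarrow> real"
  assumes f [measurable]: "f \<in> borel_measurable M" and S: "S \<in> sets M"
  shows "\<exists>m. measure M {x \<in> S. f x < m} \<le> measure M S / 2 \<and> measure M {x \<in> S. m < f x} \<le> measure M S / 2"
proof (cases "measure M S = 0")
  case True
  have "measure M {x \<in> S. f x < 0} \<le> measure M S" "measure M {x \<in> S. 0 < f x} \<le> measure M S"
    by (auto intro!: finite_measure_mono simp: S)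
  with True show ?thesis by (intro exI[of _ 0]) auto
next
  case False
  then have pos: "measure M S > 0" using zero_less_measure_iff by blast
  have ms1: "{x \<in> S. f x \<le> m} \<in> sets M" for m by (rule sets_Collect_subset[OF S]) measurable
  have ms2: "{x \<in> S. f x < m} \<in> sets M" for m by (rule sets_Collect_subset[OF S]) measurable
  have ms3: "{x \<in> S. m < f x} \<in> sets M" for m by (rule sets_Collect_subset[OF S]) measurable
  note ms = ms1 ms2 ms3
  define A where "A = {m. measure M {x \<in> S. f x \<le> m} \<ge> measure M S / 2}"
  have "(\<lambda>k. measure M {x \<in> S. f x \<le> real k}) \<longlonglongrightarrow> measure M (\<Union>k. {x \<in> S. f x \<le> real k})"
    by (intro finite_Lim_measure_incseq) (auto simp: ms incseq_def)
  moreover have "(\<Union>k. {x \<in> S. f x \<le> real k}) = S"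
  proof (intro equalityI subsetI)
    fix x assume "x \<in> S"
    obtain k where "f x \<le> real k" using real_arch_simple by blast
    with \<open>x \<in> S\<close> show "x \<in> (\<Union>k. {x \<in> S. f x \<le> real k})" by blast
  qed auto
  ultimately have "eventually (\<lambda>k. measure M {x \<in> S. f x \<le> real k} > measure M S / 2) sequentially"
    using pos by (intro order_tendstoD) auto
  from eventually_happens[OF this] obtain k where "real k \<in> A" unfolding A_def by (fastforce dest: less_imp_le)
  then have ne: "A \<noteq> {}" by auto
  have "(\<lambda>k. measure M {x \<in> S. f x \<le> - real k}) \<longlonglongrightarrow> measure M (\<Inter>k. {x \<in> S. f x \<le> - real k})"
    by (intro finite_Lim_measure_decseq) (auto simp: ms decseq_def)
  moreover have "(\<Inter>k. {x \<in> S. f x \<le> - real k}) = {}"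
  proof (rule equals0I)
    fix x assume x: "x \<in> (\<Inter>k. {x \<in> S. f x \<le> - real k})"
    obtain k where "- f x < real k" using reals_Archimedean2 by blast
    with x show False by (auto dest: spec[of _ k])
  qed
  ultimately have "eventually (\<lambda>k. measure M {x \<in> S. f x \<le> - real k} < measure M S / 2) sequentially"
    using pos by (intro order_tendstoD) auto
  from eventually_happens[OF this] obtain k' where k': "measure M {x \<in> S. f x \<le> - real k'} < measure M S / 2"
    by auto
  have mono: "measure M {x \<in> S. f x \<le> m} \<le> measure M {x \<in> S. f x \<le> m'}" if "m \<le> m'" for m m'
    using that by (intro finite_measure_mono) (auto simp: ms)
  have "- real k' \<le> m" if "m \<in> A" for m
  proof (rule ccontr)
    assume "\<not> ?thesis"
    with mono[of m "- real k'"] k' that show False by (auto simp: A_def)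
  qed
  then have bdd: "bdd_below A" by (auto simp: bdd_below_def)
  define m where "m = Inf A"
  have inA: "m' \<in> A" if "m' > m" for m'
  proof -
    have "Inf A < m'" using that by (simp add: m_def)
    from cInf_lessD[OF ne this] obtain u where "u \<in> A" "u < m'" by blast
    then show ?thesis using mono[of u m'] by (auto simp: A_def)
  qed
  have inv: "1 / real (Suc l) \<le> 1 / real (Suc k)" if "k \<le> l" for k l
    using that by (simp add: frac_le)
  have dec: "decseq (\<lambda>k. {x \<in> S. f x \<le> m + 1 / Suc k})"
    unfolding decseq_def by (intro allI impI Collect_mono conj_mono imp_refl) (use inv in \<open>smt (verit)\<close>)
  have inc: "incseq (\<lambda>k. {x \<in> S. f x \<le> m - 1 / Suc k})"
    unfolding incseq_def by (intro allI impI Collect_mono conj_mono imp_refl) (use inv in \<open>smt (verit)\<close>)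
  have "(\<lambda>k. measure M {x \<in> S. f x \<le> m + 1 / Suc k}) \<longlonglongrightarrow> measure M (\<Inter>k. {x \<in> S. f x \<le> m + 1 / Suc k})"
    by (rule finite_Lim_measure_decseq[OF _ dec]) (auto simp: ms)
  moreover have "(\<Inter>k. {x \<in> S. f x \<le> m + 1 / Suc k}) = {x \<in> S. f x \<le> m}"
  proof safe
    fix x assume "x \<in> (\<Inter>k. {x \<in> S. f x \<le> m + 1 / Suc k})"
    then have *: "f x - m \<le> 1 / Suc k" for k by (auto simp: algebra_simps)
    show "f x \<le> m"
      using LIMSEQ_le_const[OF LIMSEQ_inverse_real_of_nat, of "f x - m"] * by (auto simp: inverse_eq_divide)
  next
    fix x k assume "f x \<le> m"
    moreover have "1 / real (Suc k) > 0" by simp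
    ultimately show "f x \<le> m + 1 / real (Suc k)" by linarith
  qed auto
  ultimately have ge: "measure M S / 2 \<le> measure M {x \<in> S. f x \<le> m}"
    by (intro LIMSEQ_le_const) (use inA in \<open>auto simp: A_def\<close>)
  have eq: "measure M {x \<in> S. m < f x} = measure M S - measure M {x \<in> S. f x \<le> m}"
    by (subst finite_measure_Diff[symmetric]) (auto simp: ms S intro!: arg_cong[where f = "measure M"])
  have lim: "(\<lambda>k. measure M {x \<in> S. f x \<le> m - 1 / Suc k}) \<longlonglongrightarrow> measure M (\<Union>k. {x \<in> S. f x \<le> m - 1 / Suc k})"
    by (rule finite_Lim_measure_incseq[OF _ inc]) (auto simp: ms)
  have un: "(\<Union>k. {x \<in> S. f x \<le> m - 1 / Suc k}) = {x \<in> S. f x < m}"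
  proof safe
    fix x assume "f x < m" "x \<in> S"
    then obtain k where "inverse (real (Suc k)) < m - f x" using reals_Archimedean[of "m - f x"] by auto
    with \<open>x \<in> S\<close> show "x \<in> (\<Union>k. {x \<in> S. f x \<le> m - 1 / Suc k})" by (auto simp: inverse_eq_divide intro!: exI[of _ k])
  next
    fix x k assume "f x \<le> m - 1 / real (Suc k)"
    moreover have "1 / real (Suc k) > 0" by simp
    ultimately show "f x < m" by linarith
  qed
  have le: "measure M {x \<in> S. f x \<le> m - 1 / Suc k} \<le> measure M S / 2" for k
  proof (rule ccontr)
    assume "\<not> ?thesis"
    then have "m - 1 / Suc k \<in> A" by (auto simp: A_def)
    from cInf_lower[OF this bdd] have "m \<le> m - 1 / Suc k" by (simp only: m_def[symmetric])
    then show False by (simp add: field_simps)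
  qed
  have "measure M {x \<in> S. f x < m} \<le> measure M S / 2"
    by (rule LIMSEQ_le_const2[OF lim[unfolded un]]) (use le in blast)
  then show ?thesis using ge eq by (intro exI[of _ m]) auto
qed

definition tree_index :: "nat \<Rightarrow> nat \<Rightarrow> bool list list set" where
  "tree_index k J = {p. length p = k \<and> sum_list (map length p) \<le> J}"

abbreviation depth :: "bool list list \<Rightarrow> nat" where
  "depth p \<equiv> sum_list (map length p)"

text \<open>
  A pair \<open>c \<le> x\<close> (in the coordinates \<open>ks\<close>) is separated by exactly one cell \<open>B p \<times> R p\<close>.  The index \<open>p\<close>
  lists, for each coordinate, a path in a binary tree of median splits; cells of total depth \<open>J\<close>
  are not split any further.
\<close>

locale orthant_tree =
  fixes P :: "(real ^ 'd::finite) measure" and ks :: "'d list" and S :: "(real ^ 'd) set" and J :: nat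
    and R B :: "bool list list \<Rightarrow> (real ^ 'd) set"
  assumes R_sets: "R p \<in> sets borel" and R_subset: "R p \<subseteq> S" and B_sets: "B p \<in> sets borel"
    and mass: "p \<in> tree_index (length ks) J \<Longrightarrow> measure P (R p) \<le> measure P S / 2 ^ depth p"
    and R_disjoint: "p \<in> tree_index (length ks) J \<Longrightarrow> p' \<in> tree_index (length ks) J \<Longrightarrow> p \<noteq> p' \<Longrightarrow>
      map length p = map length p' \<Longrightarrow> R p \<inter> R p' = {}"
    and B_disjoint: "p \<in> tree_index (length ks) J \<Longrightarrow> p' \<in> tree_index (length ks) J \<Longrightarrow> p \<noteq> p' \<Longrightarrow>
      map length p = map length p' \<Longrightarrow> B p \<inter> B p' = {}"
    and cell_unique: "x \<in> S \<Longrightarrow> (\<And>i. i \<in> set ks \<Longrightarrow> c $ i \<le> x $ i) \<Longrightarrow>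
      \<exists>!p. p \<in> tree_index (length ks) J \<and> x \<in> R p \<and> c \<in> B p"
    and cell_below: "p \<in> tree_index (length ks) J \<Longrightarrow> depth p < J \<Longrightarrow> x \<in> R p \<Longrightarrow> c \<in> B p \<Longrightarrow>
      i \<in> set ks \<Longrightarrow> c $ i \<le> x $ i"
begin

lemmas tree = R_sets R_subset B_sets mass R_disjoint B_disjoint cell_unique cell_below

end

lemma tree_index_0: "tree_index k 0 = {replicate k []}"
proof -
  have "p = replicate k []" if "length p = k" "\<forall>x\<in>set p. x = []" for p :: "bool list list"
    using that by (metis replicate_eqI)
  then show ?thesis by (auto simp: tree_index_def)
qed

lemma tree_index_Nil: "tree_index 0 J = {[]}"
  by (auto simp: tree_index_def)

text \<open>With \<open>m\<close> the median in the first coordinate \<open>i\<close>, the relation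
  \<open>c $ i \<le> x $ i\<close> splits into three exclusive cases. If
  \<open>c $ i \<le> m\<close> and \<open>m \<le> x $ i\<close>, this coordinate is settled and the
  next one is treated with the same remaining depth. If both values exceed \<open>m\<close>, or both
  lie below it, the comparison is repeated in that half, with at most half of the mass and one unit
  of depth less. Hence an induction on the coordinates with an inner one on the depth.\<close>

lemma orthant_tree_exists:
  fixes P :: "(real ^ 'd::finite) measure"
  assumes P: "finite_measure P" "sets P = sets borel"
  shows "S \<in> sets borel \<Longrightarrow> \<exists>R B. orthant_tree P ks S J R B"
proof (induction ks arbitrary: S J)
  case Nil
  then show ?case
    by (intro exI[of _ "\<lambda>_. S"] exI[of _ "\<lambda>_. UNIV"]) (auto simp: orthant_tree_def tree_index_Nil)
next
  case (Cons i ks)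
  interpret finite_measure P by fact
  note [measurable_cong] = P(2)
  have [measurable]: "(\<lambda>x. x $ i) \<in> borel_measurable borel"
    by (intro borel_measurable_continuous_onI continuous_intros)
  show ?case using Cons.prems
  proof (induction J arbitrary: S)
    case 0
    \<comment> \<open>With no depth left the single cell contains every pair.
      \<open>cell_below\<close> is vacuous for it, which is why the expansion of a function has a
      remainder at depth \<open>J\<close>.\<close>
    then show ?case
      by (intro exI[of _ "\<lambda>_. S"] exI[of _ "\<lambda>_. UNIV"])
        (auto simp: orthant_tree_def tree_index_0 sum_list_replicate)
  next
    case (Suc J)
    note S = \<open>S \<in> sets borel\<close>
    obtain m where m: "measure P {x \<in> S. x $ i < m} \<le> measure P S / 2" "measure P {x \<in> S. m < x $ i} \<le> measure P S / 2"
      using median_exists[of "\<lambda>x. x $ i" S] S by (auto simp: P)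
    define H where "H = (\<lambda>b. if b then {x :: real ^ 'd. m < x $ i} else {x. x $ i < m})"
    have H: "H b \<in> sets borel" for b unfolding H_def by (cases b) (simp_all, measurable)
    have G: "{x :: real ^ 'd. m \<le> x $ i} \<in> sets borel" "{c :: real ^ 'd. c $ i \<le> m} \<in> sets borel" by measurable
    have mass: "measure P (S \<inter> H b) \<le> measure P S / 2" for b
      using m by (auto simp: H_def Int_def)
    obtain R0 B0 where 0: "orthant_tree P ks (S \<inter> {x. m \<le> x $ i}) (Suc J) R0 B0"
      using Cons.IH[OF sets.Int[OF S G(1)]] by blast
    have "\<exists>R B. orthant_tree P (i # ks) (S \<inter> H b) J R B" for b
      by (rule Suc.IH[OF sets.Int[OF S H]])
    then obtain R1 B1 where 1: "\<And>b. orthant_tree P (i # ks) (S \<inter> H b) J (R1 b) (B1 b)" by metis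
    \<comment> \<open>A leading bit \<open>b\<close> of the first path sends both points into the
      half \<open>H b\<close>; an empty first path passes to the remaining coordinates. For the
      latter, \<open>R\<close> already confines \<open>x\<close> to \<open>m \<le> x $ i\<close>
      through \<open>S\<close>, and \<open>B\<close> adds the matching constraint on
      \<open>c\<close>.\<close>
    define R where "R = (\<lambda>p. case p of (b # w) # ys \<Rightarrow> R1 b (w # ys) | [] # ys \<Rightarrow> R0 ys | [] \<Rightarrow> {})"
    define B where "B = (\<lambda>p. case p of (b # w) # ys \<Rightarrow> B1 b (w # ys) \<inter> H b | [] # ys \<Rightarrow> B0 ys \<inter> {c. c $ i \<le> m} | [] \<Rightarrow> {})"
    have idx: "(b # w) # ys \<in> tree_index (Suc k) (Suc J) \<longleftrightarrow> w # ys \<in> tree_index (Suc k) J"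
      "[] # ys \<in> tree_index (Suc k) (Suc J) \<longleftrightarrow> ys \<in> tree_index k (Suc J)"
      "[] \<in> tree_index (Suc k) (Suc J) \<longleftrightarrow> False" for b w ys k
      by (auto simp: tree_index_def)
    have RB: "R ([] # ys) = R0 ys" "R ((b # w) # ys) = R1 b (w # ys)"
      "B ([] # ys) = B0 ys \<inter> {c. c $ i \<le> m}" "B ((b # w) # ys) = B1 b (w # ys) \<inter> H b" for b w ys
      by (auto simp: R_def B_def)
    have cases: "(\<And>ys. p = [] # ys \<Longrightarrow> Q) \<Longrightarrow> (\<And>b w ys. p = (b # w) # ys \<Longrightarrow> Q) \<Longrightarrow> (p = [] \<Longrightarrow> Q) \<Longrightarrow> Q"
      for p :: "bool list list" and Q by (metis list.exhaust)
    note t0 = orthant_tree.tree[OF 0]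
      and t1 = orthant_tree.tree[OF 1, unfolded list.size add_0_right add_Suc_right]
    have sub: "R0 q \<subseteq> S" "R1 b q \<subseteq> S" for b q
      using t0(2)[of q] t1(2)[of b q] by blast+
    have c1: "R p \<in> sets borel" "R p \<subseteq> S" "B p \<in> sets borel" for p
      by (rule cases[of p]; simp add: RB sub t0(1,3) t1(1,3) G H sets.Int; simp add: R_def B_def)+
    have c2: "measure P (R p) \<le> measure P S / 2 ^ depth p" if "p \<in> tree_index (Suc (length ks)) (Suc J)" for p
    proof (rule cases[of p])
      fix ys assume [simp]: "p = [] # ys"
      have "measure P (R p) \<le> measure P (S \<inter> {x. m \<le> x $ i}) / 2 ^ depth ys"
        using t0(4)[of ys] that by (simp add: RB idx)
      also have "measure P (S \<inter> {x. m \<le> x $ i}) \<le> measure P S"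
        by (rule finite_measure_mono) (simp_all add: P S)
      finally show ?thesis by (auto simp: divide_right_mono)
    next
      fix b w ys assume [simp]: "p = (b # w) # ys"
      have "measure P (R p) \<le> measure P (S \<inter> H b) / 2 ^ depth (w # ys)"
        using t1(4)[of "w # ys"] that by (simp add: RB idx)
      also have "\<dots> \<le> (measure P S / 2) / 2 ^ depth (w # ys)" using mass by (intro divide_right_mono) auto
      finally show ?thesis by (simp add: field_simps)
    qed (use that in \<open>auto simp: tree_index_def\<close>)
    have c3: "R p \<inter> R p' = {} \<and> B p \<inter> B p' = {}"
      if "p \<in> tree_index (Suc (length ks)) (Suc J)" "p' \<in> tree_index (Suc (length ks)) (Suc J)" "p \<noteq> p'" "map length p = map length p'" for p p'
    proof (rule cases[of p]; rule cases[of p'])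
      fix ys ys' assume "p = [] # ys" "p' = [] # ys'"
      then show ?thesis using that t0(5,6)[of ys ys'] by (auto simp: RB idx)
    next
      fix b w ys b' w' ys' assume p: "p = (b # w) # ys" "p' = (b' # w') # ys'"
      show ?thesis
      proof (cases "b = b'")
        case True
        then have "R1 b (w # ys) \<inter> R1 b (w' # ys') = {} \<and> B1 b (w # ys) \<inter> B1 b (w' # ys') = {}"
          using that p t1(5,6)[of "w # ys" "w' # ys'"] by (simp add: idx)
        then show ?thesis using True p by (auto simp: RB)
      next
        case False
        then have "H b \<inter> H b' = {}" by (auto simp: H_def)
        then show ?thesis using t1(2)[of b "w # ys"] t1(2)[of b' "w' # ys'"] p by (auto simp: RB)
      qed
    qed (use that in \<open>auto simp: idx\<close>)
    have c4: "\<exists>!p. p \<in> tree_index (Suc (length ks)) (Suc J) \<and> x \<in> R p \<and> c \<in> B p"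
      if x: "x \<in> S" and le: "\<And>j. j \<in> set (i # ks) \<Longrightarrow> c $ j \<le> x $ j" for x c
    proof (cases "c $ i \<le> m \<and> m \<le> x $ i")
      case True
      then have "x \<in> S \<inter> {x. m \<le> x $ i}" using x by auto
      then have e: "\<exists>!p. p \<in> tree_index (length ks) (Suc J) \<and> x \<in> R0 p \<and> c \<in> B0 p"
        by (rule t0(7)) (use le in auto)
      obtain ys where ys: "ys \<in> tree_index (length ks) (Suc J)" "x \<in> R0 ys" "c \<in> B0 ys"
        using ex1_implies_ex[OF e] by blast
      have u: "ys' = ys" if "ys' \<in> tree_index (length ks) (Suc J)" "x \<in> R0 ys'" "c \<in> B0 ys'" for ys'
        using e ys that by blast
      show ?thesis
      proof (rule ex1I[of _ "[] # ys"])
        fix p assume *: "p \<in> tree_index (Suc (length ks)) (Suc J) \<and> x \<in> R p \<and> c \<in> B p"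
        show "p = [] # ys"
        proof (rule cases[of p])
          fix b w ys' assume [simp]: "p = (b # w) # ys'"
          have "x \<in> H b" "c \<in> H b" using * t1(2)[of b "w # ys'"] by (auto simp: RB)
          with True show ?thesis by (auto simp: H_def split: if_splits)
        qed (use * in \<open>auto simp: RB idx intro: u\<close>)
      qed (use ys True in \<open>auto simp: RB idx\<close>)
    next
      case False
      \<comment> \<open>Outside the middle case one bit serves both points: \<open>m < c $ i\<close>
        forces \<open>x\<close> into the upper half since \<open>c $ i \<le> x $ i\<close>, and
        otherwise \<open>x $ i < m\<close> forces \<open>c\<close> into the lower half.\<close>
      define b where "b = (m < c $ i)"
      have xc: "x \<in> H b" "c \<in> H b" using False le[of i] by (auto simp: H_def b_def)
      then have "x \<in> S \<inter> H b" using x by auto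
      then have e: "\<exists>!p. p \<in> tree_index (Suc (length ks)) J \<and> x \<in> R1 b p \<and> c \<in> B1 b p"
        by (rule t1(7)) (use le in auto)
      obtain zs where zs: "zs \<in> tree_index (Suc (length ks)) J" "x \<in> R1 b zs" "c \<in> B1 b zs"
        using ex1_implies_ex[OF e] by blast
      have u: "zs' = zs" if "zs' \<in> tree_index (Suc (length ks)) J" "x \<in> R1 b zs'" "c \<in> B1 b zs'" for zs'
        using e zs that by blast
      obtain w0 ys0 where n: "zs = w0 # ys0" using zs(1) by (cases zs) (auto simp: tree_index_def)
      show ?thesis
      proof (rule ex1I[of _ "(b # w0) # ys0"])
        fix p assume *: "p \<in> tree_index (Suc (length ks)) (Suc J) \<and> x \<in> R p \<and> c \<in> B p"
        show "p = (b # w0) # ys0"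
        proof (rule cases[of p])
          fix ys' assume [simp]: "p = [] # ys'"
          have "m \<le> x $ i" using * t0(2)[of "ys'"] by (auto simp: RB)
          with False * show ?thesis by (auto simp: RB)
        next
          fix b' w ys' assume [simp]: "p = (b' # w) # ys'"
          have "c \<in> H b'" using * by (auto simp: RB)
          with xc have [simp]: "b' = b" by (auto simp: H_def split: if_splits)
          show ?thesis using * u[of "w # ys'"] n by (auto simp: RB idx)
        qed (use * in \<open>auto simp: idx\<close>)
      qed (use zs n xc in \<open>auto simp: RB idx\<close>)
    qed
    have c5: "c $ j \<le> x $ j"
      if "p \<in> tree_index (Suc (length ks)) (Suc J)" "depth p < Suc J" "x \<in> R p" "c \<in> B p" "j \<in> set (i # ks)" for p x c j
    proof (rule cases[of p])
      fix ys assume [simp]: "p = [] # ys"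
      have "m \<le> x $ i" using that t0(2)[of ys] by (auto simp: RB)
      then show ?thesis using that t0(8)[of ys x c j] by (auto simp: RB idx)
    next
      fix b w ys assume [simp]: "p = (b # w) # ys"
      show ?thesis using that t1(8)[of "w # ys" x b c j] by (auto simp: RB idx)
    qed (use that in \<open>auto simp: idx\<close>)
    have "orthant_tree P (i # ks) S (Suc J) R B"
      by (rule orthant_tree.intro; (unfold list.size add_0_right add_Suc_right)?;
          (rule c1 c2 c3[THEN conjunct1] c3[THEN conjunct2] c4 c5; assumption))
    then show ?case by blast
  qed
qed

section \<open>Functions of bounded sectional variation\<close>

text \<open>Finite additivity is all that the expansion below needs, so no Jordan decomposition is used.\<close>

definition bounded_charge :: "('a::topological_space set \<Rightarrow> real) \<Rightarrow> real \<Rightarrow> bool" where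
  "bounded_charge \<mu> A \<longleftrightarrow>
     (\<forall>S\<in>sets borel. \<forall>T\<in>sets borel. S \<inter> T = {} \<longrightarrow> \<mu> (S \<union> T) = \<mu> S + \<mu> T) \<and>
     (\<forall>\<B>. finite \<B> \<longrightarrow> disjoint \<B> \<longrightarrow> \<B> \<subseteq> sets borel \<longrightarrow> (\<Sum>B\<in>\<B>. \<bar>\<mu> B\<bar>) \<le> A)"

lemma bounded_charge_empty: "bounded_charge \<mu> A \<Longrightarrow> \<mu> {} = 0"
  unfolding bounded_charge_def by (metis Int_empty_left Un_empty_left add_cancel_right_left sets.empty_sets)

lemma bounded_charge_UN:
  assumes \<mu>: "bounded_charge \<mu> A" and K: "finite K" and "disjoint_family_on B K" "\<And>k. k \<in> K \<Longrightarrow> B k \<in> sets borel"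
  shows "\<mu> (\<Union>k\<in>K. B k) = (\<Sum>k\<in>K. \<mu> (B k))"
  using K assms(3,4)
proof (induction K rule: finite_induct)
  case empty
  then show ?case using bounded_charge_empty[OF \<mu>] by simp
next
  case (insert k K)
  have "B k \<inter> (\<Union>k\<in>K. B k) = {}"
    using insert by (auto simp: disjoint_family_on_def)
  moreover have "(\<Union>k\<in>K. B k) \<in> sets borel" using insert by auto
  ultimately have "\<mu> (B k \<union> (\<Union>k\<in>K. B k)) = \<mu> (B k) + \<mu> (\<Union>k\<in>K. B k)"
    using \<mu> insert.prems by (auto simp: bounded_charge_def)
  with insert show ?case by (simp add: disjoint_family_on_mono[of K "insert k K"] subset_insertI)
qed

lemma bounded_charge_sum_le:
  assumes \<mu>: "bounded_charge \<mu> A" and K: "finite K" and d: "disjoint_family_on B K" and b: "\<And>k. k \<in> K \<Longrightarrow> B k \<in> sets borel"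
  shows "(\<Sum>k\<in>K. \<bar>\<mu> (B k)\<bar>) \<le> A"
proof -
  have "(\<Sum>k\<in>K. \<bar>\<mu> (B k)\<bar>) = (\<Sum>C\<in>B ` K. \<bar>\<mu> C\<bar>)"
  proof (rule sum.reindex_nontrivial[symmetric, unfolded comp_def])
    fix x y assume "x \<in> K" "y \<in> K" "x \<noteq> y" "B x = B y"
    then have "B x = {}" using d by (auto simp: disjoint_family_on_def)
    then show "\<bar>\<mu> (B x)\<bar> = 0" using bounded_charge_empty[OF \<mu>] by simp
  qed (rule K)
  also have "disjoint (B ` K)"
    using d by (rule disjoint_family_on_disjoint_image)
  then have "(\<Sum>C\<in>B ` K. \<bar>\<mu> C\<bar>) \<le> A"
    using \<mu> K b unfolding bounded_charge_def by blast
  finally show ?thesis .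
qed

lemma bounded_charge_sum:
  fixes \<mu> :: "'s \<Rightarrow> 'a::topological_space set \<Rightarrow> real"
  assumes "finite I" "\<And>s. s \<in> I \<Longrightarrow> bounded_charge (\<mu> s) (A s)"
  shows "bounded_charge (\<lambda>B. \<Sum>s\<in>I. \<mu> s B) (\<Sum>s\<in>I. A s)"
  unfolding bounded_charge_def
proof (intro conjI ballI allI impI)
  fix S T :: "'a set" assume "S \<in> sets borel" "T \<in> sets borel" "S \<inter> T = {}"
  then show "(\<Sum>s\<in>I. \<mu> s (S \<union> T)) = (\<Sum>s\<in>I. \<mu> s S) + (\<Sum>s\<in>I. \<mu> s T)"
    using assms(2) by (simp add: bounded_charge_def flip: sum.distrib)
next
  fix \<B> :: "'a set set" assume B: "finite \<B>" "disjoint \<B>" "\<B> \<subseteq> sets borel"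
  have "(\<Sum>B\<in>\<B>. \<bar>\<Sum>s\<in>I. \<mu> s B\<bar>) \<le> (\<Sum>B\<in>\<B>. \<Sum>s\<in>I. \<bar>\<mu> s B\<bar>)"
    by (intro sum_mono sum_abs)
  also have "\<dots> = (\<Sum>s\<in>I. \<Sum>B\<in>\<B>. \<bar>\<mu> s B\<bar>)" by (rule sum.swap)
  also have "\<dots> \<le> (\<Sum>s\<in>I. A s)"
    using assms(2) B by (intro sum_mono) (auto simp: bounded_charge_def)
  finally show "(\<Sum>B\<in>\<B>. \<bar>\<Sum>s\<in>I. \<mu> s B\<bar>) \<le> (\<Sum>s\<in>I. A s)" .
qed

section \<open>From the sections of a function to one charge on the cube\<close>

lemma bounded_charge_signed_measure:
  fixes \<mu> :: "'a::topological_space set \<Rightarrow> real"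
  assumes \<mu>: "signed_measure_on D \<mu>" and D: "D \<in> sets borel" and tv: "total_variation D \<mu> \<le> ennreal A" and A: "A \<ge> 0"
  shows "bounded_charge (\<lambda>B. \<mu> (B \<inter> D)) A"
proof -
  have sums: "(\<lambda>i. \<mu> (F i)) sums \<mu> (\<Union>i. F i)" if "\<And>i. F i \<in> sets borel \<and> F i \<subseteq> D" "disjoint_family F" for F :: "nat \<Rightarrow> 'a set"
    using \<mu> that unfolding signed_measure_on_def by blast
  have e: "\<mu> {} = 0"
  proof -
    have "(\<lambda>_::nat. \<mu> {}) sums \<mu> (\<Union>i::nat. {})" by (rule sums) (auto simp: disjoint_family_on_def)
    then have "summable (\<lambda>_::nat. \<mu> {})" by (rule sums_summable)
    then show ?thesis by (simp add: summable_const_iff)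
  qed
  show ?thesis
    unfolding bounded_charge_def
  proof (intro conjI ballI allI impI)
    fix S T :: "'a set" assume ST: "S \<in> sets borel" "T \<in> sets borel" "S \<inter> T = {}"
    define F where "F = (\<lambda>i::nat. if i = 0 then S \<inter> D else if i = 1 then T \<inter> D else {})"
    have "(\<lambda>i. \<mu> (F i)) sums \<mu> (\<Union>i. F i)"
      by (rule sums) (use ST D in \<open>auto simp: disjoint_family_on_def F_def\<close>)
    moreover have "(\<Union>i. F i) = (S \<union> T) \<inter> D" by (auto simp: F_def split: if_splits)
    moreover have "(\<lambda>i. \<mu> (F i)) sums (\<Sum>i\<in>{0,1}. \<mu> (F i))"
      by (rule sums_finite) (auto simp: F_def e)
    ultimately show "\<mu> ((S \<union> T) \<inter> D) = \<mu> (S \<inter> D) + \<mu> (T \<inter> D)"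
      by (auto simp: F_def dest: sums_unique2)
  next
    fix \<B> :: "'a set set" assume B: "finite \<B>" "disjoint \<B>" "\<B> \<subseteq> sets borel"
    \<comment> \<open>Total variation is a supremum over partitions of all of \<open>D\<close>, so
      the disjoint family is completed by what it leaves of \<open>D\<close>; empty traces are
      dropped because the blocks of a partition are nonempty.\<close>
    define P where "P = insert (D - \<Union>\<B>) ((\<lambda>B. B \<inter> D) ` \<B>) - {{}}"
    have P: "finite P" "P \<subseteq> sets borel" using B D by (auto simp: P_def intro!: sets.Diff sets.finite_Union)
    have dis: "disjoint ((\<lambda>B. B \<inter> D) ` \<B>)"
      using B(2) by (fastforce simp: disjoint_def)
    have "partition_on D P"
      unfolding partition_on_def
    proof (intro conjI)
      show "\<Union>P = D" unfolding P_def by blast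
      show "disjoint P" unfolding P_def using dis by (fastforce simp: disjoint_def)
    qed (auto simp: P_def)
    then have "(\<Sum>B\<in>P. ennreal \<bar>\<mu> B\<bar>) \<le> total_variation D \<mu>"
      unfolding total_variation_def using P by (intro SUP_upper) auto
    also note tv
    finally have "(\<Sum>B\<in>P. \<bar>\<mu> B\<bar>) \<le> A" using A by (simp add: sum_ennreal)
    have "(\<Sum>B\<in>\<B>. \<bar>\<mu> (B \<inter> D)\<bar>) = (\<Sum>C\<in>(\<lambda>B. B \<inter> D) ` \<B>. \<bar>\<mu> C\<bar>)"
    proof (rule sum.reindex_nontrivial[symmetric, unfolded comp_def])
      fix x y assume "x \<in> \<B>" "y \<in> \<B>" "x \<noteq> y" "x \<inter> D = y \<inter> D"
      then have "x \<inter> D = {}" using B(2) by (auto simp: disjoint_def)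
      then show "\<bar>\<mu> (x \<inter> D)\<bar> = 0" using e by simp
    qed (rule B)
    also have "\<dots> = (\<Sum>C\<in>(\<lambda>B. B \<inter> D) ` \<B> - {{}}. \<bar>\<mu> C\<bar>)"
      by (rule sum.mono_neutral_right) (use B e in auto)
    also have "\<dots> \<le> (\<Sum>C\<in>P. \<bar>\<mu> C\<bar>)"
      by (rule sum_mono2) (use P in \<open>auto simp: P_def\<close>)
    also have "\<dots> \<le> A" by fact
    finally show "(\<Sum>B\<in>\<B>. \<bar>\<mu> (B \<inter> D)\<bar>) \<le> A" .
  qed
qed

text \<open>Moebius inversion on the lattice of subsets. With \<open>F u\<close> the value of
  \<open>f\<close> at the point that keeps the coordinates of \<open>x\<close> in \<open>u\<close>
  and is 0 elsewhere, the inner sum is the increment of the \<open>s\<close>-section over the box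
  from 0 to \<open>x\<close>. So \<open>f x\<close> is the sum of these increments over all
  \<open>s\<close>, the empty set giving \<open>f 0\<close>.\<close>

lemma moebius_subsets:
  fixes F :: "'d::finite set \<Rightarrow> real"
  shows "(\<Sum>s\<in>UNIV. \<Sum>t\<in>Pow s. (- 1) ^ card t * F (s - t)) = F UNIV"
proof -
  have "(\<Sum>s\<in>UNIV. \<Sum>t\<in>Pow s. (- 1) ^ card t * F (s - t)) = (\<Sum>s\<in>UNIV. \<Sum>u\<in>Pow s. (- 1) ^ card (s - u) * F u)"
  proof (rule sum.cong[OF refl])
    fix s :: "'d set"
    show "(\<Sum>t\<in>Pow s. (- 1) ^ card t * F (s - t)) = (\<Sum>u\<in>Pow s. (- 1) ^ card (s - u) * F u)"
      by (rule sum.reindex_bij_witness[of _ "\<lambda>u. s - u" "\<lambda>u. s - u"]) (auto simp: double_diff)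
  qed
  also have "\<dots> = (\<Sum>s\<in>UNIV. \<Sum>u | u \<in> UNIV \<and> u \<subseteq> s. (- 1) ^ card (s - u) * F u)"
    by (intro sum.cong) auto
  also have "\<dots> = (\<Sum>u\<in>UNIV. \<Sum>s | s \<in> UNIV \<and> u \<subseteq> s. (- 1) ^ card (s - u) * F u)"
    by (rule sum.swap_restrict) auto
  also have "\<dots> = (\<Sum>u\<in>UNIV. if u = UNIV then F u else 0)"
  proof (rule sum.cong[OF refl])
    fix u :: "'d set"
    have "(\<Sum>s | s \<in> UNIV \<and> u \<subseteq> s. (- 1) ^ card (s - u) * F u) = (\<Sum>v\<in>Pow (- u). (- 1) ^ card v * F u)"
      by (rule sum.reindex_bij_witness[of _ "\<lambda>v. v \<union> u" "\<lambda>s. s - u"]) (auto intro!: arg_cong[where f = card])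
    also have "\<dots> = (\<Sum>v\<in>Pow (- u). (- 1) ^ card v) * F u" by (simp add: sum_distrib_right)
    also have "\<dots> = (if u = UNIV then F u else 0)"
    proof (cases "u = UNIV")
      case False
      then have "- u \<noteq> {}" by auto
      \<comment> \<open>The alternating sum is the expansion of the product of
        \<open>- 1 + 1\<close> over the nonempty set \<open>- u\<close>.\<close>
      then have "(\<Sum>v\<in>Pow (- u). (- 1) ^ card v :: real) = 0"
        using prod_add[of "- u" "\<lambda>_. - 1 :: real" "\<lambda>_. 1"] by (simp add: power_0_left)
      with False show ?thesis by simp
    qed simp
    finally show "(\<Sum>s | s \<in> UNIV \<and> u \<subseteq> s. (- 1) ^ card (s - u) * F u) = (if u = UNIV then F u else 0)" .
  qed
  finally show ?thesis by simp
qed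

lemma section_variation_attained:
  assumes "section_variation s f < ennreal b"
  obtains \<mu> where "generates_signed_measure s (section_of s f) \<mu>" "total_variation (half_open_box s 0 1) \<mu> \<le> ennreal b"
proof -
  have "\<exists>\<mu>\<in>{\<mu>. generates_signed_measure s (section_of s f) \<mu>}. total_variation (half_open_box s 0 1) \<mu> < ennreal b"
    using assms unfolding section_variation_def by (simp only: INF_less_iff)
  then show ?thesis using that by (auto intro: less_imp_le)
qed

lemma half_open_box_borel: "half_open_box s a b \<in> sets (borel :: (real ^ 'd::finite) measure)"
proof -
  have "{x :: real ^ 'd. if j \<in> s then a $ j < x $ j \<and> x $ j \<le> b $ j else x $ j = 0} \<in> sets borel" for j
    by (cases "j \<in> s") auto
  moreover have "half_open_box s a b = (\<Inter>j. {x. if j \<in> s then a $ j < x $ j \<and> x $ j \<le> b $ j else x $ j = 0})"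
    by (auto simp: half_open_box_def)
  ultimately show ?thesis by auto
qed

text \<open>The faces \<open>half_open_box s 0 1\<close> with nonempty \<open>s\<close>, together
  with the origin, partition the cube. The measures of all sections therefore combine into one
  charge whose distribution function is \<open>f\<close>. The factor 2 pays for choosing generating
  measures that come close to the infimum in \<open>section_variation\<close>.\<close>

lemma sectional_variation_charge:
  fixes f :: "real ^ 'd::finite \<Rightarrow> real"
  assumes v: "sectional_variation_norm f \<le> ennreal a" and a: "a > 0"
  shows "\<exists>\<mu>. bounded_charge \<mu> (2 * a) \<and> (\<forall>x\<in>cbox 0 1. f x = \<mu> {c \<in> cbox 0 1. \<forall>j. c $ j \<le> x $ j})"
proof -
  define S where "S = {s :: 'd set. s \<noteq> {}}"
  define v where "v = (\<lambda>s. section_variation s f)"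
  have fin: "finite S" by simp
  have sum_le: "ennreal \<bar>f 0\<bar> + (\<Sum>s\<in>S. v s) \<le> ennreal a" using v by (simp add: sectional_variation_norm_def S_def v_def)
  have "(\<Sum>s\<in>S. v s) < \<infinity>" using sum_le le_less_trans[of "\<Sum>s\<in>S. v s" "ennreal a" \<infinity>]
    by (metis add.commute add_increasing2 ennreal_less_top infinity_ennreal_def le_zero_eq linear order_trans zero_le)
  then have vfin: "v s < \<infinity>" if "s \<in> S" for s
    using that fin by (metis ennreal_add_eq_top infinity_ennreal_def less_top sum.remove top.not_eq_extremum)
  define N where "N = real (card S)"
  have N: "N \<ge> 0" by (simp add: N_def)
  \<comment> \<open>Each of the \<open>N\<close> section variations is allowed an excess of
    \<open>a / (N + 1)\<close>, altogether at most \<open>a\<close>.\<close>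
  define b where "b = (\<lambda>s. enn2real (v s) + a / (N + 1))"
  have vb: "v s < ennreal (b s)" and b0: "b s \<ge> 0" if "s \<in> S" for s
  proof -
    have "v s = ennreal (enn2real (v s))" using vfin[OF that] by simp
    also have "\<dots> < ennreal (b s)" using a N by (intro ennreal_lessI) (auto simp: b_def add_nonneg_pos)
    finally show "v s < ennreal (b s)" .
    show "b s \<ge> 0" using a N by (auto simp: b_def)
  qed
  have "ennreal (\<bar>f 0\<bar> + (\<Sum>s\<in>S. enn2real (v s))) = ennreal \<bar>f 0\<bar> + (\<Sum>s\<in>S. v s)"
    using vfin by (simp add: ennreal_plus sum_nonneg flip: sum_ennreal)
  then have "ennreal (\<bar>f 0\<bar> + (\<Sum>s\<in>S. enn2real (v s))) \<le> ennreal a" using sum_le by simp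
  then have le_a: "\<bar>f 0\<bar> + (\<Sum>s\<in>S. enn2real (v s)) \<le> a" using a by (simp add: ennreal_le_iff)
  have "(\<Sum>s\<in>S. b s) = (\<Sum>s\<in>S. enn2real (v s)) + N * (a / (N + 1))"
    by (simp add: b_def sum.distrib N_def)
  also have "N * (a / (N + 1)) \<le> a" using a N by (simp add: field_simps)
  finally have bsum: "\<bar>f 0\<bar> + (\<Sum>s\<in>S. b s) \<le> 2 * a" using le_a by simp
  have "\<exists>\<mu>. generates_signed_measure s (section_of s f) \<mu> \<and> total_variation (half_open_box s 0 1) \<mu> \<le> ennreal (b s)" if "s \<in> S" for s
    using section_variation_attained[OF vb[OF that, unfolded v_def]] by blast
  then obtain m where m: "\<And>s. s \<in> S \<Longrightarrow> generates_signed_measure s (section_of s f) (m s)"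
     "\<And>s. s \<in> S \<Longrightarrow> total_variation (half_open_box s 0 1) (m s) \<le> ennreal (b s)" by metis
  \<comment> \<open>The constant term becomes a point mass at the origin; every other section lives
    on its own face.\<close>
  define \<mu>' where "\<mu>' = (\<lambda>s B. if s = {} then f 0 * indicat_real B 0 else m s (B \<inter> half_open_box s 0 1))"
  define b' where "b' = (\<lambda>s. if s = {} then \<bar>f 0\<bar> else b s)"
  define \<mu> where "\<mu> = (\<lambda>B. \<Sum>s\<in>UNIV. \<mu>' s B)"
  have UN: "(UNIV :: 'd set set) = insert {} S" by (auto simp: S_def)
  have nS: "{} \<notin> S" by (simp add: S_def)
  have "bounded_charge (\<mu>' s) (b' s)" for s
  proof (cases "s = {}")
    case True
    have "(\<Sum>B\<in>\<B>. \<bar>f 0 * indicat_real B 0\<bar>) \<le> \<bar>f 0\<bar>" if "finite \<B>" "disjoint \<B>" for \<B> :: "(real ^ 'd) set set"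
    proof (cases "\<exists>B\<in>\<B>. 0 \<in> B")
      case True
      then obtain B where B: "B \<in> \<B>" "0 \<in> B" by blast
      have "(\<Sum>B\<in>\<B>. \<bar>f 0 * indicat_real B 0\<bar>) = (\<Sum>B\<in>{B}. \<bar>f 0 * indicat_real B 0\<bar>)"
        by (rule sum.mono_neutral_right) (use that B in \<open>auto simp: disjoint_def indicator_def\<close>)
      then show ?thesis using B by simp
    qed (auto simp: indicator_def intro!: sum_nonpos order_trans[OF sum_nonpos abs_ge_zero])
    then show ?thesis using True
      by (auto simp: bounded_charge_def \<mu>'_def b'_def indicator_def)
  next
    case False
    then have "s \<in> S" by (simp add: S_def)
    then show ?thesis using bounded_charge_signed_measure[of "half_open_box s 0 1" "m s" "b s"] m[of s] b0[of s] False
      by (simp add: generates_signed_measure_def half_open_box_borel \<mu>'_def b'_def)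
  qed
  then have "bounded_charge \<mu> (\<Sum>s\<in>UNIV. b' s)"
    unfolding \<mu>_def by (intro bounded_charge_sum) auto
  moreover have "(\<Sum>s\<in>UNIV. b' s) \<le> 2 * a"
  proof -
    have "(\<Sum>s\<in>S. b' s) = (\<Sum>s\<in>S. b s)" by (intro sum.cong) (auto simp: b'_def S_def)
    then show ?thesis using bsum nS fin by (simp add: UN b'_def)
  qed
  ultimately have bc: "bounded_charge \<mu> (2 * a)"
    unfolding bounded_charge_def by (meson order_trans)
  have "f x = \<mu> {c \<in> cbox 0 1. \<forall>j. c $ j \<le> x $ j}" if x: "x \<in> cbox 0 1" for x
  proof -
    have x01: "0 \<le> x $ j" "x $ j \<le> 1" for j using x by (auto simp: mem_box_cart)
    define F where "F = (\<lambda>u. f (\<chi> j. if j \<in> u then x $ j else 0))"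
    have "\<mu>' s {c \<in> cbox 0 1. \<forall>j. c $ j \<le> x $ j} = (\<Sum>t\<in>Pow s. (- 1) ^ card t * F (s - t))" for s
    proof (cases "s = {}")
      case True
      have "(\<chi> j. 0) = (0 :: real ^ 'd)" by (simp add: vec_eq_iff)
      then show ?thesis using True x01 by (simp add: \<mu>'_def F_def mem_box_cart)
    next
      case False
      have "{c \<in> cbox 0 1. \<forall>j. c $ j \<le> x $ j} \<inter> half_open_box s 0 1 = half_open_box s 0 x"
        using x01 unfolding half_open_box_def
        by (auto simp: mem_box_cart split: if_splits) (metis less_imp_le order.trans order_refl zero_le_one)+
      then have "\<mu>' s {c \<in> cbox 0 1. \<forall>j. c $ j \<le> x $ j} = increment s (section_of s f) 0 x"
        using m(1)[of s] False x01 by (simp add: \<mu>'_def generates_signed_measure_def S_def)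
      also have "\<dots> = (\<Sum>t\<in>Pow s. (- 1) ^ card t * F (s - t))"
        unfolding increment_def section_of_def F_def
        by (intro sum.cong refl arg_cong2[where f = "(*)"] arg_cong[where f = f]) (auto simp: vec_eq_iff)
      finally show ?thesis .
    qed
    then have "\<mu> {c \<in> cbox 0 1. \<forall>j. c $ j \<le> x $ j} = F UNIV"
      by (simp add: \<mu>_def moebius_subsets)
    also have "\<dots> = f x" by (simp add: F_def vec_lambda_eta)
    finally show ?thesis by simp
  qed
  with bc show ?thesis by blast
qed

text \<open>The sum being fixed, a list is determined by its tail, so only \<open>k - 1\<close>
  entries are free. This is the source of \<open>d - 1\<close>, in place of \<open>d\<close>, in the
  power of the logarithm.\<close>

lemma card_fixed_sum_lists_le:
  assumes "k > 0"
  shows "finite {l :: nat list. length l = k \<and> sum_list l = m}"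
    and "card {l :: nat list. length l = k \<and> sum_list l = m} \<le> (m + 1) ^ (k - 1)"
proof -
  let ?S = "{l :: nat list. length l = k \<and> sum_list l = m}"
  let ?T = "{l :: nat list. set l \<subseteq> {..m} \<and> length l = k - 1}"
  have inj: "inj_on tl ?S"
  proof (rule inj_onI)
    fix x y assume *: "x \<in> ?S" "y \<in> ?S" "tl x = tl y"
    then obtain a b z where "x = a # z" "y = b # z"
      using assms by (cases x; cases y) auto
    with * show "x = y" by auto
  qed
  have sub: "tl ` ?S \<subseteq> ?T"
  proof (rule image_subsetI)
    fix l assume l: "l \<in> ?S"
    have "set (tl l) \<subseteq> {..m}"
      using l member_le_sum_list[of _ l] list.set_sel(2)[of l] by (cases l) auto
    then show "tl l \<in> ?T" using l by simp
  qed
  have fin: "finite ?T" by (rule finite_lists_length_eq) simp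
  show "finite ?S" using finite_imageD[OF finite_subset[OF sub fin] inj] .
  have "card ?S = card (tl ` ?S)" by (rule card_image[OF inj, symmetric])
  also have "\<dots> \<le> card ?T" by (rule card_mono[OF fin sub])
  also have "\<dots> = (m + 1) ^ (k - 1)" by (subst card_lists_length_eq) auto
  finally show "card ?S \<le> (m + 1) ^ (k - 1)" .
qed

lemma card_bool_lists_shape:
  "finite {p :: bool list list. map length p = l} \<and> card {p :: bool list list. map length p = l} = 2 ^ sum_list l"
proof (induction l)
  case Nil
  then show ?case by simp
next
  case (Cons a l)
  have eq: "{p :: bool list list. map length p = a # l} =
      (\<lambda>(w, q). w # q) ` ({w. set w \<subseteq> UNIV \<and> length w = a} \<times> {p. map length p = l})"
    by (auto simp: Cons_eq_map_conv map_eq_Cons_conv)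
  have fin: "finite {w :: bool list. set w \<subseteq> UNIV \<and> length w = a}"
    by (rule finite_lists_length_eq) simp
  have inj: "inj_on (\<lambda>(w, q). w # q) X" for X :: "(bool list \<times> bool list list) set" by (auto simp: inj_on_def)
  have "card {w :: bool list. set w \<subseteq> UNIV \<and> length w = a} = 2 ^ a"
    by (subst card_lists_length_eq) auto
  then show ?case using Cons fin unfolding eq
    by (subst card_image[OF inj]) (auto simp: card_cartesian_product power_add)
qed

lemma tree_index_shapes: "tree_index k J = (\<Union>l\<in>{l. length l = k \<and> sum_list l \<le> J}. {p. map length p = l})"
  by (auto simp: tree_index_def)

lemma finite_tree_index: "finite (tree_index k J)"
proof -
  have "finite {l :: nat list. length l = k \<and> sum_list l \<le> J}"
  proof (rule finite_subset)
    show "{l :: nat list. length l = k \<and> sum_list l \<le> J} \<subseteq> {l. set l \<subseteq> {..J} \<and> length l = k}"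
      using member_le_sum_list order_trans by fastforce
    show "finite {l :: nat list. set l \<subseteq> {..J} \<and> length l = k}" by (rule finite_lists_length_eq) simp
  qed
  then show ?thesis unfolding tree_index_shapes using card_bool_lists_shape by blast
qed

text \<open>For fixed \<open>x\<close> the lower orthant is the disjoint union of its traces on the
  cells \<open>B p\<close> with \<open>x \<in> R p\<close>. At depth less than \<open>J\<close> the
  trace is all of \<open>B p\<close> within the cube, so its charge \<open>C p\<close> is
  independent of \<open>x\<close>. At depth \<open>J\<close> the trace varies with \<open>x\<close>,
  and its charge is only bounded, by a \<open>W p\<close> uniform in \<open>x\<close>.\<close>

lemma orthant_tree_expansion:
  fixes P :: "(real ^ 'd::finite) measure" and f :: "real ^ 'd \<Rightarrow> real"
  assumes t: "orthant_tree P ks UNIV J R B" and ks: "set ks = UNIV"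
    and \<mu>: "bounded_charge \<mu> A" and f: "\<And>x. x \<in> cbox 0 1 \<Longrightarrow> f x = \<mu> {c \<in> cbox 0 1. \<forall>j. c $ j \<le> x $ j}"
  shows "\<exists>C W :: bool list list \<Rightarrow> real.
     (\<forall>l. (\<Sum>p | p \<in> tree_index (length ks) J \<and> map length p = l. \<bar>C p\<bar>) \<le> A) \<and>
     (\<forall>p. W p \<ge> 0) \<and>
     (\<forall>l. (\<Sum>p | p \<in> tree_index (length ks) J \<and> map length p = l. W p) \<le> A) \<and>
     (\<forall>x\<in>cbox 0 1. \<bar>f x - (\<Sum>p | p \<in> tree_index (length ks) J \<and> depth p < J. C p * indicator (R p) x)\<bar>
        \<le> (\<Sum>p | p \<in> tree_index (length ks) J \<and> depth p = J. W p * indicator (R p) x))"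
proof -
  let ?I = "tree_index (length ks) J" and ?D = "cbox 0 1 :: (real ^ 'd) set"
  note fin = finite_tree_index[of "length ks" J]
  note tD = orthant_tree.tree[OF t]
  define C where "C = (\<lambda>p. \<mu> (B p \<inter> ?D))"
  define \<E> where "\<E> = (\<lambda>p. {E \<in> sets borel. E \<subseteq> B p \<inter> ?D})"
  \<comment> \<open>The supremum covers every set that can occur as the trace of a lower orthant on
    the cell.\<close>
  define W where "W = (\<lambda>p. SUP E\<in>\<E> p. \<bar>\<mu> E\<bar>)"
  have bnd: "\<bar>\<mu> E\<bar> \<le> A" if "E \<in> sets borel" for E
    using bounded_charge_sum_le[OF \<mu>, of "{E}" "\<lambda>x. x"] that by (simp add: disjoint_family_on_def)
  have bdd: "bdd_above ((\<lambda>E. \<bar>\<mu> E\<bar>) ` \<E> p)" for p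
    using bnd by (intro bdd_aboveI2[of _ _ A]) (auto simp: \<E>_def)
  have emp: "{} \<in> \<E> p" for p by (simp add: \<E>_def)
  have W_ge: "\<bar>\<mu> E\<bar> \<le> W p" if "E \<in> sets borel" "E \<subseteq> B p \<inter> ?D" for E p
    unfolding W_def using that by (intro cSUP_upper bdd) (auto simp: \<E>_def)
  have W0: "W p \<ge> 0" for p using W_ge[of "{}" p] by simp
  have dj: "disjoint_family_on (\<lambda>p. B p \<inter> ?D) {p \<in> ?I. map length p = l}" for l
    using tD(6) by (fastforce simp: disjoint_family_on_def)
  have "(\<Sum>p | p \<in> ?I \<and> map length p = l. \<bar>C p\<bar>) \<le> A" for l
    unfolding C_def using fin tD(3) by (intro bounded_charge_sum_le[OF \<mu>] dj) auto
  moreover have "(\<Sum>p | p \<in> ?I \<and> map length p = l. W p) \<le> A" for l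
  \<comment> \<open>Near-maximisers chosen inside disjoint cells are themselves disjoint, so their
    charges sum to at most \<open>A\<close>; \<open>h\<close> spreads the error \<open>e\<close>
    over the cells of the shape.\<close>
  proof (rule field_le_epsilon)
    fix e :: real assume e: "e > 0"
    let ?K = "{p \<in> ?I. map length p = l}"
    define h where "h = e / (real (card ?K) + 1)"
    have h: "h > 0" using e by (simp add: h_def)
    have "\<exists>E\<in>\<E> p. W p - h < \<bar>\<mu> E\<bar>" for p
      using h emp[of p] bdd[of p] less_cSUP_iff[of "\<E> p" "\<lambda>E. \<bar>\<mu> E\<bar>" "W p - h"] by (auto simp: W_def)
    then obtain E where E: "\<And>p. E p \<in> \<E> p" "\<And>p. W p - h < \<bar>\<mu> (E p)\<bar>" by metis
    have "(\<Sum>p\<in>?K. W p) \<le> (\<Sum>p\<in>?K. \<bar>\<mu> (E p)\<bar> + h)"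
      using E(2) by (intro sum_mono) (auto simp: algebra_simps less_imp_le)
    also have "\<dots> = (\<Sum>p\<in>?K. \<bar>\<mu> (E p)\<bar>) + real (card ?K) * h" by (simp add: sum.distrib)
    also have "(\<Sum>p\<in>?K. \<bar>\<mu> (E p)\<bar>) \<le> A"
    proof (rule bounded_charge_sum_le[OF \<mu>])
      show "disjoint_family_on E ?K" using dj[of l] E(1) unfolding disjoint_family_on_def \<E>_def by blast
    qed (use fin E(1) in \<open>auto simp: \<E>_def\<close>)
    also have "real (card ?K) * h \<le> e" using e by (simp add: h_def field_simps)
    finally show "(\<Sum>p\<in>?K. W p) \<le> A + e" by simp
  qed
  moreover have "\<bar>f x - (\<Sum>p | p \<in> ?I \<and> depth p < J. C p * indicator (R p) x)\<bar>
        \<le> (\<Sum>p | p \<in> ?I \<and> depth p = J. W p * indicator (R p) x)" if x: "x \<in> ?D" for x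
  proof -
    define L where "L = {c \<in> ?D. \<forall>j. c $ j \<le> x $ j}"
    have "L = ?D \<inter> cbox 0 x" by (auto simp: L_def mem_box_cart)
    then have L: "L \<in> sets borel" by simp
    define E where "E = (\<lambda>p. if depth p < J then B p \<inter> ?D else B p \<inter> L)"
    let ?K = "{p \<in> ?I. x \<in> R p}"
    have EB: "E p \<subseteq> B p" for p by (auto simp: E_def)
    have EL: "E p \<subseteq> L" if "p \<in> ?K" for p
    proof
      fix c assume c: "c \<in> E p"
      show "c \<in> L"
      proof (cases "depth p < J")
        case True
        then have "c $ j \<le> x $ j" for j using tD(8)[of p x c j] that c ks by (auto simp: E_def)
        with c True show ?thesis by (auto simp: L_def E_def)
      qed (use c in \<open>auto simp: E_def\<close>)
    qed
    have ex: "\<exists>!p. p \<in> ?I \<and> x \<in> R p \<and> c \<in> B p" if "c \<in> L" for c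
      by (rule tD(7)) (use that in \<open>auto simp: L_def\<close>)
    have dE: "disjoint_family_on E ?K"
      unfolding disjoint_family_on_def
    proof (intro ballI impI, rule ccontr)
      fix p q assume pq: "p \<in> ?K" "q \<in> ?K" "p \<noteq> q" "E p \<inter> E q \<noteq> {}"
      then obtain c where c: "c \<in> E p" "c \<in> E q" by blast
      then have "c \<in> L" using EL pq by blast
      from ex[OF this] show False using c EB pq by blast
    qed
    have "L = (\<Union>p\<in>?K. E p)"
    proof
      show "L \<subseteq> (\<Union>p\<in>?K. E p)"
      proof
        fix c assume c: "c \<in> L"
        obtain p where "p \<in> ?I" "x \<in> R p" "c \<in> B p" using ex1_implies_ex[OF ex[OF c]] by blast
        with c show "c \<in> (\<Union>p\<in>?K. E p)" by (auto simp: E_def L_def)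
      qed
    qed (use EL in blast)
    moreover have "\<mu> (\<Union>p\<in>?K. E p) = (\<Sum>p\<in>?K. \<mu> (E p))"
      using fin L tD(3) by (intro bounded_charge_UN[OF \<mu>] dE) (auto simp: E_def)
    ultimately have "f x = (\<Sum>p\<in>?K. \<mu> (E p))" using f[OF x] by (simp add: L_def)
    also have "\<dots> = (\<Sum>p\<in>?I. \<mu> (E p) * indicator (R p) x)"
      using fin by (intro sum.mono_neutral_cong_left) (auto simp: indicator_def)
    also have "?I = {p \<in> ?I. depth p < J} \<union> {p \<in> ?I. depth p = J}" by (auto simp: tree_index_def)
    also have "(\<Sum>p\<in>\<dots>. \<mu> (E p) * indicator (R p) x) = (\<Sum>p | p \<in> ?I \<and> depth p < J. \<mu> (E p) * indicator (R p) x) +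
        (\<Sum>p | p \<in> ?I \<and> depth p = J. \<mu> (E p) * indicator (R p) x)"
      using fin by (intro sum.union_disjoint) auto
    also have "(\<Sum>p | p \<in> ?I \<and> depth p < J. \<mu> (E p) * indicator (R p) x) = (\<Sum>p | p \<in> ?I \<and> depth p < J. C p * indicator (R p) x)"
      by (intro sum.cong) (auto simp: E_def C_def)
    finally have "\<bar>f x - (\<Sum>p | p \<in> ?I \<and> depth p < J. C p * indicator (R p) x)\<bar> =
      \<bar>\<Sum>p | p \<in> ?I \<and> depth p = J. \<mu> (E p) * indicator (R p) x\<bar>" by simp
    also have "\<dots> \<le> (\<Sum>p | p \<in> ?I \<and> depth p = J. \<bar>\<mu> (E p) * indicator (R p) x\<bar>)" by (rule sum_abs)
    also have "\<dots> \<le> (\<Sum>p | p \<in> ?I \<and> depth p = J. W p * indicator (R p) x)"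
    proof (rule sum_mono)
      fix p
      have "\<bar>\<mu> (E p)\<bar> \<le> W p" using L tD(3)[of p] by (intro W_ge) (auto simp: E_def L_def)
      then show "\<bar>\<mu> (E p) * indicator (R p) x\<bar> \<le> W p * indicator (R p) x"
        by (auto simp: indicator_def)
    qed
    finally show ?thesis .
  qed
  ultimately show ?thesis using W0 by (intro exI[of _ C] exI[of _ W]) auto
qed

section \<open>Nets of step functions\<close>

text \<open>
  At scale \<open>r\<close> the coefficients of a shape with \<open>2 ^ m\<close> cells are rounded to multiples of
  \<open>2 * a * resolution m r\<close>.  The slope \<open>1 / 16\<close> is a compromise: any positive slope below \<open>1\<close> makes
  both the entropy and the \<open>L\<^sup>2\<close> error of the shape decay geometrically in \<open>\<bar>m - r\<bar>\<close>, so that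
  summing over \<open>m\<close> costs no logarithm, and a small slope keeps the rounding error uniformly small
  on the fine shapes, as Bernstein's inequality requires.
\<close>

definition chain_weight :: "nat \<Rightarrow> nat \<Rightarrow> real" where
  "chain_weight m r = 2 powr (- \<bar>real m - real r\<bar> / 32)"

definition chain_const :: real where
  "chain_const = 2 / (1 - 2 powr (- 1 / 32))"

definition resolution :: "nat \<Rightarrow> nat \<Rightarrow> real" where
  "resolution m r = 2 powr (- real r + (real m - real r) / 16)"

lemma chain_const_ge_2: "chain_const \<ge> 2"
proof -
  have "(2::real) powr (- 1 / 32) < 2 powr 0" by (rule powr_less_mono) auto
  moreover have "(2::real) powr (- 1 / 32) > 0" by simp
  ultimately show ?thesis unfolding chain_const_def by (simp add: field_simps)
qed

lemma resolution_pos [simp]: "resolution m r > 0" by (simp add: resolution_def)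

lemma chain_weight_pos [simp]: "chain_weight m r > 0" by (simp add: chain_weight_def)

lemma sum_chain_weight_le: "(\<Sum>m\<le>J. chain_weight m r) \<le> chain_const"
proof -
  define q where "q = (2::real) powr (- 1 / 32)"
  have q: "0 < q" "q < 1"
    using powr_less_mono[of "- 1 / 32" 0 "2::real"] by (auto simp: q_def)
  have geo: "(\<Sum>k\<in>K. q ^ k) \<le> 1 / (1 - q)" if "finite K" for K
  proof -
    have "(\<Sum>k\<in>K. q ^ k) \<le> (\<Sum>k. q ^ k)" using q that by (intro sum_le_suminf) (auto intro: summable_geometric)
    also have "\<dots> = 1 / (1 - q)" using q by (intro suminf_geometric) auto
    finally show ?thesis .
  qed
  have w: "chain_weight m r = q ^ (if m \<le> r then r - m else m - r)" for m
    by (auto simp: chain_weight_def q_def powr_powr of_nat_diff simp flip: powr_realpow)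
  \<comment> \<open>Level \<open>r\<close> is counted on both sides, so that each side is a
    geometric series starting at exponent 0.\<close>
  have "(\<Sum>m\<le>J. chain_weight m r) \<le> (\<Sum>m\<in>{..r} \<union> {r..r + J}. chain_weight m r)"
    by (rule sum_mono2) (auto simp: less_imp_le)
  also have "\<dots> \<le> (\<Sum>m\<in>{..r}. chain_weight m r) + (\<Sum>m\<in>{r..r + J}. chain_weight m r)"
    by (subst sum_Un) (auto intro!: sum_nonneg simp: less_imp_le)
  also have "(\<Sum>m\<in>{..r}. chain_weight m r) = (\<Sum>k\<in>{..r}. q ^ k)"
    by (rule sum.reindex_bij_witness[of _ "\<lambda>k. r - k" "\<lambda>m. r - m"]) (auto simp: w)
  also have "(\<Sum>m\<in>{r..r + J}. chain_weight m r) = (\<Sum>k\<in>{..J}. q ^ k)"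
    by (rule sum.reindex_bij_witness[of _ "\<lambda>k. r + k" "\<lambda>m. m - r"]) (auto simp: w)
  also have "(\<Sum>k\<in>{..r}. q ^ k) + (\<Sum>k\<in>{..J}. q ^ k) \<le> 1 / (1 - q) + 1 / (1 - q)"
    by (intro add_mono geo) auto
  also have "\<dots> = chain_const" by (simp add: chain_const_def q_def)
  finally show ?thesis .
qed

text \<open>Trades a logarithm for a small power. Two fractions with sum 1 can only grow when raised
  to a power \<open>g \<le> 1\<close>, whence
  \<open>(1 + x) powr g \<le> 1 + x powr g\<close>.\<close>

lemma ln_one_plus_le_powr:
  fixes x g :: real assumes "x > 0" "0 < g" "g \<le> 1"
  shows "ln (1 + x) \<le> x powr g / g"
proof -
  have "1 = (1 / (1 + x)) powr 1 + (x / (1 + x)) powr 1" using assms by (simp flip: add_divide_distrib)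
  also have "\<dots> \<le> (1 / (1 + x)) powr g + (x / (1 + x)) powr g"
    using assms by (intro add_mono powr_mono') auto
  also have "\<dots> = (1 + x powr g) / (1 + x) powr g" using assms by (simp add: powr_divide add_divide_distrib)
  finally have "(1 + x) powr g \<le> 1 + x powr g" using assms by (simp add: field_simps)
  then have "ln ((1 + x) powr g) \<le> ln (1 + x powr g)" using assms by (subst ln_le_cancel_iff) (auto intro: add_pos_nonneg)
  also have "\<dots> \<le> x powr g" by (rule ln_add_one_self_le_self) auto
  finally show ?thesis using assms by (simp add: ln_powr field_simps)
qed

text \<open>\<open>T\<close> is the l1 budget of a coefficient vector in units of the rounding step,
  \<open>N\<close> the number of cells, and the left side is the logarithm of the bound in
  \<open>card_integer_vectors_le\<close> for the weight \<open>ln (1 + N / T)\<close>. With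
  \<open>e = m - r\<close> one has \<open>N / T = 2 powr (17 * e / 16)\<close>, so the exponent
  \<open>1 / 34\<close> turns the logarithm into \<open>2 powr (e / 32)\<close>, which uses up only
  half of the decay \<open>2 powr (- e / 16)\<close> of \<open>T / 2 ^ r\<close>. Fine levels give
  the constant 36 and coarse ones 69.\<close>

lemma shape_entropy_le:
  fixes m r :: nat
  defines "T \<equiv> 1 / resolution m r" and "N \<equiv> 2 ^ m :: real"
  shows "T * ln (1 + N / T) + N * ln (1 + 2 * T / N) \<le> 70 * 2 ^ r * chain_weight m r"
proof -
  define e where "e = real m - real r"
  have T: "T = 2 powr (real r - e / 16)"
    by (simp add: T_def resolution_def e_def flip: powr_minus_divide)
  have N: "N = 2 powr (real r + e)" by (simp add: N_def e_def powr_realpow)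
  have NT: "N / T = 2 powr (17 * e / 16)" by (simp add: N T flip: powr_diff)
  have TN: "T / N = 2 powr (- 17 * e / 16)" by (simp add: N T flip: powr_diff)
  have pos: "T > 0" "N > 0" by (auto simp: T N)
  have pr: "(2::real) ^ r = 2 powr real r" by (simp add: powr_realpow)
  show ?thesis
  proof (cases "e \<ge> 0")
    case True
    have "ln (1 + N / T) \<le> (N / T) powr (1 / 34) / (1 / 34)"
      by (rule ln_one_plus_le_powr) (use pos in auto)
    also have "\<dots> = 34 * 2 powr (e / 32)" by (simp add: NT powr_powr)
    finally have "T * ln (1 + N / T) \<le> T * (34 * 2 powr (e / 32))" using pos by simp
    also have "\<dots> = 34 * 2 powr (real r - e / 32)" by (simp add: T flip: powr_add)
    finally have 1: "T * ln (1 + N / T) \<le> 34 * 2 powr (real r - e / 32)" .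
    have "N * ln (1 + 2 * T / N) \<le> N * (2 * T / N)"
      using pos by (intro mult_left_mono ln_add_one_self_le_self) auto
    also have "\<dots> = 2 * 2 powr (real r - e / 16)" using pos by (simp add: T)
    also have "\<dots> \<le> 2 * 2 powr (real r - e / 32)" using True by (intro mult_left_mono powr_mono) auto
    finally have 2: "N * ln (1 + 2 * T / N) \<le> 2 * 2 powr (real r - e / 32)" .
    have "2 ^ r * chain_weight m r = 2 powr (real r + - \<bar>real m - real r\<bar> / 32)"
      by (simp only: chain_weight_def pr powr_add)
    also have "real r + - \<bar>real m - real r\<bar> / 32 = real r - e / 32" using True by (simp add: e_def field_simps)
    finally have eq: "2 ^ r * chain_weight m r = 2 powr (real r - e / 32)" .
    have "(2::real) powr (real r - e / 32) > 0" by simp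
    then show ?thesis using 1 2 unfolding mult.assoc eq by linarith
  next
    case False
    have "T * ln (1 + N / T) \<le> T * (N / T)"
      using pos by (intro mult_left_mono ln_add_one_self_le_self) auto
    also have "\<dots> = 2 powr (real r + e)" using pos by (simp add: N)
    also have "\<dots> \<le> 2 powr (real r + e / 32)" using False by (intro powr_mono) auto
    finally have 1: "T * ln (1 + N / T) \<le> 2 powr (real r + e / 32)" .
    have "2 * T / N = 2 powr 1 * 2 powr (- 17 * e / 16)" using TN by simp
    also have "\<dots> = 2 powr (1 + - 17 * e / 16)" by (simp only: powr_add)
    finally have TN2: "2 * T / N = 2 powr (1 + - 17 * e / 16)" .
    have "ln (1 + 2 * T / N) \<le> (2 * T / N) powr (1 / 34) / (1 / 34)"
      by (rule ln_one_plus_le_powr) (use pos in auto)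
    also have "(2 * T / N) powr (1 / 34) / (1 / 34) = 34 * 2 powr (1 / 34 - e / 32)"
      unfolding TN2 by (simp add: powr_powr field_simps)
    also have "\<dots> \<le> 34 * 2 powr (1 - e / 32)" by (intro mult_left_mono powr_mono) auto
    finally have "N * ln (1 + 2 * T / N) \<le> N * (34 * 2 powr (1 - e / 32))" using pos by simp
    also have "\<dots> = 34 * 2 powr ((real r + e) + (1 - e / 32))" unfolding N powr_add by simp
    also have "(real r + e) + (1 - e / 32) = 1 + (real r + 31 * e / 32)" by (simp add: field_simps)
    also have "34 * 2 powr (1 + (real r + 31 * e / 32)) = 68 * 2 powr (real r + 31 * e / 32)" unfolding powr_add by simp
    also have "\<dots> \<le> 68 * 2 powr (real r + e / 32)" using False by (intro mult_left_mono powr_mono) auto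
    finally have 2: "N * ln (1 + 2 * T / N) \<le> 68 * 2 powr (real r + e / 32)" .
    have "2 ^ r * chain_weight m r = 2 powr (real r + - \<bar>real m - real r\<bar> / 32)"
      by (simp only: chain_weight_def pr powr_add)
    also have "real r + - \<bar>real m - real r\<bar> / 32 = real r + e / 32" using False by (simp add: e_def field_simps)
    finally have eq: "2 ^ r * chain_weight m r = 2 powr (real r + e / 32)" .
    have "(2::real) powr (real r + e / 32) > 0" by simp
    then show ?thesis using 1 2 unfolding mult.assoc eq by linarith
  qed
qed

text \<open>Rounding towards zero does not increase absolute values, so the l1 budget of the
  coefficients carries over to their codes.\<close>

definition truncate_to_int :: "real \<Rightarrow> int" where
  "truncate_to_int x = (if x \<ge> 0 then \<lfloor>x\<rfloor> else - \<lfloor>- x\<rfloor>)"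

lemma truncate_to_int: "\<bar>x - real_of_int (truncate_to_int x)\<bar> \<le> 1" "\<bar>real_of_int (truncate_to_int x)\<bar> \<le> \<bar>x\<bar>"
proof -
  show "\<bar>x - real_of_int (truncate_to_int x)\<bar> \<le> 1"
    unfolding truncate_to_int_def by (auto split: if_splits) linarith+
  have "0 \<le> \<lfloor>\<bar>x\<bar>\<rfloor>" by simp
  then show "\<bar>real_of_int (truncate_to_int x)\<bar> \<le> \<bar>x\<bar>"
    unfolding truncate_to_int_def by (auto split: if_splits)
qed

text \<open>Abstract form of the cells \<open>R p\<close> of a tree: \<open>sh\<close> is the tuple
  of depths of a cell and \<open>lev\<close> its total depth. \<open>D\<close> bounds the number of
  shapes of each level and carries the logarithmic factor.\<close>

locale cell_system =
  fixes P :: "'o measure" and I :: "'i set" and sh :: "'i \<Rightarrow> 's" and lev :: "'s \<Rightarrow> nat"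
    and R :: "'i \<Rightarrow> 'o set" and J :: nat and D :: real
  assumes prob_P: "prob_space P"
    and finite_I: "finite I"
    and R_sets: "\<And>i. i \<in> I \<Longrightarrow> R i \<in> sets P"
    and R_mass: "\<And>i. i \<in> I \<Longrightarrow> measure P (R i) \<le> 1 / 2 ^ lev (sh i)"
    and R_disjoint: "\<And>i k. i \<in> I \<Longrightarrow> k \<in> I \<Longrightarrow> i \<noteq> k \<Longrightarrow> sh i = sh k \<Longrightarrow> R i \<inter> R k = {}"
    and card_cells: "\<And>l. l \<in> sh ` I \<Longrightarrow> card {i \<in> I. sh i = l} \<le> 2 ^ lev l"
    and lev_le: "\<And>l. l \<in> sh ` I \<Longrightarrow> lev l \<le> J"
    and card_shapes: "\<And>m. real (card {l \<in> sh ` I. lev l = m}) \<le> D"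
begin

sublocale P: prob_space P by (rule prob_P)

abbreviation cells :: "'s \<Rightarrow> 'i set" where
  "cells l \<equiv> {i \<in> I. sh i = l}"

lemma sum_cells: "(\<Sum>i\<in>I. g i) = (\<Sum>l\<in>sh ` I. \<Sum>i\<in>cells l. g i)"
  by (rule sum.image_gen[OF finite_I])

lemma sum_shapes_le:
  assumes "\<And>m. h m \<ge> (0::real)"
  shows "(\<Sum>l\<in>sh ` I. h (lev l)) \<le> D * (\<Sum>m\<le>J. h m)"
proof -
  have "(\<Sum>l\<in>sh ` I. h (lev l)) = (\<Sum>m\<le>J. \<Sum>l | l \<in> sh ` I \<and> lev l = m. h (lev l))"
    using lev_le finite_I by (intro sum.group[symmetric]) auto
  also have "\<dots> = (\<Sum>m\<le>J. real (card {l \<in> sh ` I. lev l = m}) * h m)" by simp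
  also have "\<dots> \<le> (\<Sum>m\<le>J. D * h m)" using assms card_shapes by (intro sum_mono mult_right_mono) auto
  finally show ?thesis by (simp add: sum_distrib_left)
qed

definition step_fun :: "('i \<Rightarrow> real) \<Rightarrow> 'o \<Rightarrow> real" where
  "step_fun \<Delta> z = (\<Sum>i\<in>I. \<Delta> i * indicator (R i) z)"

lemma step_fun_measurable [measurable]: "step_fun \<Delta> \<in> borel_measurable P"
proof -
  have "(\<lambda>z. \<Delta> i * indicator (R i) z) \<in> borel_measurable P" if "i \<in> I" for i
    using R_sets[OF that] by measurable
  then show ?thesis unfolding step_fun_def[abs_def] by (rule borel_measurable_sum)
qed

lemma step_fun_nonneg: "(\<And>i. i \<in> I \<Longrightarrow> \<Delta> i \<ge> 0) \<Longrightarrow> step_fun \<Delta> z \<ge> 0"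
  unfolding step_fun_def by (intro sum_nonneg) auto

text \<open>Cells of one shape are disjoint, so at most one of them contains \<open>z\<close>. The
  selected \<open>k\<close> is the same for all \<open>g\<close>, so the square of a combination
  over one shape equals the combination of the squares.\<close>

lemma shape_sum_indicator:
  assumes "l \<in> sh ` I"
  shows "(\<exists>k. k \<in> I \<and> sh k = l \<and> z \<in> R k \<and> (\<forall>g :: 'i \<Rightarrow> real. (\<Sum>i\<in>cells l. g i * indicator (R i) z) = g k))
    \<or> (\<forall>g :: 'i \<Rightarrow> real. (\<Sum>i\<in>cells l. g i * indicator (R i) z) = 0)"
proof (cases "\<exists>k. k \<in> I \<and> sh k = l \<and> z \<in> R k")
  case True
  then obtain k where k: "k \<in> I" "sh k = l" "z \<in> R k" by blast
  have "(\<Sum>i\<in>cells l. g i * indicator (R i) z) = g k" for g :: "'i \<Rightarrow> real"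
  proof -
    have "(\<Sum>i\<in>cells l. g i * indicator (R i) z) = (\<Sum>i\<in>{k}. g i * indicator (R i) z)"
    proof (rule sum.mono_neutral_right)
      show "\<forall>i\<in>cells l - {k}. g i * indicator (R i) z = 0"
      proof
        fix i assume "i \<in> cells l - {k}"
        then have "z \<notin> R i" using R_disjoint[of k i] k by auto
        then show "g i * indicator (R i) z = 0" by simp
      qed
    qed (use finite_I k in auto)
    then show ?thesis using k by simp
  qed
  with k show ?thesis by blast
next
  case False
  then have "(\<Sum>i\<in>cells l. g i * indicator (R i) z) = 0" for g :: "'i \<Rightarrow> real"
    by (intro sum.neutral) (auto simp: indicator_def)
  then show ?thesis by blast
qed

lemma step_fun_le:
  assumes "\<And>i. i \<in> I \<Longrightarrow> \<Delta> i \<le> b (sh i)" "\<And>l. l \<in> sh ` I \<Longrightarrow> b l \<ge> 0"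
  shows "step_fun \<Delta> z \<le> (\<Sum>l\<in>sh ` I. b l)"
  unfolding step_fun_def sum_cells
proof (rule sum_mono)
  fix l assume "l \<in> sh ` I"
  then show "(\<Sum>i\<in>cells l. \<Delta> i * indicator (R i) z) \<le> b l"
    using shape_sum_indicator[OF \<open>l \<in> sh ` I\<close>, of z]
    by (elim disjE exE conjE) (use assms \<open>l \<in> sh ` I\<close> in auto)
qed

lemma integrable_indicator_cell: "i \<in> I \<Longrightarrow> integrable P (indicator (R i) :: 'o \<Rightarrow> real)"
  using R_sets by (intro integrable_real_indicator) (auto simp: P.emeasure_eq_measure)

lemma integral_step_fun: "(\<integral>z. step_fun \<Delta> z \<partial>P) = (\<Sum>i\<in>I. \<Delta> i * measure P (R i))"
  unfolding step_fun_def using R_sets integrable_indicator_cell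
  by (subst Bochner_Integration.integral_sum) (auto intro!: sum.cong)

lemma integrable_step_fun: "integrable P (step_fun \<Delta>)"
  unfolding step_fun_def[abs_def] using integrable_indicator_cell
  by (intro Bochner_Integration.integrable_sum) auto

text \<open>Minkowski's inequality across the shapes, obtained from Cauchy-Schwarz with weights
  \<open>s l\<close>. Within one shape the squares add up without cross terms.\<close>

lemma integral_step_fun_sq_le:
  assumes s: "\<And>l. l \<in> sh ` I \<Longrightarrow> s l > 0"
    and le: "\<And>l. l \<in> sh ` I \<Longrightarrow> (\<Sum>i\<in>cells l. (\<Delta> i)\<^sup>2 * measure P (R i)) \<le> (s l)\<^sup>2"
  shows "(\<integral>z. (step_fun \<Delta> z)\<^sup>2 \<partial>P) \<le> (\<Sum>l\<in>sh ` I. s l)\<^sup>2"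
proof -
  define S where "S = (\<Sum>l\<in>sh ` I. s l)"
  have S0: "S \<ge> 0" unfolding S_def by (rule sum_nonneg) (use s less_imp_le in blast)
  have pt: "(step_fun \<Delta> z)\<^sup>2 \<le> step_fun (\<lambda>i. S * (\<Delta> i)\<^sup>2 / s (sh i)) z" for z
  proof -
    define y where "y = (\<lambda>l. \<Sum>i\<in>cells l. \<Delta> i * indicator (R i) z)"
    have ysq: "(y l)\<^sup>2 = (\<Sum>i\<in>cells l. (\<Delta> i)\<^sup>2 * indicator (R i) z)" if "l \<in> sh ` I" for l
      using shape_sum_indicator[OF that, of z] unfolding y_def by (elim disjE exE conjE) simp_all
    have "(step_fun \<Delta> z)\<^sup>2 = (\<Sum>l\<in>sh ` I. sqrt (s l) * (y l / sqrt (s l)))\<^sup>2"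
      unfolding step_fun_def sum_cells y_def using s
      by (intro arg_cong[where f = "\<lambda>x. x\<^sup>2"] sum.cong refl) (simp add: less_imp_neq[OF s, THEN not_sym])
    also have "\<dots> \<le> (\<Sum>l\<in>sh ` I. (sqrt (s l))\<^sup>2) * (\<Sum>l\<in>sh ` I. (y l / sqrt (s l))\<^sup>2)"
      by (rule Cauchy_Schwarz_ineq_sum)
    also have "(\<Sum>l\<in>sh ` I. (sqrt (s l))\<^sup>2) = S" unfolding S_def by (intro sum.cong refl) (simp add: less_imp_le[OF s])
    also have "S * (\<Sum>l\<in>sh ` I. (y l / sqrt (s l))\<^sup>2) = (\<Sum>l\<in>sh ` I. S * ((y l)\<^sup>2 / s l))"
      unfolding sum_distrib_left by (intro sum.cong refl) (simp add: power_divide less_imp_le[OF s])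
    also have "\<dots> = step_fun (\<lambda>i. S * (\<Delta> i)\<^sup>2 / s (sh i)) z"
      unfolding step_fun_def sum_cells
      by (intro sum.cong refl) (auto simp: ysq sum_divide_distrib sum_distrib_left field_simps intro!: sum.cong)
    finally show ?thesis .
  qed
  have "(\<integral>z. (step_fun \<Delta> z)\<^sup>2 \<partial>P) \<le> (\<integral>z. step_fun (\<lambda>i. S * (\<Delta> i)\<^sup>2 / s (sh i)) z \<partial>P)"
    by (rule integral_mono_AE') (use pt integrable_step_fun order_trans[OF zero_le_power2 pt] in auto)
  also have "\<dots> = (\<Sum>l\<in>sh ` I. S / s l * (\<Sum>i\<in>cells l. (\<Delta> i)\<^sup>2 * measure P (R i)))"
    unfolding integral_step_fun sum_cells sum_distrib_left by (intro sum.cong) auto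
  also have "\<dots> \<le> (\<Sum>l\<in>sh ` I. S / s l * (s l)\<^sup>2)"
    using S0 s le by (intro sum_mono mult_left_mono divide_nonneg_pos) auto
  also have "\<dots> = (\<Sum>l\<in>sh ` I. S * s l)" by (intro sum.cong refl) (simp add: power2_eq_square less_imp_neq[OF s, THEN not_sym])
  also have "\<dots> = S\<^sup>2" by (simp add: S_def power2_eq_square sum_distrib_left)
  finally show ?thesis by (simp add: S_def)
qed

text \<open>The constants are those of differences: two consecutive representatives are each within
  \<open>4 * a\<close> resolutions of a common vector, and two vectors of l1 size
  \<open>2 * a\<close> per shape are at distance at most \<open>4 * a\<close>.\<close>

definition close_at :: "real \<Rightarrow> nat \<Rightarrow> ('i \<Rightarrow> real) \<Rightarrow> bool" where
  "close_at a r \<Delta> \<longleftrightarrow> (\<forall>i\<in>I. 0 \<le> \<Delta> i \<and> \<Delta> i \<le> 8 * a * resolution (lev (sh i)) r) \<and>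
     (\<forall>l. (\<Sum>i\<in>cells l. \<Delta> i) \<le> 4 * a)"

text \<open>On fine levels the sum of squares of a shape is bounded by the maximum times the l1
  norm, on coarse levels by the number of cells times the squared maximum. After division by
  \<open>2 ^ m\<close>, which bounds the effect of the masses, both decay geometrically away from
  level \<open>r\<close>.\<close>

lemma close_at_L2:
  assumes c: "close_at a r \<Delta>" and a: "a > 0"
  shows "(\<integral>z. (step_fun \<Delta> z)\<^sup>2 \<partial>P) \<le> (8 * a * chain_const * D / 2 ^ r)\<^sup>2"
proof -
  define s where "s = (\<lambda>l. 8 * a / 2 ^ r * chain_weight (lev l) r)"
  have "(\<integral>z. (step_fun \<Delta> z)\<^sup>2 \<partial>P) \<le> (\<Sum>l\<in>sh ` I. s l)\<^sup>2"
  proof (rule integral_step_fun_sq_le)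
    fix l assume l: "l \<in> sh ` I"
    show "s l > 0" using a by (simp add: s_def)
    let ?K = "cells l"
    define m where "m = lev l"
    define u where "u = resolution m r"
    have D: "0 \<le> \<Delta> i" "\<Delta> i \<le> 8 * a * u" if "i \<in> ?K" for i
      using that c by (auto simp: close_at_def u_def m_def)
    have "(\<Sum>i\<in>?K. (\<Delta> i)\<^sup>2 * measure P (R i)) \<le> (\<Sum>i\<in>?K. (\<Delta> i)\<^sup>2 * (1 / 2 ^ m))"
      using R_mass by (intro sum_mono mult_left_mono) (auto simp: m_def)
    also have "\<dots> = (\<Sum>i\<in>?K. (\<Delta> i)\<^sup>2) / 2 ^ m" by (simp add: sum_divide_distrib)
    finally have 1: "(\<Sum>i\<in>?K. (\<Delta> i)\<^sup>2 * measure P (R i)) \<le> (\<Sum>i\<in>?K. (\<Delta> i)\<^sup>2) / 2 ^ m" .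
    have "(\<Sum>i\<in>?K. (\<Delta> i)\<^sup>2) \<le> (\<Sum>i\<in>?K. 8 * a * u * \<Delta> i)"
      unfolding power2_eq_square using D by (intro sum_mono mult_right_mono) auto
    also have "\<dots> = 8 * a * u * (\<Sum>i\<in>?K. \<Delta> i)" by (simp add: sum_distrib_left)
    also have "\<dots> \<le> 8 * a * u * (4 * a)" using c a by (intro mult_left_mono) (auto simp: close_at_def u_def less_imp_le)
    finally have "(\<Sum>i\<in>?K. (\<Delta> i)\<^sup>2) \<le> 32 * a\<^sup>2 * u" by (simp add: power2_eq_square algebra_simps)
    then have 2: "(\<Sum>i\<in>?K. (\<Delta> i)\<^sup>2) / 2 ^ m \<le> 32 * a\<^sup>2 * (u / 2 ^ m)" by (simp add: divide_right_mono)
    have "(\<Sum>i\<in>?K. (\<Delta> i)\<^sup>2) \<le> (\<Sum>i\<in>?K. (8 * a * u)\<^sup>2)"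
      using D by (intro sum_mono power_mono) auto
    also have "\<dots> = real (card ?K) * (8 * a * u)\<^sup>2" by simp
    also have "\<dots> \<le> 2 ^ m * (8 * a * u)\<^sup>2"
    proof (rule mult_right_mono)
      have "real (card ?K) \<le> real (2 ^ lev l)" using card_cells[OF l] by (simp only: of_nat_le_iff)
      then show "real (card ?K) \<le> 2 ^ m" by (simp add: m_def)
    qed simp
    finally have 3: "(\<Sum>i\<in>?K. (\<Delta> i)\<^sup>2) / 2 ^ m \<le> 64 * a\<^sup>2 * u\<^sup>2" by (simp add: field_simps power2_eq_square)
    have ss: "(s l)\<^sup>2 = 64 * a\<^sup>2 * 2 powr (- 2 * real r - \<bar>real m - real r\<bar> / 16)"
    proof -
      have "s l = 8 * a * 2 powr (- real r - \<bar>real m - real r\<bar> / 32)"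
      proof -
        have "1 / 2 ^ r = (2::real) powr (- real r)" by (simp add: powr_minus_divide powr_realpow)
        then have "1 / 2 ^ r * chain_weight m r = 2 powr (- real r + - \<bar>real m - real r\<bar> / 32)"
          by (simp only: chain_weight_def powr_add)
        moreover have "s l = 8 * a * (1 / 2 ^ r * chain_weight m r)" by (simp add: s_def m_def)
        ultimately show ?thesis by simp
      qed
      then have "(s l)\<^sup>2 = 64 * a\<^sup>2 * (2 powr (- real r - \<bar>real m - real r\<bar> / 32))\<^sup>2" by (simp add: power_mult_distrib)
      also have "(2 powr (- real r - \<bar>real m - real r\<bar> / 32))\<^sup>2
          = (2::real) powr ((- real r - \<bar>real m - real r\<bar> / 32) + (- real r - \<bar>real m - real r\<bar> / 32))"
        by (simp only: power2_eq_square powr_add)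
      also have "(- real r - \<bar>real m - real r\<bar> / 32) + (- real r - \<bar>real m - real r\<bar> / 32) = - 2 * real r - \<bar>real m - real r\<bar> / 16"
        by (simp add: field_simps)
      finally show ?thesis .
    qed
    show "(\<Sum>i\<in>?K. (\<Delta> i)\<^sup>2 * measure P (R i)) \<le> (s l)\<^sup>2"
    proof (cases "m \<ge> r")
      case True
      have "u / 2 ^ m = 2 powr (- real r + (real m - real r) / 16 - real m)"
        by (simp add: u_def resolution_def powr_diff powr_realpow)
      also have "\<dots> \<le> 2 powr (- 2 * real r - \<bar>real m - real r\<bar> / 16)"
        using True by (intro powr_mono) (auto simp: field_simps)
      finally have "32 * a\<^sup>2 * (u / 2 ^ m) \<le> 64 * a\<^sup>2 * 2 powr (- 2 * real r - \<bar>real m - real r\<bar> / 16)"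
        by (intro mult_mono) (auto simp: u_def less_imp_le)
      then show ?thesis using 1 2 ss by linarith
    next
      case False
      have "u\<^sup>2 = 2 powr (- 2 * real r + (real m - real r) / 8)"
        by (simp add: u_def resolution_def power2_eq_square flip: powr_add)
      also have "\<dots> \<le> 2 powr (- 2 * real r - \<bar>real m - real r\<bar> / 16)"
        using False by (intro powr_mono) (auto simp: field_simps)
      finally have "64 * a\<^sup>2 * u\<^sup>2 \<le> 64 * a\<^sup>2 * 2 powr (- 2 * real r - \<bar>real m - real r\<bar> / 16)"
        by (intro mult_left_mono) auto
      then show ?thesis using 1 3 ss by linarith
    qed
  qed
  also have "(\<Sum>l\<in>sh ` I. s l) \<le> 8 * a * chain_const * D / 2 ^ r"
  proof -
    have "(\<Sum>l\<in>sh ` I. s l) = 8 * a / 2 ^ r * (\<Sum>l\<in>sh ` I. chain_weight (lev l) r)" by (simp add: s_def sum_distrib_left)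
    also have "(\<Sum>l\<in>sh ` I. chain_weight (lev l) r) \<le> D * (\<Sum>m\<le>J. chain_weight m r)"
      by (rule sum_shapes_le) (simp add: less_imp_le)
    also have "\<dots> \<le> D * chain_const"
      using card_shapes[of 0] by (intro mult_left_mono sum_chain_weight_le) linarith
    finally show ?thesis using a by (simp add: field_simps)
  qed
  then have "(\<Sum>l\<in>sh ` I. s l)\<^sup>2 \<le> (8 * a * chain_const * D / 2 ^ r)\<^sup>2"
    using a by (intro power_mono sum_nonneg) (auto simp: s_def less_imp_le)
  finally show ?thesis .
qed

text \<open>The deepest level dominates. Half of the slope \<open>1 / 16\<close> is kept as decay
  away from level \<open>J\<close>, so summing over the levels costs only a constant.\<close>

lemma close_at_sup:
  assumes c: "close_at a r \<Delta>" and a: "a > 0"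
  shows "step_fun \<Delta> z \<le> 8 * a * chain_const * D / 2 ^ r * 2 powr ((real J - real r) / 16)"
proof -
  have "step_fun \<Delta> z \<le> (\<Sum>l\<in>sh ` I. 8 * a * resolution (lev l) r)"
    using c a by (intro step_fun_le) (auto simp: close_at_def less_imp_le)
  also have "\<dots> \<le> (\<Sum>l\<in>sh ` I. 8 * a / 2 ^ r * 2 powr ((real J - real r) / 16) * chain_weight (lev l) J)"
  proof (rule sum_mono)
    fix l assume "l \<in> sh ` I"
    define m where "m = lev l"
    have m: "m \<le> J" using lev_le \<open>l \<in> sh ` I\<close> by (auto simp: m_def)
    have "resolution m r \<le> 2 powr (- real r + (real J - real r) / 16 - \<bar>real m - real J\<bar> / 32)"
      unfolding resolution_def using m by (intro powr_mono) (auto simp: field_simps)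
    also have "\<dots> = 1 / 2 ^ r * 2 powr ((real J - real r) / 16) * chain_weight m J"
    proof -
      have "1 / 2 ^ r = (2::real) powr (- real r)" by (simp add: powr_minus_divide powr_realpow)
      then show ?thesis by (simp only: chain_weight_def powr_add[symmetric]) (simp add: field_simps)
    qed
    finally show "8 * a * resolution (lev l) r \<le> 8 * a / 2 ^ r * 2 powr ((real J - real r) / 16) * chain_weight (lev l) J"
      using a by (simp add: m_def field_simps)
  qed
  also have "\<dots> = 8 * a / 2 ^ r * 2 powr ((real J - real r) / 16) * (\<Sum>l\<in>sh ` I. chain_weight (lev l) J)"
    by (simp add: sum_distrib_left)
  also have "(\<Sum>l\<in>sh ` I. chain_weight (lev l) J) \<le> D * (\<Sum>m\<le>J. chain_weight m J)"
    by (rule sum_shapes_le) (simp add: less_imp_le)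
  also have "\<dots> \<le> D * chain_const"
    using card_shapes[of 0] by (intro mult_left_mono sum_chain_weight_le) linarith
  finally show ?thesis using a by (simp add: field_simps)
qed

section \<open>Rounded coefficients and the size of the net\<close>

definition cell_code :: "real \<Rightarrow> nat \<Rightarrow> ('i \<Rightarrow> real) \<Rightarrow> 'i \<Rightarrow> int" where
  "cell_code a r c = (\<lambda>i\<in>I. truncate_to_int (c i / (2 * a * resolution (lev (sh i)) r)))"

lemma cell_code_eq_imp_close:
  assumes "cell_code a r c = cell_code a r c'" "i \<in> I" "a > 0"
  shows "\<bar>c i - c' i\<bar> \<le> 4 * a * resolution (lev (sh i)) r"
proof -
  define \<tau> where "\<tau> = 2 * a * resolution (lev (sh i)) r"
  have \<tau>: "\<tau> > 0" using assms by (simp add: \<tau>_def)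
  have "truncate_to_int (c i / \<tau>) = truncate_to_int (c' i / \<tau>)"
    using fun_cong[OF assms(1), of i] assms(2) by (simp add: cell_code_def \<tau>_def)
  \<comment> \<open>Truncation sends all numbers strictly between -1 and 1 to 0, hence a distance of
    two units.\<close>
  then have "\<bar>c i / \<tau> - c' i / \<tau>\<bar> \<le> 2"
    using truncate_to_int(1)[of "c i / \<tau>"] truncate_to_int(1)[of "c' i / \<tau>"] by linarith
  then have "\<bar>c i - c' i\<bar> \<le> 2 * \<tau>" using \<tau> by (simp add: abs_divide flip: diff_divide_distrib) (simp add: field_simps)
  then show ?thesis by (simp add: \<tau>_def)
qed

lemma card_cell_codes_le:
  assumes a: "a > 0" and V: "\<And>c l. c \<in> V \<Longrightarrow> (\<Sum>i\<in>cells l. \<bar>c i\<bar>) \<le> 2 * a"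
  shows "finite (cell_code a r ` V) \<and> real (card (cell_code a r ` V)) \<le> exp (70 * chain_const * D * 2 ^ r)"
proof -
  define T where "T = (\<lambda>l. 1 / resolution (lev l) r)"
  define N where "N = (\<lambda>l. 2 ^ lev l :: real)"
  \<comment> \<open>This weight makes the factor contributed by each cell equal to
    \<open>1 + 2 * T l / N l\<close>, the form treated in \<open>shape_entropy_le\<close>.\<close>
  define b where "b = (\<lambda>l. ln (1 + N l / T l))"
  have T: "T l > 0" for l by (simp add: T_def)
  have N: "N l > 0" for l by (simp add: N_def)
  have b: "b l > 0" for l proof -
    have "1 + N l / T l > 1" using T[of l] N[of l] by simp
    then show ?thesis unfolding b_def by (rule ln_gt_zero)
  qed
  have eb: "exp (b l) - 1 = N l / T l" for l using T[of l] N[of l] by (simp add: b_def add_pos_pos)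
  have "finite (cell_code a r ` V) \<and> real (card (cell_code a r ` V)) \<le>
     exp (\<Sum>l\<in>sh ` I. b l * T l) * (\<Prod>i\<in>I. 1 + 2 / (exp (b (sh i)) - 1))"
  proof (rule card_integer_vectors_le[OF finite_I])
    show "cell_code a r ` V \<subseteq> I \<rightarrow>\<^sub>E UNIV" by (auto simp: cell_code_def)
    show "b (sh i) > 0" for i by (rule b)
    fix z assume "z \<in> cell_code a r ` V"
    then obtain c where c: "c \<in> V" "z = cell_code a r c" by blast
    have "(\<Sum>i\<in>I. b (sh i) * \<bar>real_of_int (z i)\<bar>) = (\<Sum>l\<in>sh ` I. \<Sum>i\<in>cells l. b (sh i) * \<bar>real_of_int (z i)\<bar>)"
      by (rule sum_cells)
    also have "\<dots> = (\<Sum>l\<in>sh ` I. b l * (\<Sum>i\<in>cells l. \<bar>real_of_int (z i)\<bar>))"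
      by (simp add: sum_distrib_left)
    also have "\<dots> \<le> (\<Sum>l\<in>sh ` I. b l * T l)"
    proof (intro sum_mono mult_left_mono)
      fix l
      have "(\<Sum>i\<in>cells l. \<bar>real_of_int (z i)\<bar>) \<le> (\<Sum>i\<in>cells l. \<bar>c i\<bar> * (T l / (2 * a)))"
      proof (rule sum_mono)
        fix i assume i: "i \<in> cells l"
        have "\<bar>real_of_int (z i)\<bar> \<le> \<bar>c i / (2 * a * resolution (lev (sh i)) r)\<bar>"
          using i c truncate_to_int(2)[of "c i / (2 * a * resolution (lev (sh i)) r)"] by (simp add: cell_code_def)
        then show "\<bar>real_of_int (z i)\<bar> \<le> \<bar>c i\<bar> * (T l / (2 * a))"
          using i a by (simp add: T_def abs_mult abs_of_pos[OF resolution_pos] field_simps)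
      qed
      also have "\<dots> = (\<Sum>i\<in>cells l. \<bar>c i\<bar>) * (T l / (2 * a))" by (simp only: sum_distrib_right)
      also have "\<dots> \<le> 2 * a * (T l / (2 * a))" using V[OF c(1)] T[of l] a by (intro mult_right_mono) auto
      finally show "(\<Sum>i\<in>cells l. \<bar>real_of_int (z i)\<bar>) \<le> T l" using a by simp
    qed (use b in \<open>auto intro: less_imp_le\<close>)
    finally show "(\<Sum>i\<in>I. b (sh i) * \<bar>real_of_int (z i)\<bar>) \<le> (\<Sum>l\<in>sh ` I. b l * T l)" .
  qed
  moreover have "exp (\<Sum>l\<in>sh ` I. b l * T l) * (\<Prod>i\<in>I. 1 + 2 / (exp (b (sh i)) - 1)) \<le> exp (70 * chain_const * D * 2 ^ r)"
  proof -
    have "(\<Prod>i\<in>I. 1 + 2 / (exp (b (sh i)) - 1)) = (\<Prod>l\<in>sh ` I. \<Prod>i\<in>cells l. 1 + 2 / (exp (b (sh i)) - 1))"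
      by (rule prod.image_gen[OF finite_I])
    also have "\<dots> = (\<Prod>l\<in>sh ` I. (1 + 2 * T l / N l) ^ card (cells l))"
      by (intro prod.cong) (auto simp: eb)
    also have "\<dots> \<le> (\<Prod>l\<in>sh ` I. exp (N l * ln (1 + 2 * T l / N l)))"
    proof (rule prod_mono, safe)
      fix i assume i: "i \<in> I"
      let ?l = "sh i"
      have ge: "1 + 2 * T ?l / N ?l \<ge> 1" using T[of ?l] N[of ?l] by simp
      show "0 \<le> (1 + 2 * T ?l / N ?l) ^ card (cells ?l)" using ge by simp
      have "(1 + 2 * T ?l / N ?l) ^ card (cells ?l) \<le> (1 + 2 * T ?l / N ?l) ^ (2 ^ lev ?l)"
        using ge card_cells i by (intro power_increasing) auto
      also have "\<dots> = (1 + 2 * T ?l / N ?l) powr real (2 ^ lev ?l)"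
        using ge by (subst powr_realpow) auto
      also have "\<dots> = exp (N ?l * ln (1 + 2 * T ?l / N ?l))" using ge by (simp add: powr_def N_def)
      finally show "(1 + 2 * T ?l / N ?l) ^ card (cells ?l) \<le> exp (N ?l * ln (1 + 2 * T ?l / N ?l))" .
    qed
    also have "\<dots> = exp (\<Sum>l\<in>sh ` I. N l * ln (1 + 2 * T l / N l))" using finite_I by (simp add: exp_sum)
    finally have "exp (\<Sum>l\<in>sh ` I. b l * T l) * (\<Prod>i\<in>I. 1 + 2 / (exp (b (sh i)) - 1))
        \<le> exp (\<Sum>l\<in>sh ` I. b l * T l) * exp (\<Sum>l\<in>sh ` I. N l * ln (1 + 2 * T l / N l))" by simp
    also have "\<dots> = exp (\<Sum>l\<in>sh ` I. T l * ln (1 + N l / T l) + N l * ln (1 + 2 * T l / N l))"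
      by (simp add: b_def sum.distrib mult.commute flip: exp_add)
    also have "(\<Sum>l\<in>sh ` I. T l * ln (1 + N l / T l) + N l * ln (1 + 2 * T l / N l)) \<le> (\<Sum>l\<in>sh ` I. 70 * 2 ^ r * chain_weight (lev l) r)"
      unfolding T_def N_def by (intro sum_mono shape_entropy_le)
    also have "\<dots> = 70 * 2 ^ r * (\<Sum>l\<in>sh ` I. chain_weight (lev l) r)" by (simp add: sum_distrib_left)
    also have "(\<Sum>l\<in>sh ` I. chain_weight (lev l) r) \<le> D * (\<Sum>m\<le>J. chain_weight m r)"
      by (rule sum_shapes_le) (simp add: less_imp_le)
    also have "\<dots> \<le> D * chain_const"
      using card_shapes[of 0] by (intro mult_left_mono sum_chain_weight_le) linarith
    finally show ?thesis by (simp add: field_simps)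
  qed
  ultimately show ?thesis by linarith
qed

end

section \<open>Chaining\<close>

text \<open>In the application \<open>C\<close> holds the coefficients of the cells of depth less
  than \<open>J\<close>, \<open>W\<close> the bounds for the cells of depth \<open>J\<close>, and
  \<open>h0\<close> is the minimiser of the risk over the class \<open>T\<close> at sample size
  \<open>n\<close>.\<close>

locale chaining = cell_system P I sh lev R J D
  for P :: "'o measure" and I :: "'i set" and sh :: "'i \<Rightarrow> 's" and lev :: "'s \<Rightarrow> nat"
    and R :: "'i \<Rightarrow> 'o set" and J :: nat and D :: real +
  fixes M :: "'w measure" and obs :: "nat \<Rightarrow> 'w \<Rightarrow> 'o" and n :: nat
    and T :: "'t set" and L :: "'t \<Rightarrow> 'o \<Rightarrow> real" and C W :: "'t \<Rightarrow> 'i \<Rightarrow> real" and a :: real and h0 :: 't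
  assumes prob_M: "prob_space M"
    and indep: "prob_space.indep_vars M (\<lambda>_. P) obs {1..}"
    and ident: "\<And>i. i \<ge> 1 \<Longrightarrow> distr M P (obs i) = P"
    and n: "n \<ge> 1" and a: "a > 0" and D: "D \<ge> 1"
    and h0: "h0 \<in> T"
    and L_measurable: "\<And>h. h \<in> T \<Longrightarrow> L h \<in> borel_measurable P"
    and C_sum: "\<And>h l. h \<in> T \<Longrightarrow> (\<Sum>i\<in>cells l. \<bar>C h i\<bar>) \<le> 2 * a"
    and W_nonneg: "\<And>h i. h \<in> T \<Longrightarrow> W h i \<ge> 0"
    and W_sum: "\<And>h l. h \<in> T \<Longrightarrow> (\<Sum>i\<in>cells l. W h i) \<le> 2 * a"
    and W_level: "\<And>h i. h \<in> T \<Longrightarrow> lev (sh i) \<noteq> J \<Longrightarrow> W h i = 0"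
    and L_lipschitz: "\<And>h h' z. h \<in> T \<Longrightarrow> h' \<in> T \<Longrightarrow> z \<in> space P \<Longrightarrow>
      \<bar>L h z - L h' z\<bar> \<le> a * (step_fun (\<lambda>i. \<bar>C h i - C h' i\<bar>) z + step_fun (\<lambda>i. W h i + W h' i) z)"
    and L_bounded: "\<And>h h' z. h \<in> T \<Longrightarrow> h' \<in> T \<Longrightarrow> z \<in> space P \<Longrightarrow> \<bar>L h z - L h' z\<bar> \<le> 4 * a\<^sup>2"
begin

sublocale M: prob_space M by (rule prob_M)

lemma obs_measurable: "i \<ge> 1 \<Longrightarrow> obs i \<in> measurable M P"
  using indep by (auto simp: M.indep_vars_def)

definition emp :: "'w \<Rightarrow> ('o \<Rightarrow> real) \<Rightarrow> real" where
  "emp \<omega> g = (\<Sum>i = 1..n. g (obs i \<omega>)) / real n"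

text \<open>One-sided by design: the excess risk of an empirical minimiser is at most the value of
  \<open>dev\<close> at its excess loss, so upper bounds on this signed quantity suffice.\<close>

definition dev :: "'w \<Rightarrow> ('o \<Rightarrow> real) \<Rightarrow> real" where
  "dev \<omega> g = (\<integral>z. g z \<partial>P) - emp \<omega> g"

lemma obs_space: "\<omega> \<in> space M \<Longrightarrow> i \<ge> 1 \<Longrightarrow> obs i \<omega> \<in> space P"
  using measurable_space[OF obs_measurable] by blast

lemma emp_mono:
  assumes "\<omega> \<in> space M" "\<And>z. z \<in> space P \<Longrightarrow> f z \<le> g z" shows "emp \<omega> f \<le> emp \<omega> g"
  unfolding emp_def using obs_space[OF assms(1)] assms(2) by (intro divide_right_mono sum_mono) auto

lemma emp_add: "emp \<omega> (\<lambda>z. f z + g z) = emp \<omega> f + emp \<omega> g"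
  by (simp add: emp_def sum.distrib add_divide_distrib)

lemma emp_cmult: "emp \<omega> (\<lambda>z. c * g z) = c * emp \<omega> g"
  by (simp add: emp_def sum_distrib_left)

lemma emp_const: "emp \<omega> (\<lambda>z. c) = c"
  using n by (simp add: emp_def)

lemma dev_add:
  assumes "integrable P f" "integrable P g"
  shows "dev \<omega> (\<lambda>z. f z + g z) = dev \<omega> f + dev \<omega> g"
  using assms by (simp add: dev_def emp_add)

lemma dev_le_abs:
  assumes \<omega>: "\<omega> \<in> space M" and f: "f \<in> borel_measurable P" and g: "integrable P g"
    and le: "\<And>z. z \<in> space P \<Longrightarrow> \<bar>f z\<bar> \<le> g z"
  shows "dev \<omega> f \<le> (\<integral>z. g z \<partial>P) + emp \<omega> g"
proof -
  have if1: "integrable P f" by (rule Bochner_Integration.integrable_bound[OF g f]) (use le in \<open>fastforce intro!: AE_I2\<close>)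
  have "(\<integral>z. f z \<partial>P) \<le> (\<integral>z. g z \<partial>P)"
    by (rule integral_mono[OF if1 g]) (use le in fastforce)
  moreover have "emp \<omega> (\<lambda>z. (- 1) * f z) \<le> emp \<omega> g"
    by (rule emp_mono[OF \<omega>]) (use le in fastforce)
  ultimately show ?thesis unfolding dev_def emp_cmult by simp
qed

lemma bounded_integrable:
  assumes "f \<in> borel_measurable P" "\<And>z. z \<in> space P \<Longrightarrow> \<bar>f z\<bar> \<le> (c::real)"
  shows "integrable P f"
  by (rule P.integrable_const_bound[where B = c]) (use assms in auto)

lemma L_diff_measurable: "h \<in> T \<Longrightarrow> h' \<in> T \<Longrightarrow> (\<lambda>z. L h z - L h' z) \<in> borel_measurable P"
  using L_measurable by (intro borel_measurable_diff) auto

lemma L_diff_integrable: "h \<in> T \<Longrightarrow> h' \<in> T \<Longrightarrow> integrable P (\<lambda>z. L h z - L h' z)"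
  by (rule bounded_integrable[OF L_diff_measurable L_bounded])

definition entropy_const :: real where "entropy_const = 70 * chain_const * D"

lemma entropy_const_ge: "entropy_const \<ge> 1"
proof -
  have "2 * 1 \<le> chain_const * D" using chain_const_ge_2 D by (intro mult_mono) auto
  then show ?thesis by (simp add: entropy_const_def)
qed

text \<open>Representatives are members of \<open>T\<close>, so the bounds on the losses apply to
  them. They depend on \<open>h\<close> only through its code, so there are at most as many as
  codes.\<close>

definition rep :: "nat \<Rightarrow> 't \<Rightarrow> 't" where
  "rep r h = (SOME h'. h' \<in> T \<and> cell_code a r (C h') = cell_code a r (C h))"

lemma rep: "h \<in> T \<Longrightarrow> rep r h \<in> T \<and> cell_code a r (C (rep r h)) = cell_code a r (C h)"
  unfolding rep_def by (rule someI[of _ h]) simp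

lemma card_rep: "finite (rep r ` T) \<and> real (card (rep r ` T)) \<le> exp (entropy_const * 2 ^ r)"
proof -
  let ?F = "\<lambda>k. SOME h'. h' \<in> T \<and> cell_code a r (C h') = k"
  have eq: "rep r ` T = ?F ` (cell_code a r ` (C ` T))" by (auto simp: rep_def image_image)
  have c: "finite (cell_code a r ` (C ` T)) \<and> real (card (cell_code a r ` (C ` T))) \<le> exp (entropy_const * 2 ^ r)"
    unfolding entropy_const_def by (rule card_cell_codes_le[OF a]) (use C_sum in auto)
  then have "card (rep r ` T) \<le> card (cell_code a r ` (C ` T))" unfolding eq by (intro card_image_le) auto
  with c show ?thesis unfolding eq by auto
qed

lemma sum_abs_diff_C_le:
  assumes "h \<in> T" "h' \<in> T"
  shows "(\<Sum>i\<in>cells l. \<bar>C h i - C h' i\<bar>) \<le> 4 * a"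
proof -
  have "(\<Sum>i\<in>cells l. \<bar>C h i - C h' i\<bar>) \<le> (\<Sum>i\<in>cells l. \<bar>C h i\<bar> + \<bar>C h' i\<bar>)"
    by (intro sum_mono) linarith
  then show ?thesis using C_sum[OF assms(1), of l] C_sum[OF assms(2), of l] by (simp add: sum.distrib)
qed

lemma close_rep:
  assumes "h \<in> T" shows "close_at a r (\<lambda>i. \<bar>C h i - C (rep r h) i\<bar>)"
  unfolding close_at_def
proof (intro conjI ballI allI sum_abs_diff_C_le)
  fix i assume i: "i \<in> I"
  have "\<bar>C h i - C (rep r h) i\<bar> \<le> 4 * a * resolution (lev (sh i)) r"
    by (rule cell_code_eq_imp_close[OF _ i a]) (use rep[OF assms, of r] in simp)
  also have "\<dots> \<le> 8 * a * resolution (lev (sh i)) r" using a by simp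
  finally show "\<bar>C h i - C (rep r h) i\<bar> \<le> 8 * a * resolution (lev (sh i)) r" .
qed (use assms rep in auto)

lemma close_rep_Suc:
  assumes "h \<in> T" shows "close_at a r (\<lambda>i. \<bar>C (rep (Suc r) h) i - C (rep r h) i\<bar>)"
  unfolding close_at_def
proof (intro conjI ballI allI sum_abs_diff_C_le)
  fix i assume i: "i \<in> I"
  have 1: "\<bar>C h i - C (rep r h) i\<bar> \<le> 4 * a * resolution (lev (sh i)) r"
    by (rule cell_code_eq_imp_close[OF _ i a]) (use rep[OF assms, of r] in simp)
  have 2: "\<bar>C h i - C (rep (Suc r) h) i\<bar> \<le> 4 * a * resolution (lev (sh i)) (Suc r)"
    by (rule cell_code_eq_imp_close[OF _ i a]) (use rep[OF assms, of "Suc r"] in simp)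
  have "resolution (lev (sh i)) (Suc r) \<le> resolution (lev (sh i)) r"
    unfolding resolution_def by (intro powr_mono) (auto simp: field_simps)
  then have "4 * a * resolution (lev (sh i)) (Suc r) \<le> 4 * a * resolution (lev (sh i)) r"
    using a by simp
  then show "\<bar>C (rep (Suc r) h) i - C (rep r h) i\<bar> \<le> 8 * a * resolution (lev (sh i)) r"
    using 1 2 by linarith
qed (use assms rep in auto)

definition remainder :: "'t \<Rightarrow> 't \<Rightarrow> 'o \<Rightarrow> real" where
  "remainder h h' = step_fun (\<lambda>i. W h i + W h' i)"

lemma remainder_measurable [measurable]: "remainder h h' \<in> borel_measurable P"
  by (simp add: remainder_def)

lemma remainder_nonneg: "h \<in> T \<Longrightarrow> h' \<in> T \<Longrightarrow> remainder h h' z \<ge> 0"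
  unfolding remainder_def using W_nonneg by (intro step_fun_nonneg) auto

lemma integrable_remainder: "integrable P (remainder h h')"
  unfolding remainder_def by (rule integrable_step_fun)

lemma sum_W_le:
  assumes "h \<in> T" "h' \<in> T"
  shows "(\<Sum>i\<in>I. W h i + W h' i) \<le> 4 * a * D"
proof -
  have "(\<Sum>i\<in>I. W h i + W h' i) = (\<Sum>l\<in>sh ` I. \<Sum>i\<in>cells l. W h i + W h' i)"
    by (rule sum_cells)
  also have "\<dots> \<le> (\<Sum>l\<in>sh ` I. if lev l = J then 4 * a else 0)"
  proof (rule sum_mono)
    fix l
    show "(\<Sum>i\<in>cells l. W h i + W h' i) \<le> (if lev l = J then 4 * a else 0)"
    proof (cases "lev l = J")
      case True
      then show ?thesis using W_sum[OF assms(1), of l] W_sum[OF assms(2), of l] by (simp add: sum.distrib)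
    next
      case False
      then show ?thesis using W_level assms by (auto intro!: sum_nonpos)
    qed
  qed
  also have "\<dots> = real (card {l \<in> sh ` I. lev l = J}) * (4 * a)"
    using finite_I by (simp add: sum.inter_filter[symmetric])
  also have "\<dots> \<le> D * (4 * a)" using card_shapes a by (intro mult_right_mono) auto
  finally show ?thesis by (simp add: mult.commute)
qed

lemma remainder_le: "h \<in> T \<Longrightarrow> h' \<in> T \<Longrightarrow> remainder h h' z \<le> 4 * a * D"
proof -
  assume t: "h \<in> T" "h' \<in> T"
  have "remainder h h' z \<le> (\<Sum>i\<in>I. W h i + W h' i)"
    unfolding remainder_def step_fun_def using W_nonneg t by (intro sum_mono) (auto simp: indicator_def)
  with sum_W_le[OF t] show ?thesis by simp
qed

lemma integral_remainder_le:
  assumes "h \<in> T" "h' \<in> T"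
  shows "(\<integral>z. remainder h h' z \<partial>P) \<le> 4 * a * D / 2 ^ J"
proof -
  have "(\<integral>z. remainder h h' z \<partial>P) = (\<Sum>i\<in>I. (W h i + W h' i) * measure P (R i))"
    unfolding remainder_def by (rule integral_step_fun)
  also have "\<dots> \<le> (\<Sum>i\<in>I. (W h i + W h' i) * (1 / 2 ^ J))"
  proof (rule sum_mono)
    fix i assume i: "i \<in> I"
    show "(W h i + W h' i) * measure P (R i) \<le> (W h i + W h' i) * (1 / 2 ^ J)"
    proof (cases "lev (sh i) = J")
      case True
      then show ?thesis using R_mass[OF i] W_nonneg assms by (intro mult_left_mono) auto
    next
      case False
      then show ?thesis using W_level assms by simp
    qed
  qed
  also have "\<dots> = (\<Sum>i\<in>I. W h i + W h' i) / 2 ^ J" by (simp add: sum_divide_distrib)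
  also have "\<dots> \<le> 4 * a * D / 2 ^ J" using sum_W_le[OF assms] by (intro divide_right_mono) auto
  finally show ?thesis .
qed

lemma integral_remainder_sq_le:
  assumes "h \<in> T" "h' \<in> T"
  shows "(\<integral>z. (remainder h h' z)\<^sup>2 \<partial>P) \<le> (4 * a * D)\<^sup>2 / 2 ^ J"
proof -
  have nn: "0 \<le> remainder h h' z" "remainder h h' z \<le> 4 * a * D" for z
    using remainder_nonneg[OF assms] remainder_le[OF assms] by auto
  have "(\<integral>z. (remainder h h' z)\<^sup>2 \<partial>P) \<le> (\<integral>z. 4 * a * D * remainder h h' z \<partial>P)"
  proof (rule integral_mono_AE')
    show "integrable P (\<lambda>z. 4 * a * D * remainder h h' z)" using integrable_remainder by simp
    show "AE z in P. (remainder h h' z)\<^sup>2 \<le> 4 * a * D * remainder h h' z"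
      unfolding power2_eq_square using nn by (intro AE_I2 mult_right_mono)
    show "AE z in P. 0 \<le> 4 * a * D * remainder h h' z"
      using nn a D by (intro AE_I2 mult_nonneg_nonneg) auto
  qed
  also have "\<dots> = 4 * a * D * (\<integral>z. remainder h h' z \<partial>P)" by simp
  also have "\<dots> \<le> 4 * a * D * (4 * a * D / 2 ^ J)"
    using a D by (intro mult_left_mono integral_remainder_le assms) auto
  finally show ?thesis by (simp add: power2_eq_square)
qed

section \<open>Collisions of observations in the deepest cells\<close>

abbreviation collision :: "'i \<Rightarrow> nat \<Rightarrow> nat \<Rightarrow> 'w set" where
  "collision i j k \<equiv> {\<omega> \<in> space M. obs j \<omega> \<in> R i \<and> obs k \<omega> \<in> R i}"

text \<open>Outside this event every cell of depth \<open>J\<close> holds at most one of the first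
  \<open>n\<close> observations, hence has empirical mass at most \<open>1 / n\<close>. That one
  event controls the deepest level for the whole class, where a union bound over functions is out of
  reach.\<close>

definition crowded :: "'w set" where
  "crowded = (\<Union>i\<in>{i \<in> I. lev (sh i) = J}. \<Union>(j, k)\<in>{(j, k). j \<in> {1..n} \<and> k \<in> {1..n} \<and> j < k}.
     collision i j k)"

lemma finite_pairs: "finite {(j, k). j \<in> {1..n} \<and> k \<in> {1..n} \<and> j < k}"
  by (rule finite_subset[of _ "{1..n} \<times> {1..n}"]) auto

lemma both_in_cell:
  assumes i: "i \<in> I" and jk: "1 \<le> j" "1 \<le> k" "j < k"
  shows "collision i j k \<in> sets M"
    and "measure M (collision i j k) = (measure P (R i))\<^sup>2"
proof -
  have eq: "collision i j k = (\<Inter>m\<in>{j, k}. obs m -` R i \<inter> space M)" by auto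
  show "collision i j k \<in> sets M"
    unfolding eq using obs_measurable jk R_sets[OF i] by (intro sets.finite_INT) (auto intro: measurable_sets)
  have single: "measure M (obs m -` R i \<inter> space M) = measure P (R i)" if "m \<ge> 1" for m
    using measure_distr[OF obs_measurable[OF that] R_sets[OF i]] ident[OF that] by simp
  have "measure M (\<Inter>m\<in>{j, k}. obs m -` R i \<inter> space M) = (\<Prod>m\<in>{j, k}. measure M (obs m -` R i \<inter> space M))"
    by (rule M.indep_varsD[OF indep]) (use jk R_sets[OF i] in auto)
  also have "\<dots> = (measure P (R i))\<^sup>2" using jk single by (simp add: power2_eq_square)
  finally show "measure M (collision i j k) = (measure P (R i))\<^sup>2" unfolding eq .
qed

lemma crowded_sets: "crowded \<in> sets M"
  unfolding crowded_def using finite_I finite_pairs both_in_cell(1)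
  by (intro sets.finite_UN) auto

text \<open>A union bound: at most \<open>D * 2 ^ J\<close> cells and \<open>n ^ 2\<close> pairs,
  each with probability at most \<open>(1 / 2 ^ J) ^ 2\<close> by independence.\<close>

lemma prob_crowded: "measure M crowded \<le> D * (real n)\<^sup>2 / 2 ^ J"
proof -
  let ?IJ = "{i \<in> I. lev (sh i) = J}" and ?K = "{(j, k). j \<in> {1..n} \<and> k \<in> {1..n} \<and> j < k}"
  let ?E = "\<lambda>i (j, k). collision i j k"
  have fin: "finite ?IJ" using finite_I by simp
  have "measure M crowded \<le> (\<Sum>i\<in>?IJ. measure M (\<Union>p\<in>?K. ?E i p))"
    unfolding crowded_def using fin finite_pairs both_in_cell(1)
    by (intro M.finite_measure_subadditive_finite) (auto intro!: sets.finite_UN)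
  also have "\<dots> \<le> (\<Sum>i\<in>?IJ. real n ^ 2 * (1 / 2 ^ J)\<^sup>2)"
  proof (rule sum_mono)
    fix i assume i: "i \<in> ?IJ"
    have "measure M (\<Union>p\<in>?K. ?E i p) \<le> (\<Sum>p\<in>?K. measure M (?E i p))"
      using finite_pairs both_in_cell(1) i by (intro M.finite_measure_subadditive_finite) auto
    also have "\<dots> \<le> (\<Sum>p\<in>?K. (1 / 2 ^ J)\<^sup>2)"
    proof (rule sum_mono)
      fix p assume "p \<in> ?K"
      then obtain j k where p: "p = (j, k)" "1 \<le> j" "1 \<le> k" "j < k" by auto
      have "measure M (?E i p) = (measure P (R i))\<^sup>2" using both_in_cell(2)[of i j k] p i by simp
      also have "\<dots> \<le> (1 / 2 ^ J)\<^sup>2" using R_mass[of i] i by (intro power_mono) auto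
      finally show "measure M (?E i p) \<le> (1 / 2 ^ J)\<^sup>2" .
    qed
    also have "\<dots> = real (card ?K) * (1 / 2 ^ J)\<^sup>2" by simp
    also have "\<dots> \<le> real n ^ 2 * (1 / 2 ^ J)\<^sup>2"
    proof (rule mult_right_mono)
      have "card ?K \<le> card ({1..n} \<times> {1..n})" by (rule card_mono) auto
      then have "card ?K \<le> n ^ 2" by (simp add: card_cartesian_product power2_eq_square)
      then have "real (card ?K) \<le> real (n ^ 2)" by (simp only: of_nat_le_iff)
      then show "real (card ?K) \<le> real n ^ 2" by simp
    qed simp
    finally show "measure M (\<Union>p\<in>?K. ?E i p) \<le> real n ^ 2 * (1 / 2 ^ J)\<^sup>2" .
  qed
  also have "\<dots> = real (card ?IJ) * (real n ^ 2 * (1 / 2 ^ J)\<^sup>2)" by simp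
  also have "\<dots> \<le> (D * 2 ^ J) * (real n ^ 2 * (1 / 2 ^ J)\<^sup>2)"
  proof (rule mult_right_mono)
    have "real (card ?IJ) = (\<Sum>i\<in>I. if lev (sh i) = J then 1 else 0)"
      using finite_I by (simp add: sum.inter_filter[symmetric])
    also have "\<dots> = (\<Sum>l\<in>sh ` I. \<Sum>i\<in>cells l. if lev (sh i) = J then 1 else 0)" by (rule sum_cells)
    also have "\<dots> \<le> (\<Sum>l\<in>sh ` I. if lev l = J then 2 ^ J else 0)"
    proof (rule sum_mono)
      fix l assume l: "l \<in> sh ` I"
      have "real (card (cells l)) \<le> real (2 ^ lev l)" using card_cells[OF l] by (simp only: of_nat_le_iff)
      then show "(\<Sum>i\<in>cells l. if lev (sh i) = J then 1 else 0) \<le> (if lev l = J then 2 ^ J else 0 :: real)"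
        by auto
    qed
    also have "\<dots> = real (card {l \<in> sh ` I. lev l = J}) * 2 ^ J"
      using finite_I by (simp add: sum.inter_filter[symmetric])
    also have "\<dots> \<le> D * 2 ^ J" using card_shapes by (intro mult_right_mono) auto
    finally show "real (card ?IJ) \<le> D * 2 ^ J" .
  qed simp
  also have "\<dots> = D * (real n)\<^sup>2 / 2 ^ J" by (simp add: power2_eq_square field_simps)
  finally show ?thesis .
qed

lemma emp_remainder_le:
  assumes t: "h \<in> T" "h' \<in> T" and \<omega>: "\<omega> \<in> space M" "\<omega> \<notin> crowded"
  shows "emp \<omega> (remainder h h') \<le> 4 * a * D / real n"
proof -
  let ?D = "\<lambda>i. W h i + W h' i"
  have count: "(\<Sum>k = 1..n. indicator (R i) (obs k \<omega>)) \<le> (1::real)" if i: "i \<in> I" "lev (sh i) = J" for i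
  proof (cases "\<exists>k\<in>{1..n}. obs k \<omega> \<in> R i")
    case True
    then obtain k where k: "k \<in> {1..n}" "obs k \<omega> \<in> R i" by blast
    have "obs j \<omega> \<notin> R i" if j: "j \<in> {1..n} - {k}" for j
    proof
      assume "obs j \<omega> \<in> R i"
      \<comment> \<open>The pairs in \<open>crowded\<close> are ordered, whereas \<open>j\<close>
        may lie on either side of \<open>k\<close>.\<close>
      moreover have "(min j k, max j k) \<in> {(j, k). j \<in> {1..n} \<and> k \<in> {1..n} \<and> j < k}" using j k by auto
      moreover have "obs (min j k) \<omega> \<in> R i" "obs (max j k) \<omega> \<in> R i" using k \<open>obs j \<omega> \<in> R i\<close> by (auto simp: min_def max_def)
      ultimately have "\<omega> \<in> crowded" unfolding crowded_def using i \<omega>(1) by blast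
      with \<omega>(2) show False by simp
    qed
    then have "(\<Sum>k = 1..n. indicator (R i) (obs k \<omega>)) = (\<Sum>k\<in>{k}. indicator (R i) (obs k \<omega>) :: real)"
      using k by (intro sum.mono_neutral_right) auto
    then show ?thesis by simp
  next
    case False
    then have "(\<Sum>k = 1..n. indicator (R i) (obs k \<omega>)) = (0::real)" by (intro sum.neutral) auto
    then show ?thesis by simp
  qed
  have "(\<Sum>k = 1..n. remainder h h' (obs k \<omega>)) = (\<Sum>i\<in>I. ?D i * (\<Sum>k = 1..n. indicator (R i) (obs k \<omega>)))"
    unfolding remainder_def step_fun_def by (subst sum.swap) (simp add: sum_distrib_left)
  also have "\<dots> \<le> (\<Sum>i\<in>I. ?D i)"
  proof (rule sum_mono)
    fix i assume i: "i \<in> I"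
    show "?D i * (\<Sum>k = 1..n. indicator (R i) (obs k \<omega>)) \<le> ?D i"
    proof (cases "lev (sh i) = J")
      case True
      have "?D i * (\<Sum>k = 1..n. indicator (R i) (obs k \<omega>)) \<le> ?D i * 1"
        using count[OF i True] W_nonneg t by (intro mult_left_mono) auto
      then show ?thesis by simp
    next
      case False
      then show ?thesis using W_level t by simp
    qed
  qed
  also have "\<dots> \<le> 4 * a * D" by (rule sum_W_le[OF t])
  finally show ?thesis unfolding emp_def by (intro divide_right_mono) auto
qed

abbreviation exceedance :: "('o \<Rightarrow> real) \<Rightarrow> real \<Rightarrow> 'w set" where
  "exceedance g x \<equiv> {\<omega> \<in> space M. dev \<omega> g > x}"

lemma bernstein_dev:
  assumes g: "g \<in> borel_measurable P" and b: "\<And>z. z \<in> space P \<Longrightarrow> \<bar>g z\<bar> \<le> b"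
    and v: "(\<integral>z. (g z)\<^sup>2 \<partial>P) \<le> v" and l: "0 < l" "l * b \<le> 1"
  shows "exceedance g (l * v + t / (real n * l)) \<in> sets M"
    and "measure M (exceedance g (l * v + t / (real n * l))) \<le> exp (- t)"
proof -
  have [measurable]: "(\<lambda>\<omega>. g (obs i \<omega>)) \<in> borel_measurable M" if "i \<in> {1..n}" for i
    by (rule measurable_compose[OF obs_measurable g]) (use that in simp)
  have [measurable]: "(\<lambda>\<omega>. dev \<omega> g) \<in> borel_measurable M"
    unfolding dev_def emp_def by measurable
  show "exceedance g (l * v + t / (real n * l)) \<in> sets M" by measurable
  \<comment> \<open>\<open>dev\<close> is the mean minus the empirical mean, so its upper tail is
    that of the empirical mean of \<open>- g\<close>.\<close>
  have "measure M {\<omega> \<in> space M. (\<integral>z. - g z \<partial>P) + l * v + t / (real n * l) < (\<Sum>i = 1..n. - g (obs i \<omega>)) / real n} \<le> exp (- t)"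
    by (rule bernstein_upper[OF prob_M prob_P indep ident _ _ _ l n]) (use g b v in auto)
  also have "{\<omega> \<in> space M. (\<integral>z. - g z \<partial>P) + l * v + t / (real n * l) < (\<Sum>i = 1..n. - g (obs i \<omega>)) / real n}
    = exceedance g (l * v + t / (real n * l))"
    by (auto simp: dev_def emp_def sum_negf)
  finally show "measure M (exceedance g (l * v + t / (real n * l))) \<le> exp (- t)" .
qed

end

section \<open>Bernstein bounds for the links and for the first net\<close>

definition clip :: "real \<Rightarrow> real \<Rightarrow> real" where
  "clip b x = max (- b) (min b x)"

lemma clip_bounds: "b \<ge> 0 \<Longrightarrow> \<bar>clip b x\<bar> \<le> b"
  by (auto simp: clip_def)

lemma abs_minus_clip_le: "b \<ge> 0 \<Longrightarrow> d \<ge> 0 \<Longrightarrow> \<bar>x\<bar> \<le> b + d \<Longrightarrow> \<bar>x - clip b x\<bar> \<le> d"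
  by (auto simp: clip_def)

context chaining
begin

definition link_sd :: "nat \<Rightarrow> real" where
  "link_sd r = 8 * a\<^sup>2 * chain_const * D / 2 ^ r"

definition link_sup :: "nat \<Rightarrow> real" where
  "link_sup r = link_sd r * 2 powr ((real J - real r) / 16)"

text \<open>Bernstein's deviation \<open>t * b / n + 2 * s * sqrt (t / n)\<close> with confidence
  \<open>t = 4 * entropy_const * 2 ^ r\<close>, range \<open>b = link_sup r\<close> and standard
  deviation \<open>s = link_sd r\<close>.\<close>

definition link_dev :: "nat \<Rightarrow> real" where
  "link_dev r = 4 * entropy_const * 2 ^ r * link_sup r / real n + 2 * link_sd r * sqrt (4 * entropy_const * 2 ^ r / real n)"

lemma link_pos: "link_sd r > 0" "link_sup r > 0"
  using a D chain_const_ge_2 by (auto simp: link_sd_def link_sup_def)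

text \<open>
  The last level of the tree is only controlled in \<open>L\<^sup>1\<close>, not uniformly.  Clipping the increments at
  the contribution of the other levels makes Bernstein's inequality applicable.
\<close>

definition clipped :: "'t \<Rightarrow> 't \<Rightarrow> 'o \<Rightarrow> real" where
  "clipped h h' z = clip (a * step_fun (\<lambda>i. \<bar>C h i - C h' i\<bar>) z) (L h z - L h' z)"

lemma clipped_measurable:
  assumes "h \<in> T" "h' \<in> T" shows "clipped h h' \<in> borel_measurable P"
  using L_diff_measurable[OF assms] unfolding clipped_def[abs_def] clip_def by measurable

lemma step_fun_abs_nonneg: "0 \<le> a * step_fun (\<lambda>i. \<bar>g i\<bar>) z"
  using a by (intro mult_nonneg_nonneg step_fun_nonneg) auto

lemma clipped_le: "\<bar>clipped h h' z\<bar> \<le> a * step_fun (\<lambda>i. \<bar>C h i - C h' i\<bar>) z"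
  unfolding clipped_def by (rule clip_bounds[OF step_fun_abs_nonneg])

lemma diff_clipped_le:
  assumes "h \<in> T" "h' \<in> T" "z \<in> space P"
  shows "\<bar>L h z - L h' z - clipped h h' z\<bar> \<le> a * remainder h h' z"
  unfolding clipped_def using L_lipschitz[OF assms] remainder_nonneg[OF assms(1,2)] a
  by (intro abs_minus_clip_le step_fun_abs_nonneg mult_nonneg_nonneg) (auto simp: remainder_def distrib_left)

text \<open>What clipping removes is at most \<open>a\<close> times the remainder. Its mean is small
  because deep cells have small mass, and its empirical mean is small outside
  \<open>crowded\<close>, in both cases uniformly over the class.\<close>

lemma dev_link:
  assumes t: "h \<in> T" "h' \<in> T" and \<omega>: "\<omega> \<in> space M" "\<omega> \<notin> crowded"
  shows "dev \<omega> (\<lambda>z. L h z - L h' z) \<le> dev \<omega> (clipped h h') + 4 * a\<^sup>2 * D * (1 / 2 ^ J + 1 / real n)"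
proof -
  let ?g = "\<lambda>z. L h z - L h' z - clipped h h' z"
  have ir: "integrable P (\<lambda>z. a * remainder h h' z)" using integrable_remainder by simp
  have mg: "?g \<in> borel_measurable P" using L_diff_measurable[OF t] clipped_measurable[OF t] by measurable
  have ig: "integrable P ?g"
    by (rule Bochner_Integration.integrable_bound[OF ir mg]) (use diff_clipped_le[OF t] in \<open>fastforce intro!: AE_I2\<close>)
  have ic: "integrable P (clipped h h')"
    using Bochner_Integration.integrable_diff[OF L_diff_integrable[OF t] ig] by simp
  have "dev \<omega> (\<lambda>z. L h z - L h' z) = dev \<omega> (\<lambda>z. clipped h h' z + ?g z)" by simp
  also have "\<dots> = dev \<omega> (clipped h h') + dev \<omega> ?g" by (rule dev_add[OF ic ig])
  also have "dev \<omega> ?g \<le> (\<integral>z. a * remainder h h' z \<partial>P) + emp \<omega> (\<lambda>z. a * remainder h h' z)"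
    by (rule dev_le_abs[OF \<omega>(1) mg ir diff_clipped_le[OF t]])
  also have "\<dots> = a * ((\<integral>z. remainder h h' z \<partial>P) + emp \<omega> (remainder h h'))"
    by (simp add: emp_cmult distrib_left)
  also have "\<dots> \<le> a * (4 * a * D / 2 ^ J + 4 * a * D / real n)"
    using a by (intro mult_left_mono add_mono integral_remainder_le emp_remainder_le t \<omega>) auto
  also have "\<dots> = 4 * a\<^sup>2 * D * (1 / 2 ^ J + 1 / real n)" by (simp add: power2_eq_square field_simps)
  finally show ?thesis by simp
qed

lemma integrable_step_fun_sq:
  assumes c: "close_at a r (\<lambda>i. \<bar>g i\<bar>)"
  shows "integrable P (\<lambda>z. (step_fun (\<lambda>i. \<bar>g i\<bar>) z)\<^sup>2)"
proof (rule bounded_integrable[where c = "(8 * a * chain_const * D / 2 ^ r * 2 powr ((real J - real r) / 16))\<^sup>2"])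
  show "\<bar>(step_fun (\<lambda>i. \<bar>g i\<bar>) z)\<^sup>2\<bar> \<le> (8 * a * chain_const * D / 2 ^ r * 2 powr ((real J - real r) / 16))\<^sup>2" for z
    using close_at_sup[OF c a, of z] step_fun_nonneg[of "\<lambda>i. \<bar>g i\<bar>" z] by (simp add: power_mono)
qed measurable

text \<open>Indexed by pairs of representatives that occur for a common \<open>h\<close>, so that
  the union is finite.\<close>

definition bad_link :: "nat \<Rightarrow> 'w set" where
  "bad_link r = (\<Union>p\<in>(\<lambda>h. (rep (Suc r) h, rep r h)) ` T. exceedance (clipped (fst p) (snd p)) (link_dev r))"

lemma bad_link_single:
  assumes t: "h \<in> T" "h' \<in> T" and c: "close_at a r (\<lambda>i. \<bar>C h i - C h' i\<bar>)"
  shows "exceedance (clipped h h') (link_dev r) \<in> sets M"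
    and "measure M (exceedance (clipped h h') (link_dev r)) \<le> exp (- (4 * entropy_const * 2 ^ r))"
proof -
  define t where "t = 4 * entropy_const * 2 ^ r"
  have tpos: "t > 0" using entropy_const_ge by (simp add: t_def)
  let ?S = "step_fun (\<lambda>i. \<bar>C h i - C h' i\<bar>)"
  have b: "\<bar>clipped h h' z\<bar> \<le> link_sup r" for z
  proof -
    have "\<bar>clipped h h' z\<bar> \<le> a * ?S z" by (rule clipped_le)
    also have "\<dots> \<le> a * (8 * a * chain_const * D / 2 ^ r * 2 powr ((real J - real r) / 16))"
      using a by (intro mult_left_mono close_at_sup[OF c]) auto
    also have "\<dots> = link_sup r" by (simp add: link_sup_def link_sd_def power2_eq_square)
    finally show ?thesis .
  qed
  have v: "(\<integral>z. (clipped h h' z)\<^sup>2 \<partial>P) \<le> (link_sd r)\<^sup>2"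
  proof -
    have iS: "integrable P (\<lambda>z. (?S z)\<^sup>2)" by (rule integrable_step_fun_sq[OF c])
    have "(\<integral>z. (clipped h h' z)\<^sup>2 \<partial>P) \<le> (\<integral>z. a\<^sup>2 * (?S z)\<^sup>2 \<partial>P)"
    proof (rule integral_mono_AE')
      show "AE z in P. (clipped h h' z)\<^sup>2 \<le> a\<^sup>2 * (?S z)\<^sup>2"
      proof (rule AE_I2)
        fix z
        have "\<bar>clipped h h' z\<bar>\<^sup>2 \<le> (a * ?S z)\<^sup>2" by (rule power_mono[OF clipped_le]) simp
        then show "(clipped h h' z)\<^sup>2 \<le> a\<^sup>2 * (?S z)\<^sup>2" by (simp add: power_mult_distrib)
      qed
    qed (use iS in auto)
    also have "\<dots> = a\<^sup>2 * (\<integral>z. (?S z)\<^sup>2 \<partial>P)" by simp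
    also have "\<dots> \<le> a\<^sup>2 * (8 * a * chain_const * D / 2 ^ r)\<^sup>2"
      by (intro mult_left_mono close_at_L2[OF c a]) auto
    also have "\<dots> = (link_sd r)\<^sup>2" by (simp add: link_sd_def power2_eq_square)
    finally show ?thesis .
  qed
  \<comment> \<open>The exponent \<open>1 / q\<close> would minimise
    \<open>l * v + t / (n * l)\<close> for \<open>v\<close> the squared standard deviation. Adding
    \<open>link_sup r\<close> to the denominator of \<open>l\<close> enforces the range condition
    and costs the term of \<open>link_dev\<close> that is linear in \<open>t / n\<close>.\<close>
  define q where "q = link_sd r * sqrt (real n / t)"
  have q: "q > 0" using link_pos[of r] n tpos by (simp add: q_def)
  define l where "l = 1 / (link_sup r + q)"
  have l: "l > 0" using link_pos[of r] q by (simp add: l_def add_pos_pos)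
  have lb: "l * link_sup r \<le> 1" using link_pos[of r] q by (simp add: l_def field_simps)
  have q2: "(link_sd r)\<^sup>2 = q\<^sup>2 * (t / real n)"
    using n tpos by (simp add: q_def power_mult_distrib)
  have "l * (link_sd r)\<^sup>2 \<le> 1 / q * (link_sd r)\<^sup>2"
    using q link_pos[of r] by (intro mult_right_mono) (auto simp: l_def frac_le)
  also have "\<dots> = q * (t / real n)" using q unfolding q2 by (simp add: power2_eq_square)
  finally have 1: "l * (link_sd r)\<^sup>2 \<le> q * (t / real n)" .
  have 2: "t / (real n * l) = (t / real n) * (link_sup r + q)" by (simp add: l_def)
  have "q * y + y * (x + q) = y * x + 2 * (q * y)" for x y :: real by (simp add: algebra_simps)
  from this[of "t / real n" "link_sup r"]
  have 3: "q * (t / real n) + (t / real n) * (link_sup r + q) = t * link_sup r / real n + 2 * (q * (t / real n))" by simp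
  have "sqrt (real n / t) * (t / real n) = sqrt (t / real n)"
    using n tpos by (simp add: real_sqrt_divide field_simps)
  then have 4: "q * (t / real n) = link_sd r * sqrt (t / real n)" unfolding q_def mult.assoc by (simp only:)
  have le: "l * (link_sd r)\<^sup>2 + t / (real n * l) \<le> link_dev r"
    unfolding link_dev_def t_def[symmetric] mult.assoc[of 2] using 1 2 3 4 by linarith
  note bern = bernstein_dev[OF clipped_measurable[OF assms(1,2)] b v l lb, of t]
  have [measurable]: "(\<lambda>\<omega>. clipped h h' (obs i \<omega>)) \<in> borel_measurable M" if "i \<in> {1..n}" for i
    by (rule measurable_compose[OF obs_measurable clipped_measurable]) (use that assms in auto)
  have [measurable]: "(\<lambda>\<omega>. dev \<omega> (clipped h h')) \<in> borel_measurable M"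
    unfolding dev_def emp_def by measurable
  show "exceedance (clipped h h') (link_dev r) \<in> sets M" by measurable
  have "measure M (exceedance (clipped h h') (link_dev r))
      \<le> measure M (exceedance (clipped h h') (l * (link_sd r)\<^sup>2 + t / (real n * l)))"
    using le by (intro M.finite_measure_mono bern(1)) auto
  also have "\<dots> \<le> exp (- t)" by (rule bern(2))
  finally show "measure M (exceedance (clipped h h') (link_dev r)) \<le> exp (- (4 * entropy_const * 2 ^ r))"
    by (simp add: t_def)
qed

lemma exp_minus_power_le: "exp (- (2 ^ r)) \<le> 1 / (2::real) ^ r"
proof -
  have "(2::real) ^ r \<le> exp (2 ^ r)" using exp_ge_add_one_self[of "2 ^ r :: real"] by linarith
  then show ?thesis by (simp add: exp_minus field_simps)
qed

lemma bad_link: "bad_link r \<in> sets M" "measure M (bad_link r) \<le> 1 / 2 ^ r"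
proof -
  let ?Q = "(\<lambda>h. (rep (Suc r) h, rep r h)) ` T"
  have sub: "?Q \<subseteq> (rep (Suc r) ` T) \<times> (rep r ` T)" by auto
  note c1 = card_rep[of "Suc r"] and c2 = card_rep[of r]
  have fin: "finite ?Q" using finite_subset[OF sub] c1 c2 by auto
  have "card ?Q \<le> card ((rep (Suc r) ` T) \<times> (rep r ` T))"
    using c1 c2 by (intro card_mono sub) auto
  then have "real (card ?Q) \<le> real (card (rep (Suc r) ` T)) * real (card (rep r ` T))"
    by (simp only: card_cartesian_product of_nat_mult[symmetric] of_nat_le_iff)
  also have "\<dots> \<le> exp (entropy_const * 2 ^ Suc r) * exp (entropy_const * 2 ^ r)"
    using c1 c2 by (intro mult_mono) auto
  \<comment> \<open>The nets at scales \<open>r + 1\<close> and \<open>r\<close> have entropies 2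
    and 1 in units of \<open>entropy_const * 2 ^ r\<close>. A confidence of 4 units leaves one for
    the decay in \<open>r\<close>.\<close>
  also have "\<dots> = exp (3 * entropy_const * 2 ^ r)" by (simp flip: exp_add)
  finally have card: "real (card ?Q) \<le> exp (3 * entropy_const * 2 ^ r)" .
  have single: "exceedance (clipped (fst p) (snd p)) (link_dev r) \<in> sets M"
    "measure M (exceedance (clipped (fst p) (snd p)) (link_dev r)) \<le> exp (- (4 * entropy_const * 2 ^ r))"
    if "p \<in> ?Q" for p
    using that bad_link_single[OF _ _ close_rep_Suc] rep by auto
  show "bad_link r \<in> sets M" unfolding bad_link_def using fin single(1) by (intro sets.finite_UN) auto
  have "measure M (bad_link r) \<le> (\<Sum>p\<in>?Q. measure M (exceedance (clipped (fst p) (snd p)) (link_dev r)))"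
    unfolding bad_link_def using fin single(1) by (intro M.finite_measure_subadditive_finite) auto
  also have "\<dots> \<le> (\<Sum>p\<in>?Q. exp (- (4 * entropy_const * 2 ^ r)))" by (intro sum_mono single(2))
  also have "\<dots> = real (card ?Q) * exp (- (4 * entropy_const * 2 ^ r))" by simp
  also have "\<dots> \<le> exp (3 * entropy_const * 2 ^ r) * exp (- (4 * entropy_const * 2 ^ r))"
    using card by (intro mult_right_mono) auto
  also have "\<dots> = exp (- (entropy_const * 2 ^ r))" by (simp flip: exp_add)
  also have "\<dots> \<le> exp (- (2 ^ r))" using entropy_const_ge by simp
  also have "\<dots> \<le> 1 / 2 ^ r" by (rule exp_minus_power_le)
  finally show "measure M (bad_link r) \<le> 1 / 2 ^ r" .
qed

definition L2_dist_sq :: "'t \<Rightarrow> 't \<Rightarrow> real" where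
  "L2_dist_sq h h' = (\<integral>z. (L h z - L h' z)\<^sup>2 \<partial>P)"

text \<open>
  Bernstein's inequality with \<open>l = 1 / (16 * a\<^sup>2)\<close>.  The variance term is later absorbed by the excess
  risk, which replaces a peeling argument.
\<close>

definition start_dev :: "nat \<Rightarrow> 't \<Rightarrow> real" where
  "start_dev r h = L2_dist_sq h h0 / (16 * a\<^sup>2) + 16 * a\<^sup>2 * (2 * entropy_const * 2 ^ r) / real n"

definition bad_start :: "nat \<Rightarrow> 'w set" where
  "bad_start r = (\<Union>h\<in>rep r ` T. exceedance (\<lambda>z. L h z - L h0 z) (start_dev r h))"

lemma bad_start: "bad_start r \<in> sets M" "measure M (bad_start r) \<le> 1 / 2 ^ r"
proof -
  note c = card_rep[of r]
  have single: "exceedance (\<lambda>z. L h z - L h0 z) (start_dev r h) \<in> sets M"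
    "measure M (exceedance (\<lambda>z. L h z - L h0 z) (start_dev r h)) \<le> exp (- (2 * entropy_const * 2 ^ r))"
    if "h \<in> rep r ` T" for h
  proof -
    have t: "h \<in> T" using that rep by auto
    have eq: "start_dev r h = 1 / (16 * a\<^sup>2) * L2_dist_sq h h0 + 2 * entropy_const * 2 ^ r / (real n * (1 / (16 * a\<^sup>2)))"
      by (simp add: start_dev_def)
    \<comment> \<open>The range is \<open>4 * a ^ 2\<close>, so this exponent is admissible. A
      confidence of 2 units against an entropy of 1 again leaves one unit.\<close>
    have "1 / (16 * a\<^sup>2) > 0" "1 / (16 * a\<^sup>2) * (4 * a\<^sup>2) \<le> 1" using a by auto
    note b = bernstein_dev[OF L_diff_measurable[OF t h0] L_bounded[OF t h0] eq_refl[OF L2_dist_sq_def[symmetric]] this, of "2 * entropy_const * 2 ^ r"]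
    show "exceedance (\<lambda>z. L h z - L h0 z) (start_dev r h) \<in> sets M"
      unfolding eq by (rule b(1))
    show "measure M (exceedance (\<lambda>z. L h z - L h0 z) (start_dev r h)) \<le> exp (- (2 * entropy_const * 2 ^ r))"
      unfolding eq by (rule b(2))
  qed
  show "bad_start r \<in> sets M" unfolding bad_start_def using c single(1) by (intro sets.finite_UN) auto
  have "measure M (bad_start r) \<le> (\<Sum>h\<in>rep r ` T. measure M (exceedance (\<lambda>z. L h z - L h0 z) (start_dev r h)))"
    unfolding bad_start_def using c single(1) by (intro M.finite_measure_subadditive_finite) auto
  also have "\<dots> \<le> (\<Sum>h\<in>rep r ` T. exp (- (2 * entropy_const * 2 ^ r)))" by (intro sum_mono single(2))
  also have "\<dots> = real (card (rep r ` T)) * exp (- (2 * entropy_const * 2 ^ r))" by simp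
  also have "\<dots> \<le> exp (entropy_const * 2 ^ r) * exp (- (2 * entropy_const * 2 ^ r))"
    using c by (intro mult_right_mono) auto
  also have "\<dots> = exp (- (entropy_const * 2 ^ r))" by (simp flip: exp_add)
  also have "\<dots> \<le> exp (- (2 ^ r))" using entropy_const_ge by simp
  also have "\<dots> \<le> 1 / 2 ^ r" by (rule exp_minus_power_le)
  finally show "measure M (bad_start r) \<le> 1 / 2 ^ r" .
qed

section \<open>Assembling the chain\<close>

lemma L2_dist_sq_rep_le:
  assumes t: "h \<in> T"
  shows "L2_dist_sq h (rep r h) \<le> 2 * ((link_sd r)\<^sup>2 + 16 * a ^ 4 * D\<^sup>2 / 2 ^ J)"
proof -
  have t': "rep r h \<in> T" using rep[OF t] by simp
  let ?S = "step_fun (\<lambda>i. \<bar>C h i - C (rep r h) i\<bar>)" and ?R = "remainder h (rep r h)"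
  note c = close_rep[OF t, of r]
  have iS: "integrable P (\<lambda>z. (?S z)\<^sup>2)" by (rule integrable_step_fun_sq[OF c])
  have iR: "integrable P (\<lambda>z. (?R z)\<^sup>2)"
  proof (rule bounded_integrable[where c = "(4 * a * D)\<^sup>2"])
    show "\<bar>(?R z)\<^sup>2\<bar> \<le> (4 * a * D)\<^sup>2" for z
      using remainder_nonneg[OF t t', of z] remainder_le[OF t t', of z] by (simp add: power_mono)
  qed measurable
  have "L2_dist_sq h (rep r h) \<le> (\<integral>z. 2 * a\<^sup>2 * (?S z)\<^sup>2 + 2 * a\<^sup>2 * (?R z)\<^sup>2 \<partial>P)"
    unfolding L2_dist_sq_def
  proof (rule integral_mono_AE')
    show "AE z in P. (L h z - L (rep r h) z)\<^sup>2 \<le> 2 * a\<^sup>2 * (?S z)\<^sup>2 + 2 * a\<^sup>2 * (?R z)\<^sup>2"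
    proof (rule AE_I2)
      fix z assume z: "z \<in> space P"
      have "\<bar>L h z - L (rep r h) z\<bar>\<^sup>2 \<le> (a * (?S z + ?R z))\<^sup>2"
        unfolding remainder_def by (rule power_mono[OF L_lipschitz[OF t t' z]]) simp
      also have "\<dots> = a\<^sup>2 * (?S z + ?R z)\<^sup>2" by (simp add: power_mult_distrib)
      also have "\<dots> \<le> a\<^sup>2 * (2 * (?S z)\<^sup>2 + 2 * (?R z)\<^sup>2)"
        using zero_le_power2[of "?S z - ?R z"] unfolding power2_eq_square
        by (intro mult_left_mono) (simp_all add: algebra_simps)
      finally show "(L h z - L (rep r h) z)\<^sup>2 \<le> 2 * a\<^sup>2 * (?S z)\<^sup>2 + 2 * a\<^sup>2 * (?R z)\<^sup>2"
        by (simp add: algebra_simps)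
    qed
  qed (use iS iR in auto)
  also have "\<dots> = 2 * a\<^sup>2 * (\<integral>z. (?S z)\<^sup>2 \<partial>P) + 2 * a\<^sup>2 * (\<integral>z. (?R z)\<^sup>2 \<partial>P)" using iS iR by simp
  also have "\<dots> \<le> 2 * a\<^sup>2 * (8 * a * chain_const * D / 2 ^ r)\<^sup>2 + 2 * a\<^sup>2 * ((4 * a * D)\<^sup>2 / 2 ^ J)"
    by (intro add_mono mult_left_mono close_at_L2[OF c a] integral_remainder_sq_le t t') auto
  also have "\<dots> = 2 * ((link_sd r)\<^sup>2 + 16 * a ^ 4 * D\<^sup>2 / 2 ^ J)"
    by (simp add: link_sd_def power2_eq_square power4_eq_xxxx field_simps)
  finally show ?thesis .
qed

text \<open>The variance in \<open>start_dev\<close> is that of a representative, while the excess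
  risk to be bounded is that of \<open>h\<close>. This inequality passes from one to the other at
  the cost of the discretisation error.\<close>

lemma L2_dist_sq_start_le:
  assumes t: "h \<in> T"
  shows "L2_dist_sq (rep r h) h0 \<le> 2 * L2_dist_sq h h0 + 2 * L2_dist_sq h (rep r h)"
proof -
  have t': "rep r h \<in> T" using rep[OF t] by simp
  have int: "integrable P (\<lambda>z. (L h1 z - L h2 z)\<^sup>2)" if "h1 \<in> T" "h2 \<in> T" for h1 h2
  proof (rule bounded_integrable[where c = "(4 * a\<^sup>2)\<^sup>2"])
    show "\<bar>(L h1 z - L h2 z)\<^sup>2\<bar> \<le> (4 * a\<^sup>2)\<^sup>2" if "z \<in> space P" for z
      using power_mono[OF L_bounded[OF \<open>h1 \<in> T\<close> \<open>h2 \<in> T\<close> that], of 2] by simp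
  qed (use L_diff_measurable[OF that] in measurable)
  have "L2_dist_sq (rep r h) h0 \<le> (\<integral>z. 2 * (L h z - L h0 z)\<^sup>2 + 2 * (L h z - L (rep r h) z)\<^sup>2 \<partial>P)"
    unfolding L2_dist_sq_def
  proof (rule integral_mono_AE')
    show "AE z in P. (L (rep r h) z - L h0 z)\<^sup>2 \<le> 2 * (L h z - L h0 z)\<^sup>2 + 2 * (L h z - L (rep r h) z)\<^sup>2"
    proof (rule AE_I2)
      fix z
      have "(x - y)\<^sup>2 \<le> 2 * x\<^sup>2 + 2 * y\<^sup>2" for x y :: real
        using zero_le_power2[of "x + y"] unfolding power2_eq_square by (simp add: algebra_simps)
      from this[of "L h z - L h0 z" "L h z - L (rep r h) z"]
      show "(L (rep r h) z - L h0 z)\<^sup>2 \<le> 2 * (L h z - L h0 z)\<^sup>2 + 2 * (L h z - L (rep r h) z)\<^sup>2" by simp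
    qed
  qed (use int t t' h0 in auto)
  also have "\<dots> = 2 * L2_dist_sq h h0 + 2 * L2_dist_sq h (rep r h)"
    unfolding L2_dist_sq_def using int t t' h0 by simp
  finally show ?thesis .
qed

text \<open>In this order: the variance caused by passing from \<open>h\<close> to its first
  representative, the confidence term of the first net, the links, the uniformly bounded last link
  from scale \<open>J\<close> to \<open>h\<close>, and the remainders of at most
  \<open>J + 1\<close> links.\<close>

definition chain_error :: "nat \<Rightarrow> real" where
  "chain_error r0 = ((link_sd r0)\<^sup>2 + 16 * a ^ 4 * D\<^sup>2 / 2 ^ J) / (4 * a\<^sup>2) + 32 * a\<^sup>2 * entropy_const * 2 ^ r0 / real n
     + (\<Sum>r\<in>{r0..<J}. link_dev r) + 2 * link_sd J + (real J + 1) * (4 * a\<^sup>2 * D * (1 / 2 ^ J + 1 / real n))"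

definition bad_event :: "nat \<Rightarrow> 'w set" where
  "bad_event r0 = crowded \<union> bad_start r0 \<union> (\<Union>r\<in>{r0..<J}. bad_link r)"

lemma bad_event: "bad_event r0 \<in> sets M" "measure M (bad_event r0) \<le> D * (real n)\<^sup>2 / 2 ^ J + 3 / 2 ^ r0"
proof -
  have UN: "(\<Union>r\<in>{r0..<J}. bad_link r) \<in> sets M" using bad_link(1) by auto
  show "bad_event r0 \<in> sets M" unfolding bad_event_def using UN bad_start(1) crowded_sets by auto
  have "measure M (\<Union>r\<in>{r0..<J}. bad_link r) \<le> (\<Sum>r\<in>{r0..<J}. measure M (bad_link r))"
    using bad_link(1) by (intro M.finite_measure_subadditive_finite) auto
  also have "\<dots> \<le> (\<Sum>r\<in>{r0..<J}. 1 / 2 ^ r)" by (intro sum_mono bad_link(2))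
  also have "\<dots> \<le> 2 / 2 ^ r0"
  proof -
    have "(\<Sum>r\<in>{r0..<r0 + k}. 1 / (2::real) ^ r) = 2 / 2 ^ r0 - 2 / 2 ^ (r0 + k)" for k
    proof (induction k)
      case (Suc k)
      have "(\<Sum>r\<in>{r0..<r0 + Suc k}. 1 / (2::real) ^ r) = 2 / 2 ^ r0 - 2 / 2 ^ (r0 + k) + 1 / 2 ^ (r0 + k)"
        using Suc.IH by simp
      moreover have "2 / 2 ^ (r0 + Suc k) = 1 / (2::real) ^ (r0 + k)" by simp
      moreover have "2 / 2 ^ (r0 + k) = 2 * (1 / (2::real) ^ (r0 + k))" by simp
      ultimately show ?case by linarith
    qed simp
    from this[of "J - r0"] show ?thesis by (cases "r0 \<le> J") auto
  qed
  finally have 3: "measure M (\<Union>r\<in>{r0..<J}. bad_link r) \<le> 2 / 2 ^ r0" .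
  have "measure M (bad_event r0) \<le> measure M (crowded \<union> bad_start r0) + measure M (\<Union>r\<in>{r0..<J}. bad_link r)"
    unfolding bad_event_def using UN bad_start(1) crowded_sets by (intro measure_Un_le) auto
  also have "measure M (crowded \<union> bad_start r0) \<le> measure M crowded + measure M (bad_start r0)"
    using bad_start(1) crowded_sets by (intro measure_Un_le) auto
  finally show "measure M (bad_event r0) \<le> D * (real n)\<^sup>2 / 2 ^ J + 3 / 2 ^ r0"
    using prob_crowded bad_start(2)[of r0] 3 by simp
qed

lemma dev_telescope:
  assumes t: "h \<in> T" and r: "r0 \<le> k"
  shows "dev \<omega> (\<lambda>z. L h z - L h0 z) = dev \<omega> (\<lambda>z. L h z - L (rep k h) z)
    + (\<Sum>r\<in>{r0..<k}. dev \<omega> (\<lambda>z. L (rep (Suc r) h) z - L (rep r h) z)) + dev \<omega> (\<lambda>z. L (rep r0 h) z - L h0 z)"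
  using r
proof (induction k rule: dec_induct)
  case base
  have "dev \<omega> (\<lambda>z. (L h z - L (rep r0 h) z) + (L (rep r0 h) z - L h0 z)) =
     dev \<omega> (\<lambda>z. L h z - L (rep r0 h) z) + dev \<omega> (\<lambda>z. L (rep r0 h) z - L h0 z)"
    using t rep h0 by (intro dev_add L_diff_integrable) auto
  then show ?case by simp
next
  case (step k)
  have "dev \<omega> (\<lambda>z. (L h z - L (rep (Suc k) h) z) + (L (rep (Suc k) h) z - L (rep k h) z)) =
     dev \<omega> (\<lambda>z. L h z - L (rep (Suc k) h) z) + dev \<omega> (\<lambda>z. L (rep (Suc k) h) z - L (rep k h) z)"
    using t rep by (intro dev_add L_diff_integrable) auto
  then show ?case using step by (simp add: sum.atLeastLessThan_Suc)
qed

lemma chaining_bound: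
  assumes \<omega>: "\<omega> \<in> space M" "\<omega> \<notin> bad_event r0" and t: "h \<in> T" and r0: "r0 \<le> J"
  shows "dev \<omega> (\<lambda>z. L h z - L h0 z) \<le> L2_dist_sq h h0 / (8 * a\<^sup>2) + chain_error r0"
proof -
  define \<eta> where "\<eta> = 4 * a\<^sup>2 * D * (1 / 2 ^ J + 1 / real n)"
  have nc: "\<omega> \<notin> crowded" and ns: "\<omega> \<notin> bad_start r0" and nl: "\<And>r. r \<in> {r0..<J} \<Longrightarrow> \<omega> \<notin> bad_link r"
    using \<omega>(2) by (auto simp: bad_event_def)
  have repT: "rep r h \<in> T" for r using rep[OF t] by simp
  have 1: "dev \<omega> (\<lambda>z. L h z - L (rep J h) z) \<le> 2 * link_sd J + \<eta>"
  proof -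
    let ?S = "step_fun (\<lambda>i. \<bar>C h i - C (rep J h) i\<bar>)"
    \<comment> \<open>The last link involves \<open>h\<close> itself and ranges over all of
      \<open>T\<close>, so no union bound applies. At scale \<open>J\<close> the uniform bound of
      \<open>close_at_sup\<close> has factor 1, and a deterministic estimate is small
      enough.\<close>
    have "dev \<omega> (clipped h (rep J h)) \<le> (\<integral>z. link_sd J \<partial>P) + emp \<omega> (\<lambda>z. link_sd J)"
    proof (rule dev_le_abs[OF \<omega>(1) clipped_measurable[OF t repT]])
      fix z
      have "\<bar>clipped h (rep J h) z\<bar> \<le> a * ?S z" by (rule clipped_le)
      also have "\<dots> \<le> a * (8 * a * chain_const * D / 2 ^ J * 2 powr ((real J - real J) / 16))"
        using a by (intro mult_left_mono close_at_sup[OF close_rep[OF t]]) auto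
      also have "\<dots> = link_sd J" by (simp add: link_sd_def power2_eq_square)
      finally show "\<bar>clipped h (rep J h) z\<bar> \<le> link_sd J" .
    qed simp
    then have "dev \<omega> (clipped h (rep J h)) \<le> 2 * link_sd J" by (simp add: emp_const P.prob_space)
    with dev_link[OF t repT \<omega>(1) nc, of J] show ?thesis by (simp add: \<eta>_def)
  qed
  have 2: "dev \<omega> (\<lambda>z. L (rep (Suc r) h) z - L (rep r h) z) \<le> link_dev r + \<eta>" if "r \<in> {r0..<J}" for r
  proof -
    have "\<not> dev \<omega> (clipped (rep (Suc r) h) (rep r h)) > link_dev r"
      using nl[OF that] \<omega>(1) t by (auto simp: bad_link_def)
    with dev_link[OF repT repT \<omega>(1) nc, of "Suc r" r] show ?thesis by (simp add: \<eta>_def)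
  qed
  have 3: "dev \<omega> (\<lambda>z. L (rep r0 h) z - L h0 z) \<le> start_dev r0 (rep r0 h)"
    using ns \<omega>(1) t by (force simp: bad_start_def)
  \<comment> \<open>\<open>L2_dist_sq_start_le\<close> doubles the weight \<open>1 / 16\<close> of
    the variance to \<open>1 / 8\<close>. The discretisation error receives a second factor 2 from
    \<open>L2_dist_sq_rep_le\<close>.\<close>
  have "start_dev r0 (rep r0 h) \<le> (2 * L2_dist_sq h h0 + 2 * (2 * ((link_sd r0)\<^sup>2 + 16 * a ^ 4 * D\<^sup>2 / 2 ^ J))) / (16 * a\<^sup>2)
     + 16 * a\<^sup>2 * (2 * entropy_const * 2 ^ r0) / real n"
    unfolding start_dev_def using L2_dist_sq_start_le[OF t, of r0] L2_dist_sq_rep_le[OF t, of r0]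
    by (intro add_right_mono divide_right_mono) auto
  also have "\<dots> = L2_dist_sq h h0 / (8 * a\<^sup>2) + ((link_sd r0)\<^sup>2 + 16 * a ^ 4 * D\<^sup>2 / 2 ^ J) / (4 * a\<^sup>2)
     + 32 * a\<^sup>2 * entropy_const * 2 ^ r0 / real n"
    using a by (simp add: add_divide_distrib)
  finally have 4: "start_dev r0 (rep r0 h) \<le> \<dots>" .
  have "(\<Sum>r\<in>{r0..<J}. dev \<omega> (\<lambda>z. L (rep (Suc r) h) z - L (rep r h) z)) \<le> (\<Sum>r\<in>{r0..<J}. link_dev r + \<eta>)"
    by (intro sum_mono 2)
  also have "\<dots> = (\<Sum>r\<in>{r0..<J}. link_dev r) + real (J - r0) * \<eta>" by (simp add: sum.distrib)
  also have "\<dots> \<le> (\<Sum>r\<in>{r0..<J}. link_dev r) + real J * \<eta>"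
    using D by (intro add_left_mono mult_right_mono) (auto simp: \<eta>_def)
  finally have 5: "(\<Sum>r\<in>{r0..<J}. dev \<omega> (\<lambda>z. L (rep (Suc r) h) z - L (rep r h) z)) \<le> (\<Sum>r\<in>{r0..<J}. link_dev r) + real J * \<eta>" .
  show ?thesis
    unfolding dev_telescope[OF t r0] chain_error_def \<eta>_def[symmetric] using 1 3 4 5 by (simp add: distrib_right)
qed

end

section \<open>Evaluation of the error at the balancing scale\<close>

definition rate_const :: real where
  "rate_const = 20200 * chain_const\<^sup>2 + 4500 * chain_const + 12"

lemma sum_powr_half_le: "(\<Sum>r\<in>{r0..<k}. 1 / sqrt (2 ^ r)) \<le> 4 / sqrt (2 ^ r0)"
proof -
  have s: "sqrt 2 \<ge> 4 / 3" by (rule real_le_rsqrt) (simp add: power2_eq_square)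
  have "(\<Sum>r\<in>{r0..<r0 + j}. 1 / sqrt (2 ^ r)) \<le> 4 / sqrt (2 ^ r0) - 4 / sqrt (2 ^ (r0 + j))" for j
  proof (induction j)
    case (Suc j)
    define y where "y = 1 / sqrt (2 ^ (r0 + j))"
    have y: "y > 0" by (simp add: y_def)
    have "4 / sqrt (2 ^ (r0 + Suc j)) = 4 / sqrt 2 * y" by (simp add: y_def real_sqrt_mult)
    also have "4 / sqrt 2 * y \<le> 3 * y" using s y by (intro mult_right_mono) (auto simp: field_simps)
    finally have "4 / sqrt (2 ^ (r0 + Suc j)) \<le> 3 * y" .
    moreover have "4 / sqrt (2 ^ (r0 + j)) = 4 * y" by (simp add: y_def)
    moreover have "(\<Sum>r\<in>{r0..<r0 + Suc j}. 1 / sqrt (2 ^ r)) = (\<Sum>r\<in>{r0..<r0 + j}. 1 / sqrt (2 ^ r)) + y"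
      by (simp add: y_def)
    ultimately show ?case using Suc.IH by linarith
  qed simp
  from this[of "k - r0"] show ?thesis
    by (cases "r0 \<le> k") (auto intro: order_trans)
qed

context chaining
begin

text \<open>Since \<open>q ^ 3 = n * D\<close>, the entropy term \<open>D * q / n\<close> equals
  \<open>(D / q) ^ 2\<close>, the squared error of the net at scale \<open>q\<close>; the links sum
  to a multiple of \<open>D * sqrt (D / n) / sqrt q\<close>, which is the same quantity. Condition
  \<open>E\<close> takes care of the range terms in Bernstein's inequality and of the accumulated
  remainders.\<close>

lemma chain_error_le:
  fixes q :: real
  assumes q: "q > 0" "q ^ 3 = real n * D" and r0: "q \<le> 2 ^ r0" "2 ^ r0 \<le> 2 * q"
    and J: "real n ^ 3 \<le> 2 ^ J" and Dn: "D \<le> real n"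
    and E: "(real J + 1) * 2 powr (real J / 16) * q\<^sup>2 \<le> real n"
  shows "chain_error r0 \<le> rate_const * (a * (D / q))\<^sup>2"
proof -
  define \<kappa> where "\<kappa> = chain_const"
  define \<delta> where "\<delta> = (D / q)\<^sup>2"
  have \<kappa>: "\<kappa> \<ge> 2" using chain_const_ge_2 by (simp add: \<kappa>_def)
  have n1: "real n \<ge> 1" using n by simp
  have \<delta>0: "\<delta> \<ge> 0" by (simp add: \<delta>_def)
  have "q ^ 3 \<le> real n ^ 3"
  proof -
    have "q ^ 3 \<le> real n * real n" unfolding q(2) using Dn n1 by (intro mult_left_mono) auto
    also have "\<dots> \<le> real n ^ 3" using power_increasing[of 2 3 "real n"] n1 by (simp add: power2_eq_square)
    finally show ?thesis .
  qed
  then have qn: "q \<le> real n" using q n1 power_mono_iff[of q "real n" 3] by auto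
  have "q\<^sup>2 \<le> real n ^ 2" using qn q by (intro power_mono) auto
  also have "\<dots> \<le> real n ^ 3" using n1 by (intro power_increasing) auto
  finally have q2J: "q\<^sup>2 \<le> 2 ^ J" using J by linarith
  have D2: "D \<le> D\<^sup>2" using D power_increasing[of 1 2 D] by simp
  \<comment> \<open>The common form of the lower-order terms: once \<open>D ^ 2\<close> is factored
    out, whatever is at most \<open>1 / q ^ 2\<close> fits into \<open>\<delta>\<close>.\<close>
  have inv: "D\<^sup>2 * x \<le> \<delta>" if "x * q\<^sup>2 \<le> 1" for x
  proof -
    have "x \<le> 1 / q\<^sup>2" using that q by (simp add: field_simps)
    then have "D\<^sup>2 * x \<le> D\<^sup>2 * (1 / q\<^sup>2)" by (intro mult_left_mono) auto
    then show ?thesis by (simp add: \<delta>_def power_divide)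
  qed
  have DJ: "D\<^sup>2 / 2 ^ J \<le> \<delta>" using inv[of "1 / 2 ^ J"] q2J by simp
  have Dq: "D * q / real n = \<delta>"
  proof -
    have "D * q / real n = D\<^sup>2 * q / (real n * D)" using D by (simp add: power2_eq_square)
    also have "\<dots> = D\<^sup>2 * q / q ^ 3" by (simp add: q)
    also have "\<dots> = \<delta>" using q(1) by (simp add: \<delta>_def power2_eq_square power3_eq_cube)
    finally show ?thesis .
  qed
  have pw: "2 powr (real J / 16) \<ge> 1" by (intro ge_one_powr_ge_zero) auto
  have E': "(real J + 1) * 2 powr (real J / 16) / real n * q\<^sup>2 \<le> 1" using E n1 by (simp add: field_simps)
  have 1: "(link_sd r0)\<^sup>2 / (4 * a\<^sup>2) \<le> 16 * \<kappa>\<^sup>2 * (a\<^sup>2 * \<delta>)"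
  proof -
    have "link_sd r0 \<le> 8 * a\<^sup>2 * \<kappa> * D / q"
      unfolding link_sd_def \<kappa>_def[symmetric] using r0 q \<kappa> D a by (intro divide_left_mono mult_nonneg_nonneg) auto
    then have "(link_sd r0)\<^sup>2 \<le> (8 * a\<^sup>2 * \<kappa> * D / q)\<^sup>2"
      using link_pos[of r0] by (intro power_mono) auto
    also have "\<dots> = 64 * \<kappa>\<^sup>2 * (a\<^sup>2 * a\<^sup>2 * \<delta>)" by (simp add: \<delta>_def power_divide power_mult_distrib)
    finally show ?thesis using a by (simp add: field_simps)
  qed
  have 2: "16 * a ^ 4 * D\<^sup>2 / 2 ^ J / (4 * a\<^sup>2) \<le> 4 * (a\<^sup>2 * \<delta>)"
  proof -
    have "16 * a ^ 4 * D\<^sup>2 / 2 ^ J / (4 * a\<^sup>2) = 4 * (a\<^sup>2 * (D\<^sup>2 / 2 ^ J))" using a by (simp add: power4_eq_xxxx power2_eq_square)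
    also have "\<dots> \<le> 4 * (a\<^sup>2 * \<delta>)" using DJ by (intro mult_left_mono) auto
    finally show ?thesis .
  qed
  have 3: "32 * a\<^sup>2 * entropy_const * 2 ^ r0 / real n \<le> 4480 * \<kappa> * (a\<^sup>2 * \<delta>)"
  proof -
    have "32 * a\<^sup>2 * entropy_const * 2 ^ r0 / real n \<le> 32 * a\<^sup>2 * entropy_const * (2 * q) / real n"
      using r0 entropy_const_ge by (intro divide_right_mono mult_left_mono) auto
    also have "\<dots> = 4480 * \<kappa> * (a\<^sup>2 * (D * q / real n))" by (simp add: entropy_const_def \<kappa>_def)
    finally show ?thesis by (simp add: Dq)
  qed
  have 4: "4 * entropy_const * 2 ^ r * link_sup r / real n \<le> 2240 * \<kappa>\<^sup>2 * a\<^sup>2 * D\<^sup>2 * (2 powr (real J / 16) / real n)" for r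
  proof -
    have "4 * entropy_const * 2 ^ r * link_sup r / real n = 2240 * \<kappa>\<^sup>2 * a\<^sup>2 * D\<^sup>2 * (2 powr ((real J - real r) / 16) / real n)"
      by (simp add: entropy_const_def \<kappa>_def link_sup_def link_sd_def power2_eq_square)
    also have "\<dots> \<le> 2240 * \<kappa>\<^sup>2 * a\<^sup>2 * D\<^sup>2 * (2 powr (real J / 16) / real n)"
      by (intro mult_left_mono divide_right_mono powr_mono) auto
    finally show ?thesis .
  qed
  have 5: "2 * link_sd r * sqrt (4 * entropy_const * 2 ^ r / real n) \<le> 4480 * \<kappa>\<^sup>2 * a\<^sup>2 * (D * sqrt (D / real n)) * (1 / sqrt (2 ^ r))" for r
  proof -
    have "sqrt (4 * entropy_const * 2 ^ r / real n) = sqrt (280 * \<kappa>) * sqrt (D / real n) * sqrt (2 ^ r)"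
      by (simp add: entropy_const_def \<kappa>_def real_sqrt_mult real_sqrt_divide)
    also have "sqrt (280 * \<kappa>) \<le> 280 * \<kappa>"
      using \<kappa> by (intro real_le_lsqrt) (auto simp: power2_eq_square)
    finally have "sqrt (4 * entropy_const * 2 ^ r / real n) \<le> 280 * \<kappa> * sqrt (D / real n) * sqrt (2 ^ r)"
      using D by (simp add: mult_right_mono)
    then have "2 * link_sd r * sqrt (4 * entropy_const * 2 ^ r / real n) \<le> 2 * link_sd r * (280 * \<kappa> * sqrt (D / real n) * sqrt (2 ^ r))"
      using link_pos[of r] by (intro mult_left_mono) auto
    also have "\<dots> = 4480 * \<kappa>\<^sup>2 * a\<^sup>2 * (D * sqrt (D / real n)) * (sqrt (2 ^ r) / 2 ^ r)"
      by (simp add: link_sd_def \<kappa>_def power2_eq_square)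
    also have "sqrt (2 ^ r) / (2 :: real) ^ r = 1 / sqrt (2 ^ r)"
      using real_div_sqrt[of "2 ^ r"] by (simp add: field_simps)
    finally show ?thesis .
  qed
  have 6: "(\<Sum>r\<in>{r0..<J}. link_dev r) \<le> 2240 * \<kappa>\<^sup>2 * (a\<^sup>2 * \<delta>) + 17920 * \<kappa>\<^sup>2 * (a\<^sup>2 * \<delta>)"
  proof -
    have "(\<Sum>r\<in>{r0..<J}. link_dev r) \<le> (\<Sum>r\<in>{r0..<J}. 2240 * \<kappa>\<^sup>2 * a\<^sup>2 * D\<^sup>2 * (2 powr (real J / 16) / real n))
       + (\<Sum>r\<in>{r0..<J}. 4480 * \<kappa>\<^sup>2 * a\<^sup>2 * (D * sqrt (D / real n)) * (1 / sqrt (2 ^ r)))"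
      unfolding link_dev_def sum.distrib[symmetric] by (intro sum_mono add_mono 4 5)
    also have "(\<Sum>r\<in>{r0..<J}. 2240 * \<kappa>\<^sup>2 * a\<^sup>2 * D\<^sup>2 * (2 powr (real J / 16) / real n)) \<le> 2240 * \<kappa>\<^sup>2 * (a\<^sup>2 * \<delta>)"
    proof -
      have "(\<Sum>r\<in>{r0..<J}. 2240 * \<kappa>\<^sup>2 * a\<^sup>2 * D\<^sup>2 * (2 powr (real J / 16) / real n))
        = 2240 * \<kappa>\<^sup>2 * (a\<^sup>2 * (D\<^sup>2 * (real (J - r0) * 2 powr (real J / 16) / real n)))" by simp
      also have "D\<^sup>2 * (real (J - r0) * 2 powr (real J / 16) / real n) \<le> \<delta>"
      proof (rule inv)
        have "real (J - r0) * 2 powr (real J / 16) / real n * q\<^sup>2 \<le> (real J + 1) * 2 powr (real J / 16) / real n * q\<^sup>2"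
          by (intro mult_right_mono divide_right_mono) auto
        then show "real (J - r0) * 2 powr (real J / 16) / real n * q\<^sup>2 \<le> 1" using E' by linarith
      qed
      finally show ?thesis by (simp add: mult_left_mono)
    qed
    also have "(\<Sum>r\<in>{r0..<J}. 4480 * \<kappa>\<^sup>2 * a\<^sup>2 * (D * sqrt (D / real n)) * (1 / sqrt (2 ^ r))) \<le> 17920 * \<kappa>\<^sup>2 * (a\<^sup>2 * \<delta>)"
    proof -
      have "(\<Sum>r\<in>{r0..<J}. 4480 * \<kappa>\<^sup>2 * a\<^sup>2 * (D * sqrt (D / real n)) * (1 / sqrt (2 ^ r))) =
         4480 * \<kappa>\<^sup>2 * a\<^sup>2 * (D * sqrt (D / real n)) * (\<Sum>r\<in>{r0..<J}. 1 / sqrt (2 ^ r))" by (simp only: sum_distrib_left)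
      also have "\<dots> \<le> 4480 * \<kappa>\<^sup>2 * a\<^sup>2 * (D * sqrt (D / real n)) * (4 / sqrt q)"
      proof (intro mult_left_mono order_trans[OF sum_powr_half_le])
        show "4 / sqrt (2 ^ r0) \<le> 4 / sqrt q" using r0 q by (intro divide_left_mono) auto
      qed (use D in auto)
      also have "\<dots> = 17920 * \<kappa>\<^sup>2 * (a\<^sup>2 * (D * (sqrt (D / real n) / sqrt q)))" by simp
      also have "sqrt (D / real n) / sqrt q = D / q\<^sup>2"
      proof -
        have "D / real n / q = (D / q\<^sup>2)\<^sup>2"
        proof -
          have "D / real n / q = D\<^sup>2 / ((real n * D) * q)" using D by (simp add: power2_eq_square)
          also have "\<dots> = D\<^sup>2 / (q ^ 3 * q)" by (simp add: q)
          also have "\<dots> = (D / q\<^sup>2)\<^sup>2" by (simp add: power_divide power2_eq_square power3_eq_cube mult.assoc)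
          finally show ?thesis .
        qed
        then have "sqrt (D / real n / q) = D / q\<^sup>2" using D by simp
        then show ?thesis by (simp add: real_sqrt_divide real_sqrt_mult)
      qed
      also have "D * (D / q\<^sup>2) = \<delta>" by (simp add: \<delta>_def power_divide power2_eq_square)
      finally show ?thesis .
    qed
    finally show ?thesis by simp
  qed
  have 7: "2 * link_sd J \<le> 16 * \<kappa> * (a\<^sup>2 * \<delta>)"
  proof -
    have "2 * link_sd J = 16 * \<kappa> * (a\<^sup>2 * (D / 2 ^ J))" by (simp add: link_sd_def \<kappa>_def)
    also have "D / 2 ^ J \<le> D\<^sup>2 / 2 ^ J" using D2 by (intro divide_right_mono) auto
    also note DJ
    finally show ?thesis using \<kappa> by (simp add: mult_left_mono)
  qed
  have 8: "(real J + 1) * (4 * a\<^sup>2 * D * (1 / 2 ^ J + 1 / real n)) \<le> 8 * (a\<^sup>2 * \<delta>)"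
  proof -
    have "1 / 2 ^ J \<le> 1 / real n"
    proof -
      have "real n \<le> real n ^ 3" using power_increasing[of 1 3 "real n"] n1 by simp
      then have "real n \<le> 2 ^ J" using J by linarith
      then show ?thesis using n1 by (intro divide_left_mono) auto
    qed
    then have "(real J + 1) * (4 * a\<^sup>2 * D * (1 / 2 ^ J + 1 / real n)) \<le> (real J + 1) * (4 * a\<^sup>2 * D * (1 / real n + 1 / real n))"
      using D by (intro mult_left_mono add_right_mono) auto
    also have "\<dots> = 8 * (a\<^sup>2 * (D * ((real J + 1) / real n)))" by simp
    also have "D * ((real J + 1) / real n) \<le> D\<^sup>2 * ((real J + 1) * 2 powr (real J / 16) / real n)"
      using D2 pw D by (intro mult_mono divide_right_mono) (auto simp: mult_le_cancel_left1)
    also have "\<dots> \<le> \<delta>" by (rule inv[OF E'])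
    finally show ?thesis by (simp add: mult_left_mono)
  qed
  have "chain_error r0 \<le> 16 * \<kappa>\<^sup>2 * (a\<^sup>2 * \<delta>) + 4 * (a\<^sup>2 * \<delta>) + 4480 * \<kappa> * (a\<^sup>2 * \<delta>)
     + (2240 * \<kappa>\<^sup>2 * (a\<^sup>2 * \<delta>) + 17920 * \<kappa>\<^sup>2 * (a\<^sup>2 * \<delta>)) + 16 * \<kappa> * (a\<^sup>2 * \<delta>) + 8 * (a\<^sup>2 * \<delta>)"
    unfolding chain_error_def add_divide_distrib using 1 2 3 6 7 8 by linarith
  \<comment> \<open>These coefficients, the first two rounded up, are the origin of
    \<open>rate_const\<close>.\<close>
  also have "\<dots> = (20176 * \<kappa>\<^sup>2 + 4496 * \<kappa> + 12) * (a\<^sup>2 * \<delta>)" by (simp add: algebra_simps)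
  also have "\<dots> \<le> rate_const * (a\<^sup>2 * \<delta>)"
    using \<kappa> \<delta>0 unfolding rate_const_def \<kappa>_def[symmetric] by (intro mult_right_mono) auto
  also have "a\<^sup>2 * \<delta> = (a * (D / q))\<^sup>2" by (simp only: \<delta>_def power_mult_distrib)
  finally show ?thesis .
qed

end

section \<open>The rate of convergence\<close>

lemma abs_charge_le:
  assumes "bounded_charge \<mu> A" "S \<in> sets borel" shows "\<bar>\<mu> S\<bar> \<le> A"
  using bounded_charge_sum_le[OF assms(1), of "{S}" "\<lambda>x. x"] assms(2) by (simp add: disjoint_family_on_def)

definition excess_deviation ::
    "'o measure \<Rightarrow> (nat \<Rightarrow> 'o) \<Rightarrow> nat \<Rightarrow> ('t \<Rightarrow> 'o \<Rightarrow> real) \<Rightarrow> 't \<Rightarrow> 't \<Rightarrow> real" where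
  "excess_deviation P z n L \<theta> \<theta>' =
     (risk P L \<theta> - risk P L \<theta>') - (empirical_risk z n L \<theta> - empirical_risk z n L \<theta>')"

text \<open>Collects all the probability at one sample size. The tree is built from the law of the
  covariate alone, since the functions to be approximated depend on \<open>x\<close> only, and its
  cells are pulled back along \<open>fst\<close> to the space of observations.\<close>

lemma finite_sample_bound:
  fixes P0 :: "((real ^ 'd::finite) \<times> real) measure" and M :: "'w measure"
    and L :: "(real ^ 'd \<Rightarrow> real) \<Rightarrow> (real ^ 'd) \<times> real \<Rightarrow> real" and T :: "(real ^ 'd \<Rightarrow> real) set"
    and q :: real and J r0 n :: nat
  defines "D \<equiv> (real J + 1) ^ (CARD('d) - 1)"
  assumes obs_space: "\<O> \<subseteq> cbox 0 1 \<times> \<Y>"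
    and P0: "prob_space P0" "sets P0 = sets (restrict_space borel \<O>)"
    and M: "prob_space M" and indep: "prob_space.indep_vars M (\<lambda>_. P0) obs {1..}"
    and ident: "\<And>i. i \<ge> 1 \<Longrightarrow> distr M P0 (obs i) = P0"
    and n: "n \<ge> 1" and a: "a > 0"
    and int: "\<And>\<theta>. \<theta> \<in> T \<Longrightarrow> integrable P0 (L \<theta>)"
    and var: "\<And>\<theta>. \<theta> \<in> T \<Longrightarrow> sectional_variation_norm \<theta> \<le> ennreal a"
    and Lt: "\<And>\<theta> x y. \<theta> \<in> T \<Longrightarrow> x \<in> cbox 0 1 \<Longrightarrow> y \<in> \<Y> \<Longrightarrow> L \<theta> (x, y) = Lt (\<theta> x) y"
    and lip: "\<And>y. y \<in> \<Y> \<Longrightarrow> a-lipschitz_on UNIV (\<lambda>u. Lt u y)"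
    and \<theta>1: "\<theta>1 \<in> T" and r0J: "r0 \<le> J"
    and q: "q > 0" "q ^ 3 = real n * D" and r0: "q \<le> 2 ^ r0" "2 ^ r0 \<le> 2 * q"
    and J: "real n ^ 3 \<le> 2 ^ J" and Dn: "D \<le> real n"
    and E: "(real J + 1) * 2 powr (real J / 16) * q\<^sup>2 \<le> real n"
  shows "\<exists>B\<in>sets M. measure M B \<le> D * (real n)\<^sup>2 / 2 ^ J + 3 / 2 ^ r0 \<and>
    (\<forall>\<omega>\<in>space M - B. \<forall>\<theta>\<in>T.
       excess_deviation P0 (\<lambda>i. obs i \<omega>) n L \<theta> \<theta>1
        \<le> (norm_L2 P0 (\<lambda>z. L \<theta> z - L \<theta>1 z))\<^sup>2 / (8 * a\<^sup>2) + rate_const * (a * (D / q))\<^sup>2)"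
proof -
  interpret P: prob_space P0 by fact
  interpret M: prob_space M by fact
  have spP: "space P0 = \<O>"
    using sets_eq_imp_space_eq[OF P0(2)] by (simp add: space_restrict_space)
  have fst: "fst \<in> measurable P0 borel"
  proof -
    have "fst \<in> measurable (restrict_space borel \<O>) (borel :: (real ^ 'd) measure)"
      by (intro measurable_restrict_space1 borel_measurable_continuous_onI continuous_intros)
    then show ?thesis using measurable_cong_sets[OF P0(2) refl] by blast
  qed
  define Q where "Q = distr P0 borel fst"
  have Q: "prob_space Q" "sets Q = sets borel"
    by (auto simp: Q_def intro: P.prob_space_distr fst)
  obtain ks :: "'d list" where ks: "set ks = UNIV" "distinct ks"
    using finite_distinct_list[of "UNIV :: 'd set"] by auto
  have len: "length ks = CARD('d)" using distinct_card[OF ks(2)] ks(1) by simp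
  obtain R B where tree: "orthant_tree Q ks UNIV J R B"
    using orthant_tree_exists[OF prob_space.finite_measure[OF Q(1)] Q(2), of UNIV ks J] by auto
  note tD = orthant_tree.tree[OF tree]
  define I where "I = tree_index (length ks) J"
  define R' where "R' = (\<lambda>p. {z \<in> space P0. fst z \<in> R p})"
  have R'_eq: "R' p = fst -` R p \<inter> space P0" for p by (auto simp: R'_def)
  have massQ: "measure P0 (R' p) = measure Q (R p)" for p
    unfolding R'_eq Q_def using tD(1)[of p] by (subst measure_distr[OF fst]) auto
  have Q1: "measure Q UNIV = 1"
    using prob_space.prob_space[OF Q(1)] sets_eq_imp_space_eq[OF Q(2)] by simp
  have dpos: "length ks > 0" using len by simp
  have D1: "D \<ge> 1" unfolding D_def by (intro one_le_power) simp
  have cells: "cell_system P0 I (map length) sum_list R' J D"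
  proof (unfold_locales)
    show "finite I" unfolding I_def by (rule finite_tree_index)
    show "R' p \<in> sets P0" for p unfolding R'_eq by (rule measurable_sets[OF fst tD(1)])
    show "measure P0 (R' p) \<le> 1 / 2 ^ depth p" if "p \<in> I" for p
      using tD(4)[of p] that unfolding massQ I_def Q1 by simp
    show "R' p \<inter> R' p' = {}" if "p \<in> I" "p' \<in> I" "p \<noteq> p'" "map length p = map length p'" for p p'
      using tD(5)[of p p'] that unfolding R'_def I_def by auto
    show "card {p \<in> I. map length p = l} \<le> 2 ^ sum_list l" for l
    proof -
      have "card {p \<in> I. map length p = l} \<le> card {p :: bool list list. map length p = l}"
        using card_bool_lists_shape[of l] by (intro card_mono) auto
      then show ?thesis using card_bool_lists_shape[of l] by simp
    qed
    show "sum_list l \<le> J" if "l \<in> map length ` I" for l using that by (auto simp: I_def tree_index_def)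
    show "real (card {l \<in> map length ` I. sum_list l = m}) \<le> D" for m
    proof (cases "m \<le> J")
      case True
      have "card {l \<in> map length ` I. sum_list l = m} \<le> card {l :: nat list. length l = length ks \<and> sum_list l = m}"
        using card_fixed_sum_lists_le(1)[OF dpos] by (intro card_mono) (auto simp: I_def tree_index_def)
      also have "\<dots> \<le> (m + 1) ^ (length ks - 1)" by (rule card_fixed_sum_lists_le(2)[OF dpos])
      also have "\<dots> \<le> (J + 1) ^ (length ks - 1)" using True by (intro power_mono) auto
      finally have "real (card {l \<in> map length ` I. sum_list l = m}) \<le> real ((J + 1) ^ (length ks - 1))"
        by (simp only: of_nat_le_iff)
      then show ?thesis by (simp add: D_def len add.commute)
    next
      case False
      then have "{l \<in> map length ` I. sum_list l = m} = {}" by (auto simp: I_def tree_index_def)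
      from arg_cong[OF this, of card] show ?thesis using D1 by (simp only: card.empty)
    qed
  qed
  interpret cell_system P0 I "map length" sum_list R' J D by (rule cells)
  define expands where "expands \<theta> C W \<longleftrightarrow>
     (\<forall>l. (\<Sum>p | p \<in> I \<and> map length p = l. \<bar>C p\<bar>) \<le> 2 * a) \<and> (\<forall>p. W p \<ge> 0) \<and>
     (\<forall>l. (\<Sum>p | p \<in> I \<and> map length p = l. W p) \<le> 2 * a) \<and>
     (\<forall>x\<in>cbox 0 1. \<bar>\<theta> x - (\<Sum>p | p \<in> I \<and> depth p < J. C p * indicator (R p) x)\<bar>
        \<le> (\<Sum>p | p \<in> I \<and> depth p = J. W p * indicator (R p) x))"
    for \<theta> :: "real ^ 'd \<Rightarrow> real" and C W :: "bool list list \<Rightarrow> real"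
  have ex: "(\<exists>C W. expands \<theta> C W) \<and> (\<forall>x\<in>cbox 0 1. \<bar>\<theta> x\<bar> \<le> 2 * a)" if \<theta>: "\<theta> \<in> T" for \<theta>
  proof -
    obtain \<mu> where \<mu>: "bounded_charge \<mu> (2 * a)" "\<And>x. x \<in> cbox 0 1 \<Longrightarrow> \<theta> x = \<mu> {c \<in> cbox 0 1. \<forall>j. c $ j \<le> x $ j}"
      using sectional_variation_charge[OF var[OF \<theta>] a] by blast
    have "\<bar>\<theta> x\<bar> \<le> 2 * a" if "x \<in> cbox 0 1" for x
    proof -
      have "{c \<in> cbox 0 1. \<forall>j. c $ j \<le> x $ j} = cbox 0 1 \<inter> cbox 0 x" by (auto simp: mem_box_cart)
      then show ?thesis unfolding \<mu>(2)[OF that] by (intro abs_charge_le[OF \<mu>(1)]) simp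
    qed
    then show ?thesis
      using orthant_tree_expansion[OF tree ks(1) \<mu>] unfolding expands_def I_def by blast
  qed
  obtain C where "\<And>\<theta>. \<theta> \<in> T \<Longrightarrow> \<exists>W. expands \<theta> (C \<theta>) W" using ex by metis
  then obtain W where CW: "\<And>\<theta>. \<theta> \<in> T \<Longrightarrow> expands \<theta> (C \<theta>) (W \<theta>)" by metis
  have CW: "(\<Sum>p | p \<in> I \<and> map length p = l. \<bar>C \<theta> p\<bar>) \<le> 2 * a" "W \<theta> p \<ge> 0"
    "(\<Sum>p | p \<in> I \<and> map length p = l. W \<theta> p) \<le> 2 * a"
    "x \<in> cbox 0 1 \<Longrightarrow> \<bar>\<theta> x - (\<Sum>p | p \<in> I \<and> depth p < J. C \<theta> p * indicator (R p) x)\<bar>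
        \<le> (\<Sum>p | p \<in> I \<and> depth p = J. W \<theta> p * indicator (R p) x)"
    "x \<in> cbox 0 1 \<Longrightarrow> \<bar>\<theta> x\<bar> \<le> 2 * a" if "\<theta> \<in> T" for \<theta> l p x
    using CW[OF that] ex[OF that] unfolding expands_def by blast+
  \<comment> \<open>A cell of depth \<open>J\<close> has no coefficient valid for all
    \<open>x\<close>; its whole contribution is charged to \<open>W'\<close>.\<close>
  define C' where "C' = (\<lambda>\<theta> p. if depth p < J then C \<theta> p else 0)"
  define W' where "W' = (\<lambda>\<theta> p. if depth p = J then W \<theta> p else 0)"
  have finI: "finite I" by (rule finite_I)
  have L_lip: "\<bar>L \<theta> z - L \<theta>' z\<bar> \<le> a * \<bar>\<theta> (fst z) - \<theta>' (fst z)\<bar>" and fstz: "fst z \<in> cbox 0 1"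
    if "\<theta> \<in> T" "\<theta>' \<in> T" "z \<in> space P0" for \<theta> \<theta>' z
  proof -
    have "z \<in> cbox 0 1 \<times> \<Y>" using that(3) obs_space unfolding spP by blast
    then obtain x y where z: "z = (x, y)" "x \<in> cbox 0 1" "y \<in> \<Y>" by blast
    show "\<bar>L \<theta> z - L \<theta>' z\<bar> \<le> a * \<bar>\<theta> (fst z) - \<theta>' (fst z)\<bar>" "fst z \<in> cbox 0 1"
      using lipschitz_onD[OF lip[OF z(3)], of "\<theta> x" "\<theta>' x"] that z by (auto simp: Lt dist_real_def)
  qed
  have chain: "chaining P0 I (map length) sum_list R' J D M obs n T L C' W' a \<theta>1"
  proof (unfold_locales)
    show "L \<theta> \<in> borel_measurable P0" if "\<theta> \<in> T" for \<theta> using int[OF that] by auto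
    show "(\<Sum>p | p \<in> I \<and> map length p = l. \<bar>C' \<theta> p\<bar>) \<le> 2 * a" if "\<theta> \<in> T" for \<theta> l
      by (rule order_trans[OF sum_mono CW(1)[OF that, of l]]) (auto simp: C'_def)
    show "0 \<le> W' \<theta> p" if "\<theta> \<in> T" for \<theta> p using CW(2)[OF that] by (auto simp: W'_def)
    show "(\<Sum>p | p \<in> I \<and> map length p = l. W' \<theta> p) \<le> 2 * a" if "\<theta> \<in> T" for \<theta> l
      by (rule order_trans[OF sum_mono CW(3)[OF that, of l]]) (use CW(2)[OF that] in \<open>auto simp: W'_def\<close>)
    show "W' \<theta> p = 0" if "depth p \<noteq> J" for \<theta> p using that by (simp add: W'_def)
    show "\<bar>L \<theta> z - L \<theta>' z\<bar> \<le> 4 * a\<^sup>2" if "\<theta> \<in> T" "\<theta>' \<in> T" "z \<in> space P0" for \<theta> \<theta>' z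
    proof -
      have "\<bar>\<theta> (fst z) - \<theta>' (fst z)\<bar> \<le> 4 * a"
        using CW(5)[OF that(1) fstz[OF that]] CW(5)[OF that(2) fstz[OF that]] by linarith
      then have "a * \<bar>\<theta> (fst z) - \<theta>' (fst z)\<bar> \<le> a * (4 * a)" using a by (intro mult_left_mono) auto
      then show ?thesis using L_lip[OF that] by (simp add: power2_eq_square)
    qed
    show "\<bar>L \<theta> z - L \<theta>' z\<bar> \<le> a * (step_fun (\<lambda>p. \<bar>C' \<theta> p - C' \<theta>' p\<bar>) z + step_fun (\<lambda>p. W' \<theta> p + W' \<theta>' p) z)"
      if "\<theta> \<in> T" "\<theta>' \<in> T" "z \<in> space P0" for \<theta> \<theta>' z
    proof -
      let ?x = "fst z"
      have ind: "indicator (R' p) z = (indicator (R p) ?x :: real)" for p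
        using that(3) by (simp add: R'_def indicator_def)
      have sC: "step_fun (C' \<theta>) z = (\<Sum>p | p \<in> I \<and> depth p < J. C \<theta> p * indicator (R p) ?x)" for \<theta>
        unfolding step_fun_def ind using finI by (intro sum.mono_neutral_cong_right) (auto simp: C'_def)
      have sW: "step_fun (W' \<theta>) z = (\<Sum>p | p \<in> I \<and> depth p = J. W \<theta> p * indicator (R p) ?x)" for \<theta>
        unfolding step_fun_def ind using finI by (intro sum.mono_neutral_cong_right) (auto simp: W'_def)
      have "\<bar>\<theta> ?x - step_fun (C' \<theta>) z\<bar> \<le> step_fun (W' \<theta>) z" "\<bar>\<theta>' ?x - step_fun (C' \<theta>') z\<bar> \<le> step_fun (W' \<theta>') z"
        unfolding sC sW using CW(4) fstz[OF that] that by auto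
      moreover have "\<bar>step_fun (C' \<theta>) z - step_fun (C' \<theta>') z\<bar> \<le> step_fun (\<lambda>p. \<bar>C' \<theta> p - C' \<theta>' p\<bar>) z"
      proof -
        have "step_fun (C' \<theta>) z - step_fun (C' \<theta>') z = (\<Sum>p\<in>I. (C' \<theta> p - C' \<theta>' p) * indicator (R' p) z)"
          by (simp add: step_fun_def sum_subtractf left_diff_distrib)
        also have "\<bar>\<dots>\<bar> \<le> (\<Sum>p\<in>I. \<bar>(C' \<theta> p - C' \<theta>' p) * indicator (R' p) z\<bar>)" by (rule sum_abs)
        finally show ?thesis by (simp add: step_fun_def abs_mult)
      qed
      moreover have "step_fun (\<lambda>p. W' \<theta> p + W' \<theta>' p) z = step_fun (W' \<theta>) z + step_fun (W' \<theta>') z"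
        by (simp add: step_fun_def distrib_right sum.distrib)
      ultimately have "\<bar>\<theta> ?x - \<theta>' ?x\<bar> \<le> step_fun (\<lambda>p. \<bar>C' \<theta> p - C' \<theta>' p\<bar>) z + step_fun (\<lambda>p. W' \<theta> p + W' \<theta>' p) z"
        by linarith
      then have "a * \<bar>\<theta> ?x - \<theta>' ?x\<bar> \<le> a * (step_fun (\<lambda>p. \<bar>C' \<theta> p - C' \<theta>' p\<bar>) z + step_fun (\<lambda>p. W' \<theta> p + W' \<theta>' p) z)"
        using a by (intro mult_left_mono) auto
      with L_lip[OF that] show ?thesis by linarith
    qed
  qed (use indep ident n a D1 \<theta>1 in auto)
  interpret chaining P0 I "map length" sum_list R' J D M obs n T L C' W' a \<theta>1 by (rule chain)
  show ?thesis
  proof (intro bexI[OF _ bad_event(1)[of r0]] conjI bad_event(2) ballI)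
    fix \<omega> \<theta> assume \<omega>: "\<omega> \<in> space M - bad_event r0" and \<theta>: "\<theta> \<in> T"
    have 1: "dev \<omega> (\<lambda>z. L \<theta> z - L \<theta>1 z) = excess_deviation P0 (\<lambda>i. obs i \<omega>) n L \<theta> \<theta>1"
      using int \<theta> \<theta>1 by (simp add: excess_deviation_def dev_def emp_def risk_def empirical_risk_def sum_subtractf diff_divide_distrib)
    have 2: "(norm_L2 P0 (\<lambda>z. L \<theta> z - L \<theta>1 z))\<^sup>2 = L2_dist_sq \<theta> \<theta>1"
      by (simp add: norm_L2_def L2_dist_sq_def)
    have 3: "dev \<omega> (\<lambda>z. L \<theta> z - L \<theta>1 z) \<le> L2_dist_sq \<theta> \<theta>1 / (8 * a\<^sup>2) + chain_error r0"
      using chaining_bound[of \<omega> r0 \<theta>] \<omega> \<theta> r0J by simp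
    have 4: "chain_error r0 \<le> rate_const * (a * (D / q))\<^sup>2"
      by (rule chain_error_le[OF q r0 J Dn E])
    show "excess_deviation P0 (\<lambda>i. obs i \<omega>) n L \<theta> \<theta>1
        \<le> (norm_L2 P0 (\<lambda>z. L \<theta> z - L \<theta>1 z))\<^sup>2 / (8 * a\<^sup>2) + rate_const * (a * (D / q))\<^sup>2"
      unfolding 2 using 1 3 4 by linarith
  qed
qed

section \<open>Depth and scale as functions of the sample size\<close>

lemma power_of_two_between:
  fixes q :: real assumes "q \<ge> 1"
  obtains r :: nat where "q \<le> 2 ^ r" "2 ^ r \<le> 2 * q"
proof -
  have ex: "\<exists>r::nat. q \<le> 2 ^ r" using real_arch_pow[of 2 q] by (auto intro: less_imp_le)
  define r where "r = (LEAST r::nat. q \<le> 2 ^ r)"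
  have 1: "q \<le> 2 ^ r" unfolding r_def by (rule LeastI_ex[OF ex])
  have "2 ^ r \<le> 2 * q"
  proof (cases r)
    case (Suc k)
    then have "\<not> q \<le> 2 ^ k" unfolding r_def using not_less_Least[of k] by (metis lessI)
    with Suc show ?thesis by simp
  qed (use assms in simp)
  with 1 that show thesis by blast
qed

text \<open>Here \<open>8 * ln n\<close> stands for the bound on \<open>J + 1\<close>, and
  \<open>c\<close> for \<open>d - 1\<close>. The conditions yield \<open>D \<le> n\<close>,
  condition \<open>E\<close> of \<open>chain_error_le\<close>, whose polynomial order
  \<open>3 / 16 + 2 / 3\<close> is below 1, and the smallness of the probability of the bad
  event.\<close>

lemma rate_conditions:
  assumes "\<epsilon> > 0" "c \<ge> 0"
  shows "\<forall>\<^sub>F n in sequentially. (8 * ln (real n)) powr c \<le> real n \<and>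
    8 * ln (real n) * (2 * real n ^ 3) powr (1 / 16) * (real n * (8 * ln (real n)) powr c) powr (2 / 3) \<le> real n \<and>
    (8 * ln (real n)) powr c / real n + 3 / real n powr (1 / 3) \<le> \<epsilon>"
proof -
  have 1: "\<forall>\<^sub>F n in sequentially. (8 * ln (real n)) powr c \<le> real n"
    by real_asymp
  have 2: "\<forall>\<^sub>F n in sequentially.
    8 * ln (real n) * (2 * real n ^ 3) powr (1 / 16) * (real n * (8 * ln (real n)) powr c) powr (2 / 3) \<le> real n"
    by real_asymp
  have "((\<lambda>n. (8 * ln (real n)) powr c / real n + 3 / real n powr (1 / 3)) \<longlongrightarrow> 0) sequentially"
    by real_asymp
  from order_tendstoD(2)[OF this assms(1)]
  have 3: "\<forall>\<^sub>F n in sequentially. (8 * ln (real n)) powr c / real n + 3 / real n powr (1 / 3) \<le> \<epsilon>"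
    by eventually_elim simp
  show ?thesis using 1 2 3 by eventually_elim simp
qed

theorem theorem1:
  fixes M :: "'w measure"
    and P0 :: "((real ^ 'd::finite) \<times> real) measure"
    and obs :: "nat \<Rightarrow> 'w \<Rightarrow> (real ^ 'd) \<times> real"
    and \<O> :: "((real ^ 'd) \<times> real) set"
    and \<Y> :: "real set"
    and \<Theta> :: "(real ^ 'd \<Rightarrow> real) set"
    and L :: "(real ^ 'd \<Rightarrow> real) \<Rightarrow> (real ^ 'd) \<times> real \<Rightarrow> real"
    and \<theta>0 :: "real ^ 'd \<Rightarrow> real"
    and \<Theta>n :: "nat \<Rightarrow> (real ^ 'd \<Rightarrow> real) set"
    and a :: "nat \<Rightarrow> real"
    and \<theta>n :: "nat \<Rightarrow> real ^ 'd \<Rightarrow> real"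
    and \<theta>hat :: "nat \<Rightarrow> 'w \<Rightarrow> real ^ 'd \<Rightarrow> real"
  assumes obs_space: "\<O> \<subseteq> cbox 0 1 \<times> \<Y>"
    and P0: "prob_space P0" "sets P0 = sets (restrict_space borel \<O>)"
    and M: "prob_space M"
    and indep: "prob_space.indep_vars M (\<lambda>_. P0) obs {1..}"
    and ident: "\<And>i. i \<ge> 1 \<Longrightarrow> distr M P0 (obs i) = P0"
    and \<Theta>: "\<And>\<theta>. \<theta> \<in> \<Theta> \<Longrightarrow> \<theta> \<in> cadlag_cube \<and> sectional_variation_norm \<theta> < \<infinity>"
    and risk_defined: "\<And>\<theta>. \<theta> \<in> \<Theta> \<Longrightarrow> integrable P0 (L \<theta>)"
    and \<theta>0: "is_arg_min (risk P0 L) (\<lambda>\<theta>. \<theta> \<in> \<Theta>) \<theta>0"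
    and \<Theta>n_subset: "\<And>n. n \<ge> 1 \<Longrightarrow> \<Theta>n n \<subseteq> \<Theta>"
    and \<Theta>n_mono: "\<And>m n. 1 \<le> m \<Longrightarrow> m \<le> n \<Longrightarrow> \<Theta>n m \<subseteq> \<Theta>n n"
    and a_pos: "\<And>n. n \<ge> 1 \<Longrightarrow> a n > 0"
    and a_mono: "\<And>m n. 1 \<le> m \<Longrightarrow> m \<le> n \<Longrightarrow> a m \<le> a n"
    and a_growth: "\<exists>p>0. a \<in> O(\<lambda>n. real n powr p)"
    and \<theta>n: "\<And>n. n \<ge> 1 \<Longrightarrow> is_arg_min (risk P0 L) (\<lambda>\<theta>. \<theta> \<in> \<Theta>n n) (\<theta>n n)"
    and \<theta>hat: "\<And>n \<omega>. n \<ge> 1 \<Longrightarrow> \<omega> \<in> space M \<Longrightarrow>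
        is_arg_min (empirical_risk (\<lambda>i. obs i \<omega>) n L) (\<lambda>\<theta>. \<theta> \<in> \<Theta>n n) (\<theta>hat n \<omega>)"
    and A1: "\<And>n. n \<ge> 1 \<Longrightarrow>
        \<Theta>n n \<subseteq> {\<theta> \<in> cadlag_cube. sectional_variation_norm \<theta> \<le> ennreal (a n)}"
    and A2: "\<exists>Lt :: real \<Rightarrow> real \<Rightarrow> real.
        (\<forall>n\<ge>1. \<forall>\<theta>\<in>\<Theta>n n. \<forall>x\<in>cbox 0 1. \<forall>y\<in>\<Y>. L \<theta> (x, y) = Lt (\<theta> x) y) \<and>
        (\<forall>y\<in>\<Y>. \<exists>u\<^sub>y. antimono_on {..u\<^sub>y} (\<lambda>u. Lt u y) \<and> mono_on {u\<^sub>y..} (\<lambda>u. Lt u y) \<and>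
           (\<forall>n\<ge>1. (a n)-lipschitz_on UNIV (\<lambda>u. Lt u y)))"
    and A3: "\<And>n \<theta>. n \<ge> 1 \<Longrightarrow> \<theta> \<in> \<Theta>n n \<Longrightarrow>
        norm_L2 P0 (\<lambda>z. L \<theta> z - L (\<theta>n n) z) \<le> a n * loss_dissim P0 L \<theta> (\<theta>n n)"
    and \<theta>0_eventually: "\<theta>0 \<in> {\<theta> \<in> \<Theta>. \<exists>n0. \<forall>n\<ge>n0. \<theta> \<in> \<Theta>n n}"
  shows "bounded_in_prob M (\<lambda>n \<omega>. loss_dissim P0 L (\<theta>hat n \<omega>) \<theta>0)
           (\<lambda>n. a n * real n powr (- 1 / 3) * ln (real n) powr (2 * (real CARD('d) - 1) / 3))"
proof -
  interpret M: prob_space M by fact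
  define d1 where "d1 = CARD('d) - 1"
  have d1: "real CARD('d) - 1 = real d1" by (simp add: d1_def of_nat_diff Suc_leI)
  obtain Lt :: "real \<Rightarrow> real \<Rightarrow> real" where
    Lt: "\<And>n \<theta> x y. n \<ge> 1 \<Longrightarrow> \<theta> \<in> \<Theta>n n \<Longrightarrow> x \<in> cbox 0 1 \<Longrightarrow> y \<in> \<Y> \<Longrightarrow> L \<theta> (x, y) = Lt (\<theta> x) y"
    and lip: "\<And>n y. n \<ge> 1 \<Longrightarrow> y \<in> \<Y> \<Longrightarrow> (a n)-lipschitz_on UNIV (\<lambda>u. Lt u y)"
    using A2 by metis
  obtain n0 where n0: "\<And>n. n \<ge> n0 \<Longrightarrow> \<theta>0 \<in> \<Theta>n n" using \<theta>0_eventually by blast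
  define K where "K = sqrt (2 * rate_const)"
  have rc: "rate_const > 0" using chain_const_ge_2 unfolding rate_const_def by (simp add: add_pos_pos)
  have K: "K > 0" using rc by (simp add: K_def)
  \<comment> \<open>One constant serves all \<open>\<epsilon>\<close>, because the probability of
    the bad event tends to 0. The power of 8 comes from \<open>D \<le> (8 * ln n) powr d1\<close>,
    which enters the rate with exponent \<open>2 / 3\<close>.\<close>
  define C where "C = K * 8 powr (2 * real d1 / 3)"
  have C: "C > 0" using K by (simp add: C_def)
  show ?thesis
    unfolding bounded_in_prob_def
  proof (intro allI impI exI[of _ C] conjI C)
    fix \<epsilon> :: real assume \<epsilon>: "\<epsilon> > 0"
    let ?E = "\<lambda>n. {\<omega> \<in> space M. C * (a n * real n powr (- 1 / 3) * ln (real n) powr (2 * (real CARD('d) - 1) / 3))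
         < \<bar>loss_dissim P0 L (\<theta>hat n \<omega>) \<theta>0\<bar>}"
    show "\<forall>\<^sub>F n in sequentially. outer_measure_of M (?E n) \<le> ennreal \<epsilon>"
      using rate_conditions[OF \<epsilon> of_nat_0_le_iff[of d1]] eventually_ge_at_top[of "max 3 n0"]
    proof eventually_elim
      case (elim n)
      then have n3: "n \<ge> 3" and nn0: "n \<ge> n0" and n1: "n \<ge> 1" by auto
      note e1 = elim(1)[THEN conjunct1] and e2 = elim(1)[THEN conjunct2, THEN conjunct1] and e3 = elim(1)[THEN conjunct2, THEN conjunct2]
      have rn: "real n \<ge> 3" using n3 by simp
      \<comment> \<open>From 3 on \<open>ln n\<close> is at least 1, so additive constants can be
        absorbed into \<open>8 * ln n\<close>.\<close>
      have "exp 1 \<le> real n" using exp_le rn by linarith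
      then have ln1: "ln (real n) \<ge> 1" using rn by (subst ln_ge_iff) auto
      have a: "a n > 0" by (rule a_pos[OF n1])
      have cube: "real n ^ 3 \<ge> 1" using rn by (intro one_le_power) simp
      \<comment> \<open>Deepest cells of mass at most \<open>n ^ -3\<close> turn the collision
        probability \<open>D * n ^ 2 / 2 ^ J\<close> into at most \<open>D / n\<close>, while
        \<open>J\<close> remains logarithmic in \<open>n\<close>.\<close>
      obtain J where J: "real n ^ 3 \<le> 2 ^ J" "2 ^ J \<le> 2 * real n ^ 3" by (rule power_of_two_between[OF cube])
      have J8: "real J + 1 \<le> 8 * ln (real n)"
      proof -
        have "real J * ln 2 = ln (2 ^ J)" by (simp add: ln_realpow)
        also have "\<dots> \<le> ln (2 * real n ^ 3)" using J rn by (subst ln_le_cancel_iff) auto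
        also have "\<dots> = ln 2 + 3 * ln (real n)" using rn by (simp add: ln_mult ln_realpow)
        finally have "(real J - 1) * ln 2 \<le> 3 * ln (real n)" by (simp add: algebra_simps)
        moreover have "(real J - 1) * (2 / 3) \<le> (real J - 1) * ln 2" if "J \<ge> 1"
          using ln2_ge_two_thirds that by (intro mult_left_mono) auto
        ultimately have "J \<ge> 1 \<longrightarrow> (real J - 1) * (2 / 3) \<le> 3 * ln (real n)" by auto
        then show ?thesis using ln1 by (cases "J \<ge> 1") auto
      qed
      define D where "D = (real J + 1) ^ (CARD('d) - 1)"
      have D1: "D \<ge> 1" unfolding D_def by (intro one_le_power) simp
      have "D \<le> (8 * ln (real n)) ^ d1" unfolding D_def d1_def using J8 by (intro power_mono) auto
      also have "\<dots> = (8 * ln (real n)) powr real d1" using ln1 by (subst powr_realpow) auto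
      finally have Dle: "D \<le> (8 * ln (real n)) powr real d1" .
      then have Dn: "D \<le> real n" using e1 by linarith
      have nD: "real n * D \<ge> 1" using rn D1 mult_mono[of 1 "real n" 1 D] by simp
      define q where "q = (real n * D) powr (1 / 3)"
      have q1: "q \<ge> 1" unfolding q_def using nD by (intro ge_one_powr_ge_zero) auto
      have q3: "q ^ 3 = real n * D"
      proof -
        have "q ^ 3 = q powr real 3" using q1 by (subst powr_realpow) auto
        then show ?thesis using nD by (simp add: q_def powr_powr)
      qed
      have q2: "q\<^sup>2 = (real n * D) powr (2 / 3)"
      proof -
        have "q\<^sup>2 = q powr real 2" using q1 by (subst powr_realpow) auto
        then show ?thesis by (simp add: q_def powr_powr)
      qed
      have qn: "real n powr (1 / 3) \<le> q"
        unfolding q_def using rn D1 by (intro powr_mono2) auto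
      obtain r0 where r0: "q \<le> 2 ^ r0" "2 ^ r0 \<le> 2 * q" by (rule power_of_two_between[OF q1])
      have "q ^ 3 \<le> real n ^ 3"
      proof -
        have "q ^ 3 \<le> real n * real n" unfolding q3 using Dn by (intro mult_left_mono) auto
        also have "\<dots> \<le> real n ^ 3" using power_increasing[of 2 3 "real n"] rn by (simp add: power2_eq_square)
        finally show ?thesis .
      qed
      then have "q \<le> real n" using q1 power_mono_iff[of q "real n" 3] by auto
      then have "2 ^ r0 \<le> 2 * real n" using r0 by linarith
      also have "\<dots> \<le> real n ^ 2" using rn by (simp add: power2_eq_square mult_right_mono)
      also have "\<dots> \<le> real n ^ 3" using rn by (intro power_increasing) auto
      also note J(1)
      finally have "r0 \<le> J" by simp
      have E: "(real J + 1) * 2 powr (real J / 16) * q\<^sup>2 \<le> real n"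
      proof -
        have "2 powr (real J / 16) = (2 ^ J) powr (1 / 16)" by (simp add: powr_powr flip: powr_realpow)
        also have "\<dots> \<le> (2 * real n ^ 3) powr (1 / 16)" using J by (intro powr_mono2) auto
        finally have "2 powr (real J / 16) \<le> (2 * real n ^ 3) powr (1 / 16)" .
        moreover have "q\<^sup>2 \<le> (real n * (8 * ln (real n)) powr real d1) powr (2 / 3)"
          unfolding q2 using Dle D1 by (intro powr_mono2 mult_left_mono) auto
        ultimately have "(real J + 1) * 2 powr (real J / 16) * q\<^sup>2 \<le>
          8 * ln (real n) * (2 * real n ^ 3) powr (1 / 16) * (real n * (8 * ln (real n)) powr real d1) powr (2 / 3)"
          using J8 by (intro mult_mono) auto
        also note e2
        finally show ?thesis .
      qed
      have sub: "\<theta> \<in> \<Theta>" if "\<theta> \<in> \<Theta>n n" for \<theta> using \<Theta>n_subset[OF n1] that by blast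
      have \<theta>nT: "\<theta>n n \<in> \<Theta>n n" and \<theta>n_min: "\<And>\<theta>. \<theta> \<in> \<Theta>n n \<Longrightarrow> risk P0 L (\<theta>n n) \<le> risk P0 L \<theta>"
        using \<theta>n[OF n1] by (auto simp: is_arg_min_def not_less)
      \<comment> \<open>From \<open>n0\<close> on \<open>\<theta>0\<close> belongs to the sieve, so
        the two minimal risks agree and the dissimilarity to \<open>\<theta>0\<close> is the one to
        \<open>\<theta>n n\<close>, to which \<open>A3\<close> applies.\<close>
      have "risk P0 L \<theta>0 \<le> risk P0 L (\<theta>n n)" using \<theta>0 sub[OF \<theta>nT] by (auto simp: is_arg_min_def not_less)
      then have risk_eq: "risk P0 L \<theta>0 = risk P0 L (\<theta>n n)" using \<theta>n_min[OF n0[OF nn0]] by simp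
      have "\<exists>B\<in>sets M. measure M B \<le> D * (real n)\<^sup>2 / 2 ^ J + 3 / 2 ^ r0 \<and>
        (\<forall>\<omega>\<in>space M - B. \<forall>\<theta>\<in>\<Theta>n n.
           excess_deviation P0 (\<lambda>i. obs i \<omega>) n L \<theta> (\<theta>n n)
            \<le> (norm_L2 P0 (\<lambda>z. L \<theta> z - L (\<theta>n n) z))\<^sup>2 / (8 * (a n)\<^sup>2) + rate_const * (a n * (D / q))\<^sup>2)"
        unfolding D_def
      proof (rule finite_sample_bound[OF obs_space P0 M indep ident n1 a])
        show "integrable P0 (L \<theta>)" if "\<theta> \<in> \<Theta>n n" for \<theta> using risk_defined[OF sub[OF that]] .
        show "sectional_variation_norm \<theta> \<le> ennreal (a n)" if "\<theta> \<in> \<Theta>n n" for \<theta> using A1[OF n1] that by blast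
        show "L \<theta> (x, y) = Lt (\<theta> x) y" if "\<theta> \<in> \<Theta>n n" "x \<in> cbox 0 1" "y \<in> \<Y>" for \<theta> x y by (rule Lt[OF n1 that])
        show "(a n)-lipschitz_on UNIV (\<lambda>u. Lt u y)" if "y \<in> \<Y>" for y by (rule lip[OF n1 that])
        show "q > 0" using q1 by simp
      qed (use \<theta>nT \<open>r0 \<le> J\<close> q3 r0 J Dn E in \<open>simp_all add: D_def\<close>)
      then obtain B where B: "B \<in> sets M" "measure M B \<le> D * (real n)\<^sup>2 / 2 ^ J + 3 / 2 ^ r0"
        and good: "\<And>\<omega> \<theta>. \<omega> \<in> space M - B \<Longrightarrow> \<theta> \<in> \<Theta>n n \<Longrightarrow>
           excess_deviation P0 (\<lambda>i. obs i \<omega>) n L \<theta> (\<theta>n n)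
            \<le> (norm_L2 P0 (\<lambda>z. L \<theta> z - L (\<theta>n n) z))\<^sup>2 / (8 * (a n)\<^sup>2) + rate_const * (a n * (D / q))\<^sup>2"
        by blast
      have rate: "D / q \<le> 8 powr (2 * real d1 / 3) * (real n powr (- 1 / 3) * ln (real n) powr (2 * real d1 / 3))"
      proof -
        have "D / q = D powr 1 / (real n powr (1 / 3) * D powr (1 / 3))"
          using D1 by (simp add: q_def powr_mult)
        also have "\<dots> = D powr (2 / 3) * real n powr (- 1 / 3)"
        proof -
          have "D powr 1 = D powr (2 / 3) * D powr (1 / 3)" by (simp flip: powr_add)
          then have "D powr 1 / (real n powr (1 / 3) * D powr (1 / 3))
              = D powr (2 / 3) * D powr (1 / 3) / (real n powr (1 / 3) * D powr (1 / 3))" by (simp only:)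
          also have "\<dots> = D powr (2 / 3) * (1 / real n powr (1 / 3))" using D1 by simp
          also have "1 / real n powr (1 / 3) = real n powr (- 1 / 3)" by (simp add: powr_minus_divide)
          finally show ?thesis .
        qed
        also have "\<dots> \<le> ((8 * ln (real n)) powr real d1) powr (2 / 3) * real n powr (- 1 / 3)"
          using Dle D1 by (intro mult_right_mono powr_mono2) auto
        also have "((8 * ln (real n)) powr real d1) powr (2 / 3) = 8 powr (2 * real d1 / 3) * ln (real n) powr (2 * real d1 / 3)"
          using ln1 by (simp add: powr_powr powr_mult mult.commute)
        finally show ?thesis by (simp add: mult_ac)
      qed
      have "?E n \<subseteq> B"
      proof (rule subsetI, rule ccontr)
        fix \<omega> assume "\<omega> \<in> ?E n" and nB: "\<omega> \<notin> B"
        then have \<omega>: "\<omega> \<in> space M" and large: "C * (a n * real n powr (- 1 / 3) * ln (real n) powr (2 * real d1 / 3))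
           < \<bar>loss_dissim P0 L (\<theta>hat n \<omega>) \<theta>0\<bar>" by (auto simp: d1)
        define \<theta> where "\<theta> = \<theta>hat n \<omega>"
        have \<theta>T: "\<theta> \<in> \<Theta>n n" and erm: "empirical_risk (\<lambda>i. obs i \<omega>) n L \<theta> \<le> empirical_risk (\<lambda>i. obs i \<omega>) n L (\<theta>n n)"
          using \<theta>hat[OF n1 \<omega>] \<theta>nT by (auto simp: is_arg_min_def not_less \<theta>_def)
        define X where "X = risk P0 L \<theta> - risk P0 L (\<theta>n n)"
        have X0: "X \<ge> 0" using \<theta>n_min[OF \<theta>T] by (simp add: X_def)
        have "norm_L2 P0 (\<lambda>z. L \<theta> z - L (\<theta>n n) z) \<le> a n * sqrt X"
          using A3[OF n1 \<theta>T] by (simp add: loss_dissim_def X_def)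
        moreover have "norm_L2 P0 (\<lambda>z. L \<theta> z - L (\<theta>n n) z) \<ge> 0" by (simp add: norm_L2_def)
        ultimately have "(norm_L2 P0 (\<lambda>z. L \<theta> z - L (\<theta>n n) z))\<^sup>2 \<le> (a n * sqrt X)\<^sup>2" by (intro power_mono)
        also have "\<dots> = (a n)\<^sup>2 * X" using X0 by (simp add: power_mult_distrib)
        finally have "(norm_L2 P0 (\<lambda>z. L \<theta> z - L (\<theta>n n) z))\<^sup>2 / (8 * (a n)\<^sup>2) \<le> X / 8"
          using a by (simp add: field_simps)
        moreover have "excess_deviation P0 (\<lambda>i. obs i \<omega>) n L \<theta> (\<theta>n n)
            \<le> (norm_L2 P0 (\<lambda>z. L \<theta> z - L (\<theta>n n) z))\<^sup>2 / (8 * (a n)\<^sup>2) + rate_const * (a n * (D / q))\<^sup>2"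
          by (rule good) (use \<omega> nB \<theta>T in auto)
        \<comment> \<open>The empirical excess of \<open>\<theta>hat\<close> is at most 0, so
          \<open>X\<close> is bounded by the deviation. By \<open>A3\<close> the variance term is at
          most \<open>X / 8\<close> and is moved to the left.\<close>
        ultimately have "X \<le> X / 8 + rate_const * (a n * (D / q))\<^sup>2"
          using erm unfolding X_def excess_deviation_def by linarith
        then have "X \<le> 2 * rate_const * (a n * (D / q))\<^sup>2"
          using rc zero_le_power2[of "a n * (D / q)"] mult_nonneg_nonneg[of rate_const "(a n * (D / q))\<^sup>2"] by linarith
        then have "sqrt X \<le> sqrt (2 * rate_const * (a n * (D / q))\<^sup>2)" by simp
        also have "\<dots> = K * (a n * (D / q))" using a D1 q1 by (simp add: K_def real_sqrt_mult)
        also have "\<dots> \<le> K * (a n * (8 powr (2 * real d1 / 3) * (real n powr (- 1 / 3) * ln (real n) powr (2 * real d1 / 3))))"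
          using K a by (intro mult_left_mono rate) auto
        also have "\<dots> = C * (a n * real n powr (- 1 / 3) * ln (real n) powr (2 * real d1 / 3))" by (simp add: C_def mult_ac)
        finally have "\<bar>loss_dissim P0 L (\<theta>hat n \<omega>) \<theta>0\<bar> \<le> C * (a n * real n powr (- 1 / 3) * ln (real n) powr (2 * real d1 / 3))"
          using X0 by (simp add: loss_dissim_def risk_eq X_def \<theta>_def)
        with large show False by linarith
      qed
      \<comment> \<open>The event may fail to be measurable; \<open>B\<close> is a measurable set
        that covers it.\<close>
      then have "outer_measure_of M (?E n) \<le> emeasure M B"
        unfolding outer_measure_of_def using B(1) by (intro INF_lower) auto
      also have "emeasure M B = ennreal (measure M B)" by (simp add: M.emeasure_eq_measure)
      also have "measure M B \<le> \<epsilon>"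
      proof -
        have "D * (real n)\<^sup>2 / 2 ^ J \<le> D * (real n)\<^sup>2 / real n ^ 3"
          using J rn D1 by (intro divide_left_mono) auto
        also have "\<dots> = D / real n" using rn by (simp add: power2_eq_square power3_eq_cube)
        also have "\<dots> \<le> (8 * ln (real n)) powr real d1 / real n" using Dle by (intro divide_right_mono) auto
        finally have 1: "D * (real n)\<^sup>2 / 2 ^ J \<le> (8 * ln (real n)) powr real d1 / real n" .
        have "real n powr (1 / 3) \<le> 2 ^ r0" using qn r0 by linarith
        then have "3 / 2 ^ r0 \<le> 3 / real n powr (1 / 3)" using rn by (intro divide_left_mono) auto
        with 1 B(2) e3 show ?thesis by linarith
      qed
      then have "ennreal (measure M B) \<le> ennreal \<epsilon>" by (rule ennreal_leI)
      finally show ?case .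
    qed
  qed
qed

end
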